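(* Let $\mathcal{A}$ be an essentially small additive category and let $S$ be a set of morphisms of $\mathcal{A}$ that contains all identity morphisms of objects of $\mathcal{A}$ and is closed with respect to the direct sum operation (if $s,t\in S$ then $s\oplus t\in S$). Then the natural functor $Q:\mathcal{A}[S^{-1}]\to\mathcal{A}[S^{-1}]_{add}$ is an isomorphism of categories.
   Context: $\mathcal{A}[S^{-1}]$ is the "abstract" (Gabriel–Zisman) localization: the target of the initial functor among all functors from $\mathcal{A}$ that send every element of $S$ to an isomorphism; its objects are those of $\mathcal{A}$. $\mathcal{A}[S^{-1}]_{add}$ is defined as follows. Let $K^b(\mathcal{A})$ be the homotopy category of bounded complexes over $\mathcal{A}$, let $\mathcal{D}$ be the smallest full strict triangulated subcategory of $K^b(\mathcal{A})$ containing the cones $X\xrightarrow{s}Y$ of all $s\in S$. Then $\mathcal{A}[S^{-1}]_{add}$ is the full subcategory of the Verdier quotient $K^b(\mathcal{A})/\mathcal{D}$ whose objects are those of $\mathcal{A}$ (as complexes concentrated in degree $0$). The functor $\mathcal{A}\to\mathcal{A}[S^{-1}]_{add}$ induced by the localization functor makes all elements of $S$ invertible, so it induces a natural functor $Q:\mathcal{A}[S^{-1}]\to\mathcal{A}[S^{-1}]_{add}$, which is the identity on objects. *)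

theory Defs
  imports "HOL-Algebra.Group"
begin

section \<open>Categories and functors\<close>

text \<open>Objects and morphisms form sets inside arbitrary types, so every category here is small
  and essential smallness needs no separate assumption.  \<open>Comp C g f\<close> is the composite
  of \<open>f\<close> followed by \<open>g\<close>.\<close>

record ('o, 'm) cat =
  Ob :: "'o set"
  Arr :: "'m set"
  Dom :: "'m \<Rightarrow> 'o"
  Cod :: "'m \<Rightarrow> 'o"
  Ident :: "'o \<Rightarrow> 'm"
  Comp :: "'m \<Rightarrow> 'm \<Rightarrow> 'm"

definition Hom :: "('o, 'm, 'x) cat_scheme \<Rightarrow> 'o \<Rightarrow> 'o \<Rightarrow> 'm set" where
  "Hom C X Y = {f \<in> Arr C. Dom C f = X \<and> Cod C f = Y}"

locale category =
  fixes C :: "('o, 'm, 'x) cat_scheme"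
  assumes Dom_Ob: "f \<in> Arr C \<Longrightarrow> Dom C f \<in> Ob C"
    and Cod_Ob: "f \<in> Arr C \<Longrightarrow> Cod C f \<in> Ob C"
    and Ident_Hom: "X \<in> Ob C \<Longrightarrow> Ident C X \<in> Hom C X X"
    and Comp_Hom: "f \<in> Hom C X Y \<Longrightarrow> g \<in> Hom C Y Z \<Longrightarrow> Comp C g f \<in> Hom C X Z"
    and Comp_Ident: "f \<in> Hom C X Y \<Longrightarrow> Comp C f (Ident C X) = f"
    and Ident_Comp: "f \<in> Hom C X Y \<Longrightarrow> Comp C (Ident C Y) f = f"
    and Comp_assoc: "f \<in> Hom C X Y \<Longrightarrow> g \<in> Hom C Y Z \<Longrightarrow> h \<in> Hom C Z W \<Longrightarrow>
      Comp C h (Comp C g f) = Comp C (Comp C h g) f"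

definition inverse_arrows :: "('o, 'm, 'x) cat_scheme \<Rightarrow> 'm \<Rightarrow> 'm \<Rightarrow> bool" where
  "inverse_arrows C f g \<longleftrightarrow> f \<in> Arr C \<and> g \<in> Hom C (Cod C f) (Dom C f) \<and>
     Comp C g f = Ident C (Dom C f) \<and> Comp C f g = Ident C (Cod C f)"

definition is_iso :: "('o, 'm, 'x) cat_scheme \<Rightarrow> 'm \<Rightarrow> bool" where
  "is_iso C f \<longleftrightarrow> (\<exists>g. inverse_arrows C f g)"

definition inv_arrow :: "('o, 'm, 'x) cat_scheme \<Rightarrow> 'm \<Rightarrow> 'm" where
  "inv_arrow C f = (THE g. inverse_arrows C f g)"

definition isomorphic :: "('o, 'm, 'x) cat_scheme \<Rightarrow> 'o \<Rightarrow> 'o \<Rightarrow> bool" where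
  "isomorphic C X Y \<longleftrightarrow> (\<exists>f \<in> Hom C X Y. is_iso C f)"

definition zero_object :: "('o, 'm, 'x) cat_scheme \<Rightarrow> 'o \<Rightarrow> bool" where
  "zero_object C Z \<longleftrightarrow> Z \<in> Ob C \<and>
     (\<forall>X \<in> Ob C. (\<exists>!f. f \<in> Hom C X Z) \<and> (\<exists>!f. f \<in> Hom C Z X))"

definition full_subcat :: "('o, 'm) cat \<Rightarrow> 'o set \<Rightarrow> ('o, 'm) cat" where
  "full_subcat C P = C\<lparr>Ob := Ob C \<inter> P, Arr := {f \<in> Arr C. Dom C f \<in> P \<and> Cod C f \<in> P}\<rparr>"

record ('o, 'm, 'p, 'n) fctr =
  ObMap :: "'o \<Rightarrow> 'p"
  ArrMap :: "'m \<Rightarrow> 'n"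

locale is_functor = dom: category C + cod: category D
  for C :: "('o, 'm, 'x) cat_scheme" and D :: "('p, 'n, 'y) cat_scheme"
    and F :: "('o, 'm, 'p, 'n) fctr" +
  assumes ObMap_Ob: "X \<in> Ob C \<Longrightarrow> ObMap F X \<in> Ob D"
    and ArrMap_Hom: "f \<in> Hom C X Y \<Longrightarrow> ArrMap F f \<in> Hom D (ObMap F X) (ObMap F Y)"
    and ArrMap_Ident: "X \<in> Ob C \<Longrightarrow> ArrMap F (Ident C X) = Ident D (ObMap F X)"
    and ArrMap_Comp: "f \<in> Hom C X Y \<Longrightarrow> g \<in> Hom C Y Z \<Longrightarrow>
      ArrMap F (Comp C g f) = Comp D (ArrMap F g) (ArrMap F f)"

definition fcomp :: "('p, 'n, 'q, 'k) fctr \<Rightarrow> ('o, 'm, 'p, 'n) fctr \<Rightarrow> ('o, 'm, 'q, 'k) fctr" where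
  "fcomp G F = \<lparr>ObMap = ObMap G \<circ> ObMap F, ArrMap = ArrMap G \<circ> ArrMap F\<rparr>"

definition fid :: "('o, 'm, 'o, 'm) fctr" where
  "fid = \<lparr>ObMap = id, ArrMap = id\<rparr>"

text \<open>Equality of functors with source \<open>C\<close>: values outside \<open>C\<close> are irrelevant.\<close>

definition feq :: "('o, 'm, 'x) cat_scheme \<Rightarrow> ('o, 'm, 'p, 'n) fctr \<Rightarrow> ('o, 'm, 'p, 'n) fctr \<Rightarrow> bool" where
  "feq C F G \<longleftrightarrow> (\<forall>X \<in> Ob C. ObMap F X = ObMap G X) \<and> (\<forall>f \<in> Arr C. ArrMap F f = ArrMap G f)"

definition cat_isomorphism ::
    "('o, 'm, 'x) cat_scheme \<Rightarrow> ('p, 'n, 'y) cat_scheme \<Rightarrow> ('o, 'm, 'p, 'n) fctr \<Rightarrow> bool" where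
  "cat_isomorphism C D F \<longleftrightarrow> is_functor C D F \<and>
     (\<exists>G. is_functor D C G \<and> feq C (fcomp G F) fid \<and> feq D (fcomp F G) fid)"

lemma HomD: "f \<in> Hom C X Y \<Longrightarrow> f \<in> Arr C \<and> Dom C f = X \<and> Cod C f = Y"
  by (simp add: Hom_def)

lemma (in category) Hom_Ob: "f \<in> Hom C X Y \<Longrightarrow> X \<in> Ob C \<and> Y \<in> Ob C"
  using Dom_Ob Cod_Ob by (auto simp: Hom_def)

lemma (in category) inverse_arrows_unique:
  assumes "inverse_arrows C f g" "inverse_arrows C f h"
  shows "g = h"
proof -
  let ?X = "Dom C f" and ?Y = "Cod C f"
  have f: "f \<in> Hom C ?X ?Y" and g: "g \<in> Hom C ?Y ?X" and h: "h \<in> Hom C ?Y ?X"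
    using assms by (auto simp: inverse_arrows_def Hom_def)
  have "g = Comp C g (Comp C f h)"
    using assms(2) Comp_Ident[OF g] by (simp add: inverse_arrows_def)
  also have "\<dots> = Comp C (Comp C g f) h"
    by (rule Comp_assoc[OF h f g])
  also have "\<dots> = h"
    using assms(1) Ident_Comp[OF h] by (simp add: inverse_arrows_def)
  finally show ?thesis .
qed

lemma (in category) inverse_arrows_inv_arrow:
  "is_iso C f \<Longrightarrow> inverse_arrows C f (inv_arrow C f)"
  unfolding is_iso_def inv_arrow_def
  by (metis inverse_arrows_unique theI)

lemma full_subcat_category:
  fixes C' :: "('o, 'm) cat"
  assumes "category C'"
  shows "category (full_subcat C' P)"
proof -
  interpret C': category C' by fact
  have H: "f \<in> Hom (full_subcat C' P) X Y \<longleftrightarrow> f \<in> Hom C' X Y \<and> X \<in> P \<and> Y \<in> P" for f X Y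
    by (auto simp: full_subcat_def Hom_def)
  show ?thesis
    apply unfold_locales
    unfolding H
    by (auto simp: full_subcat_def C'.Dom_Ob C'.Cod_Ob C'.Ident_Hom
      intro: C'.Comp_Hom C'.Comp_Ident C'.Ident_Comp C'.Comp_assoc)
qed


section \<open>Gabriel--Zisman localization\<close>

text \<open>A zigzag is a list of arrows of \<open>C\<close> and of formal inverses of elements of \<open>S\<close>, read in the
  order in which they are traversed.  The localization is the category of zigzags modulo the
  congruence generated by the relations of \<open>C\<close> and by the inversion relations.  The theorem
  \<open>gz_universal\<close> below shows that it has the required initiality property.\<close>

datatype 'm step = Fwd 'm | Bwd 'm

inductive gz_path :: "('o, 'm, 'x) cat_scheme \<Rightarrow> 'm set \<Rightarrow> 'o \<Rightarrow> 'o \<Rightarrow> 'm step list \<Rightarrow> bool"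
  for C S where
    nil: "X \<in> Ob C \<Longrightarrow> gz_path C S X X []"
  | fwd: "f \<in> Arr C \<Longrightarrow> gz_path C S (Cod C f) Y w \<Longrightarrow> gz_path C S (Dom C f) Y (Fwd f # w)"
  | bwd: "s \<in> S \<Longrightarrow> gz_path C S (Dom C s) Y w \<Longrightarrow> gz_path C S (Cod C s) Y (Bwd s # w)"

inductive gz_eq :: "('o, 'm, 'x) cat_scheme \<Rightarrow> 'm set \<Rightarrow> 'o \<Rightarrow> 'o \<Rightarrow> 'm step list \<Rightarrow> 'm step list \<Rightarrow> bool"
  for C S where
    refl: "gz_path C S X Y w \<Longrightarrow> gz_eq C S X Y w w"
  | sym: "gz_eq C S X Y v w \<Longrightarrow> gz_eq C S X Y w v"
  | trans: "gz_eq C S X Y u v \<Longrightarrow> gz_eq C S X Y v w \<Longrightarrow> gz_eq C S X Y u w"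
  | cong: "gz_path C S X X' u \<Longrightarrow> gz_eq C S X' Y' w w' \<Longrightarrow> gz_path C S Y' Y v \<Longrightarrow>
      gz_eq C S X Y (u @ w @ v) (u @ w' @ v)"
  | ident: "X \<in> Ob C \<Longrightarrow> gz_eq C S X X [Fwd (Ident C X)] []"
  | comp: "f \<in> Hom C X Y \<Longrightarrow> g \<in> Hom C Y Z \<Longrightarrow> gz_eq C S X Z [Fwd f, Fwd g] [Fwd (Comp C g f)]"
  | inv_right: "s \<in> S \<Longrightarrow> gz_eq C S (Dom C s) (Dom C s) [Fwd s, Bwd s] []"
  | inv_left: "s \<in> S \<Longrightarrow> gz_eq C S (Cod C s) (Cod C s) [Bwd s, Fwd s] []"

type_synonym ('o, 'm) gz_arr = "'o \<times> 'o \<times> 'm step list set"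

definition gz_class :: "('o, 'm, 'x) cat_scheme \<Rightarrow> 'm set \<Rightarrow> 'o \<Rightarrow> 'o \<Rightarrow> 'm step list \<Rightarrow> ('o, 'm) gz_arr" where
  "gz_class C S X Y w = (X, Y, {w'. gz_eq C S X Y w w'})"

definition gz :: "('o, 'm, 'x) cat_scheme \<Rightarrow> 'm set \<Rightarrow> ('o, ('o, 'm) gz_arr) cat" where
  "gz C S = \<lparr>
     Ob = Ob C,
     Arr = {gz_class C S X Y w | X Y w. gz_path C S X Y w},
     Dom = (\<lambda>(X, Y, c). X),
     Cod = (\<lambda>(X, Y, c). Y),
     Ident = (\<lambda>X. gz_class C S X X []),
     Comp = (\<lambda>(Y, Z, d) (X, Y', c). (X, Z, {u. \<exists>v \<in> c. \<exists>w \<in> d. gz_eq C S X Z (v @ w) u}))\<rparr>"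

definition gz_loc :: "('o, 'm, 'x) cat_scheme \<Rightarrow> 'm set \<Rightarrow> ('o, 'm, 'o, ('o, 'm) gz_arr) fctr" where
  "gz_loc C S = \<lparr>ObMap = id, ArrMap = (\<lambda>f. gz_class C S (Dom C f) (Cod C f) [Fwd f])\<rparr>"

text \<open>The functor induced on the localization by a functor \<open>F\<close> that inverts \<open>S\<close>.  The first
  argument of \<open>gz_eval\<close> after \<open>F\<close> is the source of the zigzag.\<close>

fun gz_eval :: "('o, 'm, 'x) cat_scheme \<Rightarrow> ('p, 'n, 'y) cat_scheme \<Rightarrow> ('o, 'm, 'p, 'n) fctr \<Rightarrow>
    'o \<Rightarrow> 'm step list \<Rightarrow> 'n" where
  "gz_eval C D F X [] = Ident D (ObMap F X)"
| "gz_eval C D F X (Fwd f # w) = Comp D (gz_eval C D F (Cod C f) w) (ArrMap F f)"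
| "gz_eval C D F X (Bwd s # w) = Comp D (gz_eval C D F (Dom C s) w) (inv_arrow D (ArrMap F s))"

definition gz_lift :: "('o, 'm, 'x) cat_scheme \<Rightarrow> ('p, 'n, 'y) cat_scheme \<Rightarrow> ('o, 'm, 'p, 'n) fctr \<Rightarrow>
    ('o, ('o, 'm) gz_arr, 'p, 'n) fctr" where
  "gz_lift C D F = \<lparr>ObMap = ObMap F, ArrMap = (\<lambda>(X, Y, c). the_elem (gz_eval C D F X ` c))\<rparr>"

lemma gz_path_append:
  "gz_path C S X Y u \<Longrightarrow> gz_path C S Y Z v \<Longrightarrow> gz_path C S X Z (u @ v)"
  by (induction rule: gz_path.induct) (auto intro: gz_path.intros)

lemma gz_path_Nil: "gz_path C S X Y [] \<longleftrightarrow> X = Y \<and> X \<in> Ob C"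
  by (auto elim: gz_path.cases intro: gz_path.intros)

lemma gz_path_Fwd:
  "gz_path C S X Y (Fwd f # w) \<longleftrightarrow> f \<in> Arr C \<and> X = Dom C f \<and> gz_path C S (Cod C f) Y w"
  by (auto elim: gz_path.cases intro: gz_path.intros)

lemma gz_path_Bwd:
  "gz_path C S X Y (Bwd s # w) \<longleftrightarrow> s \<in> S \<and> X = Cod C s \<and> gz_path C S (Dom C s) Y w"
  by (auto elim: gz_path.cases intro: gz_path.intros)

lemmas gz_path_simps = gz_path_Nil gz_path_Fwd gz_path_Bwd

context category
begin

context
  fixes S assumes S: "S \<subseteq> Arr C"
begin

lemma gz_path_Ob: "gz_path C S X Y w \<Longrightarrow> X \<in> Ob C \<and> Y \<in> Ob C"
  by (induction rule: gz_path.induct) (use S Dom_Ob Cod_Ob in auto)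

lemma gz_eq_path: "gz_eq C S X Y v w \<Longrightarrow> gz_path C S X Y v \<and> gz_path C S X Y w"
proof (induction rule: gz_eq.induct)
  case (ident X)
  then show ?case using Ident_Hom[of X] by (auto simp: gz_path_simps Hom_def)
next
  case (comp f X Y g Z)
  then show ?case
    using Comp_Hom[OF comp] Hom_Ob[OF comp(1)] Hom_Ob[OF comp(2)]
    by (auto simp: gz_path_simps Hom_def)
next
  case (inv_right s)
  then show ?case using S Dom_Ob Cod_Ob by (auto simp: gz_path_simps)
next
  case (inv_left s)
  then show ?case using S Dom_Ob Cod_Ob by (auto simp: gz_path_simps)
qed (auto intro: gz_path_append)

lemma gz_eq_append:
  assumes "gz_eq C S X Y v v'" "gz_eq C S Y Z w w'"
  shows "gz_eq C S X Z (v @ w) (v' @ w')"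
proof -
  have p: "gz_path C S X X []" "gz_path C S Z Z []"
    using assms gz_eq_path gz_path_Ob by (meson gz_path.nil)+
  have "gz_eq C S X Z ([] @ v @ w) ([] @ v' @ w)"
    using p assms gz_eq_path by (blast intro: gz_eq.cong)
  moreover have "gz_eq C S X Z (v' @ w @ []) (v' @ w' @ [])"
    using p assms gz_eq_path by (blast intro: gz_eq.cong)
  ultimately show ?thesis by (auto intro: gz_eq.trans)
qed

lemma gz_class_eq_iff:
  "gz_path C S X Y v \<Longrightarrow>
    gz_class C S X Y v = gz_class C S X Y w \<longleftrightarrow> gz_eq C S X Y v w"
  unfolding gz_class_def by (auto intro: gz_eq.refl gz_eq.sym gz_eq.trans)

lemma gz_Hom_iff: "a \<in> Hom (gz C S) X Y \<longleftrightarrow> (\<exists>w. gz_path C S X Y w \<and> a = gz_class C S X Y w)"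
  by (auto simp: gz_def Hom_def gz_class_def)

lemma gz_Comp:
  assumes "gz_path C S X Y v" "gz_path C S Y Z w"
  shows "Comp (gz C S) (gz_class C S Y Z w) (gz_class C S X Y v) = gz_class C S X Z (v @ w)"
proof -
  have "(\<exists>v'. gz_eq C S X Y v v' \<and> (\<exists>w'. gz_eq C S Y Z w w' \<and> gz_eq C S X Z (v' @ w') u))
      \<longleftrightarrow> gz_eq C S X Z (v @ w) u" for u
    using assms by (meson gz_eq.refl gz_eq.trans gz_eq_append)
  then show ?thesis by (auto simp: gz_def gz_class_def)
qed

lemma gz_Ob [simp]: "Ob (gz C S) = Ob C"
  by (simp add: gz_def)

lemma gz_Ident [simp]: "Ident (gz C S) X = gz_class C S X X []"
  by (simp add: gz_def)

theorem gz_category: "category (gz C S)"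
proof
  fix f assume "f \<in> Arr (gz C S)"
  then show "Dom (gz C S) f \<in> Ob (gz C S)" "Cod (gz C S) f \<in> Ob (gz C S)"
    using gz_path_Ob by (auto simp: gz_def gz_class_def)
next
  fix X assume "X \<in> Ob (gz C S)"
  then show "Ident (gz C S) X \<in> Hom (gz C S) X X"
    by (auto simp: gz_Hom_iff intro: gz_path.nil)
next
  fix f g X Y Z assume "f \<in> Hom (gz C S) X Y" "g \<in> Hom (gz C S) Y Z"
  then show "Comp (gz C S) g f \<in> Hom (gz C S) X Z"
    by (auto simp: gz_Hom_iff gz_Comp intro: gz_path_append)
next
  fix f X Y assume f: "f \<in> Hom (gz C S) X Y"
  then obtain w where w: "gz_path C S X Y w" "f = gz_class C S X Y w"
    by (auto simp: gz_Hom_iff)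
  then have "gz_path C S X X []" "gz_path C S Y Y []"
    using gz_path_Ob by (auto intro: gz_path.nil)
  with w show "Comp (gz C S) f (Ident (gz C S) X) = f" "Comp (gz C S) (Ident (gz C S) Y) f = f"
    by (auto simp: gz_Comp)
next
  fix f g h X Y Z W
  assume "f \<in> Hom (gz C S) X Y" "g \<in> Hom (gz C S) Y Z" "h \<in> Hom (gz C S) Z W"
  then show "Comp (gz C S) h (Comp (gz C S) g f) = Comp (gz C S) (Comp (gz C S) h g) f"
    by (auto simp: gz_Hom_iff gz_Comp gz_path_append)
qed

lemma gz_path_single_Fwd: "f \<in> Hom C X Y \<Longrightarrow> gz_path C S X Y [Fwd f]"
  using Hom_Ob by (fastforce simp: gz_path_simps Hom_def)

theorem gz_loc_functor: "is_functor C (gz C S) (gz_loc C S)"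
proof -
  interpret L: category "gz C S" by (rule gz_category)
  show ?thesis
  proof
    fix X assume "X \<in> Ob C"
    then show "ObMap (gz_loc C S) X \<in> Ob (gz C S)" by (simp add: gz_loc_def)
  next
    fix f X Y assume "f \<in> Hom C X Y"
    then show "ArrMap (gz_loc C S) f \<in> Hom (gz C S) (ObMap (gz_loc C S) X) (ObMap (gz_loc C S) Y)"
      using gz_path_single_Fwd[of f X Y] HomD[of f C X Y] by (auto simp: gz_loc_def gz_Hom_iff)
  next
    fix X assume X: "X \<in> Ob C"
    then show "ArrMap (gz_loc C S) (Ident C X) = Ident (gz C S) (ObMap (gz_loc C S) X)"
      using Ident_Hom[OF X] gz_path_single_Fwd[OF Ident_Hom[OF X]] HomD[OF Ident_Hom[OF X]]
      by (auto simp: gz_loc_def gz_class_eq_iff intro: gz_eq.ident)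
  next
    fix f g X Y Z assume f: "f \<in> Hom C X Y" and g: "g \<in> Hom C Y Z"
    note gf = Comp_Hom[OF f g]
    show "ArrMap (gz_loc C S) (Comp C g f)
        = Comp (gz C S) (ArrMap (gz_loc C S) g) (ArrMap (gz_loc C S) f)"
      using gz_eq.comp[OF f g, of S] gz_path_single_Fwd[OF f] gz_path_single_Fwd[OF g]
        gz_path_single_Fwd[OF gf] HomD[OF f] HomD[OF g] HomD[OF gf]
      by (auto simp: gz_loc_def gz_Comp gz_class_eq_iff intro: gz_eq.sym)
  qed
qed

lemma gz_inverse:
  assumes s: "s \<in> S"
  shows "inverse_arrows (gz C S) (ArrMap (gz_loc C S) s) (gz_class C S (Cod C s) (Dom C s) [Bwd s])"
proof -
  have p: "gz_path C S (Dom C s) (Cod C s) [Fwd s]" "gz_path C S (Cod C s) (Dom C s) [Bwd s]"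
    using s S Dom_Ob Cod_Ob by (auto simp: gz_path_simps)
  have DC: "Dom (gz C S) (gz_class C S X Y w) = X" "Cod (gz C S) (gz_class C S X Y w) = Y" for X Y w
    by (auto simp: gz_def gz_class_def)
  have H: "gz_class C S (Dom C s) (Cod C s) [Fwd s] \<in> Hom (gz C S) (Dom C s) (Cod C s)"
    "gz_class C S (Cod C s) (Dom C s) [Bwd s] \<in> Hom (gz C S) (Cod C s) (Dom C s)"
    using p unfolding gz_Hom_iff by blast+
  have E: "gz_class C S (Dom C s) (Dom C s) ([Fwd s] @ [Bwd s]) = gz_class C S (Dom C s) (Dom C s) []"
    "gz_class C S (Cod C s) (Cod C s) ([Bwd s] @ [Fwd s]) = gz_class C S (Cod C s) (Cod C s) []"
    using gz_eq.inv_left[OF s, of C] gz_eq.inv_right[OF s, of C]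
      gz_path_append[OF p] gz_path_append[OF p(2,1)] by (simp_all add: gz_class_eq_iff)
  show ?thesis
    using H HomD[OF H(1)] E
    by (simp add: inverse_arrows_def gz_loc_def DC gz_Comp[OF p] gz_Comp[OF p(2,1)])
qed

theorem gz_loc_inverts: "s \<in> S \<Longrightarrow> is_iso (gz C S) (ArrMap (gz_loc C S) s)"
  unfolding is_iso_def using gz_inverse by blast

lemma functor_eval:
  assumes G: "is_functor (gz C S) D G" and F: "feq C (fcomp G (gz_loc C S)) F"
    and w: "gz_path C S X Y w"
  shows "ArrMap G (gz_class C S X Y w) = gz_eval C D F X w"
proof -
  interpret G: is_functor "gz C S" D G by fact
  have GO: "ObMap G X = ObMap F X" if "X \<in> Ob C" for X
    using F that by (auto simp: feq_def fcomp_def gz_loc_def)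
  have GA: "ArrMap G (ArrMap (gz_loc C S) f) = ArrMap F f" if "f \<in> Arr C" for f
    using F that by (auto simp: feq_def fcomp_def)
  show ?thesis using w
  proof (induction rule: gz_path.induct)
    case (nil X)
    then show ?case using G.ArrMap_Ident[of X] GO[of X] by simp
  next
    case (fwd f Y w)
    have p: "gz_path C S (Dom C f) (Cod C f) [Fwd f]"
      using fwd Cod_Ob by (auto simp: gz_path_simps)
    have "ArrMap G (gz_class C S (Dom C f) Y (Fwd f # w))
       = ArrMap G (Comp (gz C S) (gz_class C S (Cod C f) Y w) (gz_class C S (Dom C f) (Cod C f) [Fwd f]))"
      using gz_Comp[OF p fwd(2)] by simp
    also have "\<dots> = Comp D (ArrMap G (gz_class C S (Cod C f) Y w)) (ArrMap G (gz_class C S (Dom C f) (Cod C f) [Fwd f]))"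
      using p fwd by (intro G.ArrMap_Comp) (auto simp: gz_Hom_iff)
    finally show ?case using fwd GA[of f] by (simp add: gz_loc_def)
  next
    case (bwd s Y w)
    let ?b = "gz_class C S (Cod C s) (Dom C s) [Bwd s]"
    let ?f = "gz_class C S (Dom C s) (Cod C s) [Fwd s]"
    have s: "s \<in> Arr C" using bwd S by auto
    have p: "gz_path C S (Cod C s) (Dom C s) [Bwd s]" "gz_path C S (Dom C s) (Cod C s) [Fwd s]"
      using bwd s Cod_Ob Dom_Ob by (auto simp: gz_path_simps)
    have H: "?b \<in> Hom (gz C S) (Cod C s) (Dom C s)" "?f \<in> Hom (gz C S) (Dom C s) (Cod C s)"
      using p by (auto simp: gz_Hom_iff)
    have inv: "inverse_arrows (gz C S) ?f ?b"
      using gz_inverse[OF bwd(1)] by (simp add: gz_loc_def)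
    have Ff: "ArrMap G ?f = ArrMap F s" using GA[OF s] by (simp add: gz_loc_def)
    have "inverse_arrows D (ArrMap F s) (ArrMap G ?b)"
      using G.ArrMap_Comp[OF H] G.ArrMap_Comp[OF H(2,1)] G.ArrMap_Hom[OF H(1)] G.ArrMap_Hom[OF H(2)]
        inv HomD[OF H(2)] G.ArrMap_Ident[of "Dom C s"] G.ArrMap_Ident[of "Cod C s"] Dom_Ob[OF s] Cod_Ob[OF s]
      unfolding inverse_arrows_def Ff by (auto simp: Hom_def)
    then have Gb: "ArrMap G ?b = inv_arrow D (ArrMap F s)"
      using G.cod.inverse_arrows_inv_arrow G.cod.inverse_arrows_unique is_iso_def by metis
    have "ArrMap G (gz_class C S (Cod C s) Y (Bwd s # w))
       = ArrMap G (Comp (gz C S) (gz_class C S (Dom C s) Y w) ?b)"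
      using gz_Comp[OF p(1) bwd(2)] by simp
    also have "\<dots> = Comp D (ArrMap G (gz_class C S (Dom C s) Y w)) (ArrMap G ?b)"
      using H(1) bwd by (intro G.ArrMap_Comp) (auto simp: gz_Hom_iff)
    finally show ?case using bwd Gb by simp
  qed
qed

context
  fixes D :: "('p, 'n, 'y) cat_scheme" and F
  assumes F: "is_functor C D F" and inverts: "\<And>s. s \<in> S \<Longrightarrow> is_iso D (ArrMap F s)"
begin

interpretation F: is_functor C D F by (rule F)

lemma inv_arrow_image:
  assumes "s \<in> S"
  shows "inverse_arrows D (ArrMap F s) (inv_arrow D (ArrMap F s))"
    "ArrMap F s \<in> Hom D (ObMap F (Dom C s)) (ObMap F (Cod C s))"
    "inv_arrow D (ArrMap F s) \<in> Hom D (ObMap F (Cod C s)) (ObMap F (Dom C s))"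
proof -
  show 1: "inverse_arrows D (ArrMap F s) (inv_arrow D (ArrMap F s))"
    using F.cod.inverse_arrows_inv_arrow inverts assms by blast
  show 2: "ArrMap F s \<in> Hom D (ObMap F (Dom C s)) (ObMap F (Cod C s))"
    using assms S by (intro F.ArrMap_Hom) (auto simp: Hom_def)
  show "inv_arrow D (ArrMap F s) \<in> Hom D (ObMap F (Cod C s)) (ObMap F (Dom C s))"
    using 1 HomD[OF 2] by (auto simp: inverse_arrows_def)
qed

lemma gz_eval_Hom:
  "gz_path C S X Y w \<Longrightarrow> gz_eval C D F X w \<in> Hom D (ObMap F X) (ObMap F Y)"
proof (induction rule: gz_path.induct)
  case (nil X)
  then show ?case by (simp add: F.cod.Ident_Hom F.ObMap_Ob)
next
  case (fwd f Y w)
  then have "ArrMap F f \<in> Hom D (ObMap F (Dom C f)) (ObMap F (Cod C f))"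
    by (intro F.ArrMap_Hom) (auto simp: Hom_def)
  with fwd show ?case by (auto intro: F.cod.Comp_Hom)
next
  case (bwd s Y w)
  then show ?case using inv_arrow_image(3)[of s] by (auto intro: F.cod.Comp_Hom)
qed

lemma gz_eval_append:
  "gz_path C S X Y v \<Longrightarrow> gz_path C S Y Z w \<Longrightarrow>
    gz_eval C D F X (v @ w) = Comp D (gz_eval C D F Y w) (gz_eval C D F X v)"
proof (induction rule: gz_path.induct)
  case (nil X)
  then show ?case using F.cod.Comp_Ident[OF gz_eval_Hom] by simp
next
  case (fwd f Y v)
  then have "ArrMap F f \<in> Hom D (ObMap F (Dom C f)) (ObMap F (Cod C f))"
    by (intro F.ArrMap_Hom) (auto simp: Hom_def)
  from F.cod.Comp_assoc[OF this gz_eval_Hom[OF fwd(2)] gz_eval_Hom[OF fwd(4)]] fwd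
  show ?case by simp
next
  case (bwd s Y v)
  from F.cod.Comp_assoc[OF inv_arrow_image(3)[OF bwd(1)] gz_eval_Hom[OF bwd(2)] gz_eval_Hom[OF bwd(4)]] bwd
  show ?case by simp
qed

lemma gz_eval_eq: "gz_eq C S X Y v w \<Longrightarrow> gz_eval C D F X v = gz_eval C D F X w"
proof (induction rule: gz_eq.induct)
  case (cong X X' u Y' w w' Y v)
  then have "gz_path C S X' Y' w" "gz_path C S X' Y' w'" using gz_eq_path by blast+
  with cong show ?case
    using gz_eval_append[OF cong(1) gz_path_append[of C S X' Y' _ Y v]]
      gz_eval_append[of X' Y' _ Y v] by metis
next
  case (ident X)
  then show ?case
    using HomD[OF Ident_Hom[OF ident]] F.cod.Ident_Comp[OF F.ArrMap_Hom[OF Ident_Hom[OF ident]]]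
    by (simp add: F.ArrMap_Ident)
next
  case (comp f X Y g Z)
  note gf = Comp_Hom[OF comp]
  show ?case
    using HomD[OF comp(1)] HomD[OF comp(2)] HomD[OF gf] F.ArrMap_Comp[OF comp]
      F.cod.Ident_Comp[OF F.ArrMap_Hom[OF comp(2)]]
      F.cod.Ident_Comp[OF F.ArrMap_Hom[OF gf]] by simp
next
  case (inv_right s)
  then show ?case
    using inv_arrow_image[OF inv_right] F.cod.Ident_Comp[OF inv_arrow_image(3)[OF inv_right]]
      HomD[OF inv_arrow_image(2)[OF inv_right]]
    by (simp add: inverse_arrows_def)
next
  case (inv_left s)
  then show ?case
    using inv_arrow_image[OF inv_left] F.cod.Ident_Comp[OF inv_arrow_image(2)[OF inv_left]]
      HomD[OF inv_arrow_image(2)[OF inv_left]]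
    by (simp add: inverse_arrows_def)
qed auto

lemma gz_lift_class:
  assumes "gz_path C S X Y w"
  shows "ArrMap (gz_lift C D F) (gz_class C S X Y w) = gz_eval C D F X w"
proof -
  have "gz_eval C D F X ` {w'. gz_eq C S X Y w w'} = {gz_eval C D F X w}"
  proof (intro Set.set_eqI iffI)
    fix a assume "a \<in> gz_eval C D F X ` {w'. gz_eq C S X Y w w'}"
    then obtain w' where "gz_eq C S X Y w w'" "a = gz_eval C D F X w'" by blast
    then show "a \<in> {gz_eval C D F X w}" using gz_eval_eq[of X Y w w'] by simp
  next
    fix a assume "a \<in> {gz_eval C D F X w}"
    then show "a \<in> gz_eval C D F X ` {w'. gz_eq C S X Y w w'}"
      using gz_eq.refl[OF assms] by blast
  qed
  then show ?thesis unfolding gz_lift_def gz_class_def by simp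
qed

lemma gz_lift_Ob: "ObMap (gz_lift C D F) = ObMap F"
  by (simp add: gz_lift_def)

lemma gz_lift_functor: "is_functor (gz C S) D (gz_lift C D F)"
proof -
  interpret L: category "gz C S" by (rule gz_category)
  show ?thesis
  proof
    fix X assume "X \<in> Ob (gz C S)"
    then have X: "X \<in> Ob C" by simp
    then show "ObMap (gz_lift C D F) X \<in> Ob D"
      unfolding gz_lift_Ob by (rule F.ObMap_Ob)
    show "ArrMap (gz_lift C D F) (Ident (gz C S) X) = Ident D (ObMap (gz_lift C D F) X)"
      using gz_lift_class[OF gz_path.nil[OF X]] unfolding gz_lift_Ob by simp
  next
    fix f X Y assume "f \<in> Hom (gz C S) X Y"
    then obtain w where w: "gz_path C S X Y w" and f: "f = gz_class C S X Y w"
      unfolding gz_Hom_iff by blast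
    show "ArrMap (gz_lift C D F) f \<in> Hom D (ObMap (gz_lift C D F) X) (ObMap (gz_lift C D F) Y)"
      unfolding gz_lift_Ob f gz_lift_class[OF w] by (rule gz_eval_Hom[OF w])
  next
    fix f g X Y Z assume "f \<in> Hom (gz C S) X Y" "g \<in> Hom (gz C S) Y Z"
    then obtain v w where v: "gz_path C S X Y v" and f: "f = gz_class C S X Y v"
      and w: "gz_path C S Y Z w" and g: "g = gz_class C S Y Z w"
      unfolding gz_Hom_iff by blast
    show "ArrMap (gz_lift C D F) (Comp (gz C S) g f) =
        Comp D (ArrMap (gz_lift C D F) g) (ArrMap (gz_lift C D F) f)"
      unfolding f g gz_Comp[OF v w] gz_lift_class[OF v] gz_lift_class[OF w]
        gz_lift_class[OF gz_path_append[OF v w]] by (rule gz_eval_append[OF v w])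
  qed
qed

theorem gz_universal:
  "is_functor (gz C S) D (gz_lift C D F)"
  "feq C (fcomp (gz_lift C D F) (gz_loc C S)) F"
  "is_functor (gz C S) D G \<Longrightarrow> feq C (fcomp G (gz_loc C S)) F \<Longrightarrow> feq (gz C S) G (gz_lift C D F)"
proof -
  show "is_functor (gz C S) D (gz_lift C D F)" by (rule gz_lift_functor)
  have "ArrMap (gz_lift C D F) (ArrMap (gz_loc C S) f) = ArrMap F f" if "f \<in> Arr C" for f
  proof -
    have f: "f \<in> Hom C (Dom C f) (Cod C f)" using that by (simp add: Hom_def)
    show ?thesis
      using gz_lift_class[OF gz_path_single_Fwd[OF f]] F.cod.Ident_Comp[OF F.ArrMap_Hom[OF f]]
      by (simp add: gz_loc_def)
  qed
  then show "feq C (fcomp (gz_lift C D F) (gz_loc C S)) F"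
    by (simp add: feq_def fcomp_def gz_lift_Ob gz_loc_def)
next
  assume G: "is_functor (gz C S) D G" "feq C (fcomp G (gz_loc C S)) F"
  have "ArrMap G f = ArrMap (gz_lift C D F) f" if "f \<in> Arr (gz C S)" for f
  proof -
    obtain X Y w where "gz_path C S X Y w" "f = gz_class C S X Y w"
      using \<open>f \<in> Arr (gz C S)\<close> by (auto simp: gz_def)
    then show ?thesis using functor_eval[OF G, of X Y w] gz_lift_class[of X Y w] by simp
  qed
  moreover have "ObMap G X = ObMap (gz_lift C D F) X" if "X \<in> Ob C" for X
    using G(2) that by (auto simp: feq_def fcomp_def gz_loc_def gz_lift_def)
  ultimately show "feq (gz C S) G (gz_lift C D F)"
    unfolding feq_def gz_Ob by blast
qed

end

end

end


section \<open>Additive categories\<close>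

text \<open>The group structure on morphisms, a zero object and an operation of direct sum are part of
  the data; the theorem is thus about every possible choice of them.\<close>

record ('o, 'm) addcat = "('o, 'm) cat" +
  Add :: "'m \<Rightarrow> 'm \<Rightarrow> 'm"
  ZeroArr :: "'o \<Rightarrow> 'o \<Rightarrow> 'm"
  ZeroOb :: "'o"
  DSum :: "'o \<Rightarrow> 'o \<Rightarrow> 'o"
  In1 :: "'o \<Rightarrow> 'o \<Rightarrow> 'm"
  In2 :: "'o \<Rightarrow> 'o \<Rightarrow> 'm"
  Pr1 :: "'o \<Rightarrow> 'o \<Rightarrow> 'm"
  Pr2 :: "'o \<Rightarrow> 'o \<Rightarrow> 'm"

definition hom_group :: "('o, 'm, 'x) addcat_scheme \<Rightarrow> 'o \<Rightarrow> 'o \<Rightarrow> 'm monoid" where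
  "hom_group A X Y = \<lparr>carrier = Hom A X Y, monoid.mult = Add A, one = ZeroArr A X Y\<rparr>"

locale additive_category = category A
  for A :: "('o, 'm, 'x) addcat_scheme" +
  assumes hom_comm_group: "X \<in> Ob A \<Longrightarrow> Y \<in> Ob A \<Longrightarrow> comm_group (hom_group A X Y)"
    and Comp_Add_left: "f \<in> Hom A X Y \<Longrightarrow> g \<in> Hom A Y Z \<Longrightarrow> g' \<in> Hom A Y Z \<Longrightarrow>
      Comp A (Add A g g') f = Add A (Comp A g f) (Comp A g' f)"
    and Comp_Add_right: "f \<in> Hom A X Y \<Longrightarrow> f' \<in> Hom A X Y \<Longrightarrow> g \<in> Hom A Y Z \<Longrightarrow>
      Comp A g (Add A f f') = Add A (Comp A g f) (Comp A g f')"
    and zero_object_ZeroOb: "zero_object A (ZeroOb A)"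
    and DSum_Ob: "X \<in> Ob A \<Longrightarrow> Y \<in> Ob A \<Longrightarrow> DSum A X Y \<in> Ob A"
    and In1_Hom: "X \<in> Ob A \<Longrightarrow> Y \<in> Ob A \<Longrightarrow> In1 A X Y \<in> Hom A X (DSum A X Y)"
    and In2_Hom: "X \<in> Ob A \<Longrightarrow> Y \<in> Ob A \<Longrightarrow> In2 A X Y \<in> Hom A Y (DSum A X Y)"
    and Pr1_Hom: "X \<in> Ob A \<Longrightarrow> Y \<in> Ob A \<Longrightarrow> Pr1 A X Y \<in> Hom A (DSum A X Y) X"
    and Pr2_Hom: "X \<in> Ob A \<Longrightarrow> Y \<in> Ob A \<Longrightarrow> Pr2 A X Y \<in> Hom A (DSum A X Y) Y"
    and Pr1_In1: "X \<in> Ob A \<Longrightarrow> Y \<in> Ob A \<Longrightarrow> Comp A (Pr1 A X Y) (In1 A X Y) = Ident A X"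
    and Pr2_In2: "X \<in> Ob A \<Longrightarrow> Y \<in> Ob A \<Longrightarrow> Comp A (Pr2 A X Y) (In2 A X Y) = Ident A Y"
    and Pr1_In2: "X \<in> Ob A \<Longrightarrow> Y \<in> Ob A \<Longrightarrow> Comp A (Pr1 A X Y) (In2 A X Y) = ZeroArr A Y X"
    and Pr2_In1: "X \<in> Ob A \<Longrightarrow> Y \<in> Ob A \<Longrightarrow> Comp A (Pr2 A X Y) (In1 A X Y) = ZeroArr A X Y"
    and In_Pr_sum: "X \<in> Ob A \<Longrightarrow> Y \<in> Ob A \<Longrightarrow>
      Add A (Comp A (In1 A X Y) (Pr1 A X Y)) (Comp A (In2 A X Y) (Pr2 A X Y)) = Ident A (DSum A X Y)"

definition neg :: "('o, 'm, 'x) addcat_scheme \<Rightarrow> 'm \<Rightarrow> 'm" where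
  "neg A f = m_inv (hom_group A (Dom A f) (Cod A f)) f"

definition dsum_arr :: "('o, 'm, 'x) addcat_scheme \<Rightarrow> 'm \<Rightarrow> 'm \<Rightarrow> 'm" where
  "dsum_arr A s t = Add A
     (Comp A (In1 A (Cod A s) (Cod A t)) (Comp A s (Pr1 A (Dom A s) (Dom A t))))
     (Comp A (In2 A (Cod A s) (Cod A t)) (Comp A t (Pr2 A (Dom A s) (Dom A t))))"


section \<open>The homotopy category of bounded complexes\<close>

record ('o, 'm) cplx =
  COb :: "int \<Rightarrow> 'o"
  Diff :: "int \<Rightarrow> 'm"

definition is_complex :: "('o, 'm, 'x) addcat_scheme \<Rightarrow> ('o, 'm) cplx \<Rightarrow> bool" where
  "is_complex A X \<longleftrightarrow> (\<forall>i. COb X i \<in> Ob A \<and> Diff X i \<in> Hom A (COb X i) (COb X (i + 1)) \<and>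
     Comp A (Diff X (i + 1)) (Diff X i) = ZeroArr A (COb X i) (COb X (i + 2)))"

definition bounded_complex :: "('o, 'm, 'x) addcat_scheme \<Rightarrow> ('o, 'm) cplx \<Rightarrow> bool" where
  "bounded_complex A X \<longleftrightarrow> is_complex A X \<and> (\<exists>n. \<forall>i. \<bar>i\<bar> > n \<longrightarrow> zero_object A (COb X i))"

definition chain_map :: "('o, 'm, 'x) addcat_scheme \<Rightarrow> ('o, 'm) cplx \<Rightarrow> ('o, 'm) cplx \<Rightarrow> (int \<Rightarrow> 'm) \<Rightarrow> bool" where
  "chain_map A X Y f \<longleftrightarrow> (\<forall>i. f i \<in> Hom A (COb X i) (COb Y i) \<and>
     Comp A (Diff Y i) (f i) = Comp A (f (i + 1)) (Diff X i))"

definition homotopic :: "('o, 'm, 'x) addcat_scheme \<Rightarrow> ('o, 'm) cplx \<Rightarrow> ('o, 'm) cplx \<Rightarrow>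
    (int \<Rightarrow> 'm) \<Rightarrow> (int \<Rightarrow> 'm) \<Rightarrow> bool" where
  "homotopic A X Y f g \<longleftrightarrow> (\<exists>h. \<forall>i. h i \<in> Hom A (COb X i) (COb Y (i - 1)) \<and>
     f i = Add A (g i) (Add A (Comp A (Diff Y (i - 1)) (h i)) (Comp A (h (i + 1)) (Diff X i))))"

type_synonym ('o, 'm) ho_arr = "('o, 'm) cplx \<times> ('o, 'm) cplx \<times> (int \<Rightarrow> 'm) set"

definition ho_class :: "('o, 'm, 'x) addcat_scheme \<Rightarrow> ('o, 'm) cplx \<Rightarrow> ('o, 'm) cplx \<Rightarrow> (int \<Rightarrow> 'm) \<Rightarrow>
    ('o, 'm) ho_arr" where
  "ho_class A X Y f = (X, Y, {g. chain_map A X Y g \<and> homotopic A X Y f g})"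

definition Kb :: "('o, 'm, 'x) addcat_scheme \<Rightarrow> (('o, 'm) cplx, ('o, 'm) ho_arr) cat" where
  "Kb A = \<lparr>
     Ob = {X. bounded_complex A X},
     Arr = {ho_class A X Y f | X Y f. bounded_complex A X \<and> bounded_complex A Y \<and> chain_map A X Y f},
     Dom = (\<lambda>(X, Y, c). X),
     Cod = (\<lambda>(X, Y, c). Y),
     Ident = (\<lambda>X. ho_class A X X (\<lambda>i. Ident A (COb X i))),
     Comp = (\<lambda>(Y, Z, d) (X, Y', c). (X, Z, {u. chain_map A X Z u \<and>
       (\<exists>f \<in> c. \<exists>g \<in> d. homotopic A X Z (\<lambda>i. Comp A (g i) (f i)) u)}))\<rparr>"

definition shift :: "('o, 'm, 'x) addcat_scheme \<Rightarrow> int \<Rightarrow> ('o, 'm) cplx \<Rightarrow> ('o, 'm) cplx" where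
  "shift A n X = \<lparr>COb = (\<lambda>i. COb X (i + n)),
     Diff = (\<lambda>i. if even n then Diff X (i + n) else neg A (Diff X (i + n)))\<rparr>"

text \<open>The cone of \<open>f : X \<rightarrow> Y\<close> has terms \<open>X\<^sup>i\<^sup>+\<^sup>1 \<oplus> Y\<^sup>i\<close> and differential \<open>(x, y) \<mapsto> (- d x, f x + d y)\<close>.\<close>

definition cone :: "('o, 'm, 'x) addcat_scheme \<Rightarrow> ('o, 'm) cplx \<Rightarrow> ('o, 'm) cplx \<Rightarrow> (int \<Rightarrow> 'm) \<Rightarrow>
    ('o, 'm) cplx" where
  "cone A X Y f = \<lparr>COb = (\<lambda>i. DSum A (COb X (i + 1)) (COb Y i)),
     Diff = (\<lambda>i. Add A
       (Comp A (In1 A (COb X (i + 2)) (COb Y (i + 1)))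
         (Comp A (neg A (Diff X (i + 1))) (Pr1 A (COb X (i + 1)) (COb Y i))))
       (Comp A (In2 A (COb X (i + 2)) (COb Y (i + 1)))
         (Add A (Comp A (f (i + 1)) (Pr1 A (COb X (i + 1)) (COb Y i)))
                (Comp A (Diff Y i) (Pr2 A (COb X (i + 1)) (COb Y i))))))\<rparr>"

definition stalk :: "('o, 'm, 'x) addcat_scheme \<Rightarrow> 'o \<Rightarrow> ('o, 'm) cplx" where
  "stalk A X = \<lparr>COb = (\<lambda>i. if i = 0 then X else ZeroOb A),
     Diff = (\<lambda>i. ZeroArr A (if i = 0 then X else ZeroOb A) (if i + 1 = 0 then X else ZeroOb A))\<rparr>"

definition stalk_map :: "('o, 'm, 'x) addcat_scheme \<Rightarrow> 'm \<Rightarrow> int \<Rightarrow> 'm" where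
  "stalk_map A f = (\<lambda>i. if i = 0 then f else ZeroArr A (ZeroOb A) (ZeroOb A))"

definition Kb_embed :: "('o, 'm, 'x) addcat_scheme \<Rightarrow> ('o, 'm, ('o, 'm) cplx, ('o, 'm) ho_arr) fctr" where
  "Kb_embed A = \<lparr>ObMap = stalk A,
     ArrMap = (\<lambda>f. ho_class A (stalk A (Dom A f)) (stalk A (Cod A f)) (stalk_map A f))\<rparr>"


section \<open>Verdier quotients and the additive localization\<close>

text \<open>A full subcategory is given by its set of objects; strict means closed under isomorphisms.
  The two-term complex \<open>X \<rightarrow> Y\<close> given by \<open>s\<close> is taken as the cone of the map induced by \<open>s\<close>
  between the complexes concentrated in degree \<open>0\<close>.\<close>

definition strict_triangulated :: "('o, 'm, 'x) addcat_scheme \<Rightarrow> ('o, 'm) cplx set \<Rightarrow> bool" where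
  "strict_triangulated A P \<longleftrightarrow> P \<subseteq> Ob (Kb A) \<and>
     (\<forall>Z. zero_object (Kb A) Z \<longrightarrow> Z \<in> P) \<and>
     (\<forall>X \<in> P. \<forall>Y \<in> Ob (Kb A). isomorphic (Kb A) X Y \<longrightarrow> Y \<in> P) \<and>
     (\<forall>X \<in> P. \<forall>n. shift A n X \<in> P) \<and>
     (\<forall>X \<in> P. \<forall>Y \<in> P. \<forall>f. chain_map A X Y f \<longrightarrow> cone A X Y f \<in> P)"

definition cone_subcat :: "('o, 'm, 'x) addcat_scheme \<Rightarrow> 'm set \<Rightarrow> ('o, 'm) cplx set" where
  "cone_subcat A S = \<Inter> {P. strict_triangulated A P \<and>
     (\<forall>s \<in> S. cone A (stalk A (Dom A s)) (stalk A (Cod A s)) (stalk_map A s) \<in> P)}"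

definition cone_in :: "('o, 'm, 'x) addcat_scheme \<Rightarrow> ('o, 'm) cplx set \<Rightarrow> ('o, 'm) ho_arr set" where
  "cone_in A P = {ho_class A X Y f | X Y f. bounded_complex A X \<and> bounded_complex A Y \<and>
     chain_map A X Y f \<and> cone A X Y f \<in> P}"

text \<open>The Verdier quotient by \<open>P\<close> is the localization at the morphisms with cone in \<open>P\<close>.\<close>

definition verdier_quotient :: "('o, 'm, 'x) addcat_scheme \<Rightarrow> ('o, 'm) cplx set \<Rightarrow>
    (('o, 'm) cplx, (('o, 'm) cplx, ('o, 'm) ho_arr) gz_arr) cat" where
  "verdier_quotient A P = gz (Kb A) (cone_in A P)"

definition gz_add :: "('o, 'm, 'x) addcat_scheme \<Rightarrow> 'm set \<Rightarrow>
    (('o, 'm) cplx, (('o, 'm) cplx, ('o, 'm) ho_arr) gz_arr) cat" where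
  "gz_add A S = full_subcat (verdier_quotient A (cone_subcat A S)) (stalk A ` Ob A)"

definition gz_add_loc :: "('o, 'm, 'x) addcat_scheme \<Rightarrow> 'm set \<Rightarrow>
    ('o, 'm, ('o, 'm) cplx, (('o, 'm) cplx, ('o, 'm) ho_arr) gz_arr) fctr" where
  "gz_add_loc A S = fcomp (gz_loc (Kb A) (cone_in A (cone_subcat A S))) (Kb_embed A)"

text \<open>The natural functor \<open>Q\<close>; on objects it sends \<open>X\<close> to \<open>X\<close> placed in degree \<open>0\<close>.\<close>

definition gz_to_gz_add :: "('o, 'm, 'x) addcat_scheme \<Rightarrow> 'm set \<Rightarrow>
    ('o, ('o, 'm) gz_arr, ('o, 'm) cplx, (('o, 'm) cplx, ('o, 'm) ho_arr) gz_arr) fctr" where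
  "gz_to_gz_add A S = gz_lift A (gz_add A S) (gz_add_loc A S)"


subsection \<open>The natural functor is a functor\<close>

context additive_category
begin

lemma Add_Hom: "f \<in> Hom A X Y \<Longrightarrow> g \<in> Hom A X Y \<Longrightarrow> Add A f g \<in> Hom A X Y"
proof -
  assume f: "f \<in> Hom A X Y" and g: "g \<in> Hom A X Y"
  interpret H: comm_group "hom_group A X Y" using hom_comm_group Hom_Ob[OF f] by blast
  show ?thesis using H.m_closed f g by (simp add: hom_group_def)
qed

lemma ZeroArr_Hom: "X \<in> Ob A \<Longrightarrow> Y \<in> Ob A \<Longrightarrow> ZeroArr A X Y \<in> Hom A X Y"
proof -
  assume "X \<in> Ob A" "Y \<in> Ob A"
  then interpret H: comm_group "hom_group A X Y" using hom_comm_group by blast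
  show ?thesis using H.one_closed by (simp add: hom_group_def)
qed

lemma neg_Hom: "f \<in> Hom A X Y \<Longrightarrow> neg A f \<in> Hom A X Y"
proof -
  assume f: "f \<in> Hom A X Y"
  interpret H: comm_group "hom_group A X Y" using hom_comm_group Hom_Ob[OF f] by blast
  show ?thesis using H.inv_closed[of f] f HomD[OF f] by (simp add: hom_group_def neg_def)
qed

lemma Add_neg: "f \<in> Hom A X Y \<Longrightarrow> Add A f (neg A f) = ZeroArr A X Y"
proof -
  assume f: "f \<in> Hom A X Y"
  interpret H: comm_group "hom_group A X Y" using hom_comm_group Hom_Ob[OF f] by blast
  show ?thesis using H.r_inv[of f] f HomD[OF f] by (simp add: hom_group_def neg_def)
qed

lemma Add_ZeroArr: "f \<in> Hom A X Y \<Longrightarrow> Add A f (ZeroArr A X Y) = f"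
proof -
  assume f: "f \<in> Hom A X Y"
  interpret H: comm_group "hom_group A X Y" using hom_comm_group Hom_Ob[OF f] by blast
  show ?thesis using H.r_one[of f] f by (simp add: hom_group_def)
qed

lemma Add_comm: "f \<in> Hom A X Y \<Longrightarrow> g \<in> Hom A X Y \<Longrightarrow> Add A f g = Add A g f"
proof -
  assume f: "f \<in> Hom A X Y" and g: "g \<in> Hom A X Y"
  interpret H: comm_group "hom_group A X Y" using hom_comm_group Hom_Ob[OF f] by blast
  show ?thesis using H.m_comm[of f g] f g by (simp add: hom_group_def)
qed

lemma Add_assoc: "f \<in> Hom A X Y \<Longrightarrow> g \<in> Hom A X Y \<Longrightarrow> h \<in> Hom A X Y \<Longrightarrow>
    Add A (Add A f g) h = Add A f (Add A g h)"
proof -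
  assume f: "f \<in> Hom A X Y" and g: "g \<in> Hom A X Y" and h: "h \<in> Hom A X Y"
  interpret H: comm_group "hom_group A X Y" using hom_comm_group Hom_Ob[OF f] by blast
  show ?thesis using H.m_assoc[of f g h] f g h by (simp add: hom_group_def)
qed

lemma Add_idem_zero:
  assumes "f \<in> Hom A X Y" "Add A f f = f" shows "f = ZeroArr A X Y"
  by (metis Add_ZeroArr Add_assoc Add_neg assms neg_Hom)

lemma Comp_ZeroArr: "X \<in> Ob A \<Longrightarrow> g \<in> Hom A Y Z \<Longrightarrow> Comp A g (ZeroArr A X Y) = ZeroArr A X Z"
  using Comp_Add_right[of "ZeroArr A X Y" X Y "ZeroArr A X Y" g Z] ZeroArr_Hom[of X Y] Hom_Ob[of g Y Z]
    Comp_Hom[of "ZeroArr A X Y" X Y g Z] Add_ZeroArr[of "ZeroArr A X Y" X Y]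
  by (intro Add_idem_zero) simp_all

lemma ZeroArr_Comp: "Z \<in> Ob A \<Longrightarrow> f \<in> Hom A X Y \<Longrightarrow> Comp A (ZeroArr A Y Z) f = ZeroArr A X Z"
  using Comp_Add_left[of f X Y "ZeroArr A Y Z" Z "ZeroArr A Y Z"] ZeroArr_Hom[of Y Z] Hom_Ob[of f X Y]
    Comp_Hom[of f X Y "ZeroArr A Y Z" Z] Add_ZeroArr[of "ZeroArr A Y Z" Y Z]
  by (intro Add_idem_zero) simp_all

lemma neg_unique:
  assumes f: "f \<in> Hom A X Y" and g: "g \<in> Hom A X Y" and z: "Add A f g = ZeroArr A X Y"
  shows "g = neg A f"
proof -
  have n: "neg A f \<in> Hom A X Y" using f by (rule neg_Hom)
  have "g = Add A g (Add A f (neg A f))" using Add_neg[OF f] Add_ZeroArr[OF g] by simp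
  also have "\<dots> = Add A (Add A f g) (neg A f)" using Add_assoc[OF g f n] Add_comm[OF f g] by simp
  also have "\<dots> = neg A f"
    using z Add_comm[OF ZeroArr_Hom n] Add_ZeroArr[OF n] Hom_Ob[OF f] by simp
  finally show ?thesis .
qed

lemma Comp_neg:
  assumes f: "f \<in> Hom A X Y" and g: "g \<in> Hom A Y Z"
  shows "Comp A g (neg A f) = neg A (Comp A g f)"
proof (rule neg_unique)
  show "Comp A g f \<in> Hom A X Z" "Comp A g (neg A f) \<in> Hom A X Z"
    using Comp_Hom f g neg_Hom by blast+
  show "Add A (Comp A g f) (Comp A g (neg A f)) = ZeroArr A X Z"
    using Comp_Add_right[OF f neg_Hom[OF f] g] Add_neg[OF f] Comp_ZeroArr g Hom_Ob[OF f] by simp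
qed

lemma neg_Comp:
  assumes f: "f \<in> Hom A X Y" and g: "g \<in> Hom A Y Z"
  shows "Comp A (neg A g) f = neg A (Comp A g f)"
proof (rule neg_unique)
  show "Comp A g f \<in> Hom A X Z" "Comp A (neg A g) f \<in> Hom A X Z"
    using Comp_Hom f g neg_Hom by blast+
  show "Add A (Comp A g f) (Comp A (neg A g) f) = ZeroArr A X Z"
    using Comp_Add_left[OF f g neg_Hom[OF g]] Add_neg[OF g] ZeroArr_Comp f Hom_Ob[OF g] by simp
qed

lemma Add_swap:
  assumes "a \<in> Hom A X Y" "b \<in> Hom A X Y" "c \<in> Hom A X Y" "d \<in> Hom A X Y"
  shows "Add A (Add A a b) (Add A c d) = Add A (Add A a c) (Add A b d)"
proof -
  have "Add A (Add A a b) (Add A c d) = Add A a (Add A b (Add A c d))"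
    using assms Add_Hom Add_assoc by blast
  also have "Add A b (Add A c d) = Add A (Add A c b) d"
    using assms Add_assoc[of b X Y c d] Add_comm[of b X Y c] by simp
  also have "\<dots> = Add A c (Add A b d)"
    using assms Add_assoc by blast
  also have "Add A a \<dots> = Add A (Add A a c) (Add A b d)"
    using assms Add_Hom Add_assoc[of a X Y c "Add A b d"] by simp
  finally show ?thesis .
qed

lemma complex_Hom:
  assumes "is_complex A X"
  shows "COb X i \<in> Ob A" "Diff X i \<in> Hom A (COb X i) (COb X (i + 1))"
    "Diff X (i - 1) \<in> Hom A (COb X (i - 1)) (COb X i)"
  using assms spec[OF assms[unfolded is_complex_def], of "i - 1"] by (auto simp: is_complex_def)

lemma homotopy_terms:
  assumes "is_complex A X" "is_complex A Y" "\<And>i. h i \<in> Hom A (COb X i) (COb Y (i - 1))"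
  shows "Comp A (Diff Y (i - 1)) (h i) \<in> Hom A (COb X i) (COb Y i)"
    "Comp A (h (i + 1)) (Diff X i) \<in> Hom A (COb X i) (COb Y i)"
    "h (i + 1) \<in> Hom A (COb X (i + 1)) (COb Y i)"
proof -
  show 1: "h (i + 1) \<in> Hom A (COb X (i + 1)) (COb Y i)" using assms(3)[of "i + 1"] by simp
  show "Comp A (Diff Y (i - 1)) (h i) \<in> Hom A (COb X i) (COb Y i)"
    using Comp_Hom[OF assms(3) complex_Hom(3)[OF assms(2)]] .
  show "Comp A (h (i + 1)) (Diff X i) \<in> Hom A (COb X i) (COb Y i)"
    using Comp_Hom[OF complex_Hom(2)[OF assms(1)] 1] .
qed

lemma homotopic_refl:
  assumes "is_complex A X" "is_complex A Y" "chain_map A X Y f"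
  shows "homotopic A X Y f f"
proof -
  let ?h = "\<lambda>i. ZeroArr A (COb X i) (COb Y (i - 1))"
  have f: "f i \<in> Hom A (COb X i) (COb Y i)" for i using assms by (simp add: chain_map_def)
  have h: "?h i \<in> Hom A (COb X i) (COb Y (i - 1))" for i
    using assms by (simp add: ZeroArr_Hom complex_Hom)
  have "f i = Add A (f i) (Add A (Comp A (Diff Y (i - 1)) (?h i)) (Comp A (?h (i + 1)) (Diff X i)))" for i
    using Comp_ZeroArr[OF complex_Hom(1)[OF assms(1)] complex_Hom(3)[OF assms(2)], of i i]
      ZeroArr_Comp[OF complex_Hom(1)[OF assms(2)] complex_Hom(2)[OF assms(1)], of i i]
      Add_ZeroArr[OF f] Add_ZeroArr[OF ZeroArr_Hom] complex_Hom(1)[OF assms(1)] complex_Hom(1)[OF assms(2)]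
    by simp
  then show ?thesis unfolding homotopic_def using h by (intro exI[of _ ?h]) blast
qed

lemma homotopic_sym:
  assumes X: "is_complex A X" and Y: "is_complex A Y"
    and f: "chain_map A X Y f" and g: "chain_map A X Y g" and fg: "homotopic A X Y f g"
  shows "homotopic A X Y g f"
proof -
  obtain h where h: "\<And>i. h i \<in> Hom A (COb X i) (COb Y (i - 1))"
    and e: "\<And>i. f i = Add A (g i) (Add A (Comp A (Diff Y (i - 1)) (h i)) (Comp A (h (i + 1)) (Diff X i)))"
    using fg unfolding homotopic_def by blast
  note T = homotopy_terms[OF X Y h]
  let ?h = "\<lambda>i. neg A (h i)"
  have g: "g i \<in> Hom A (COb X i) (COb Y i)" for i using g by (simp add: chain_map_def)
  have "g i = Add A (f i) (Add A (Comp A (Diff Y (i - 1)) (?h i)) (Comp A (?h (i + 1)) (Diff X i)))" for i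
  proof -
    let ?a = "Comp A (Diff Y (i - 1)) (h i)" and ?b = "Comp A (h (i + 1)) (Diff X i)"
    have n: "Comp A (Diff Y (i - 1)) (?h i) = neg A ?a" "Comp A (?h (i + 1)) (Diff X i) = neg A ?b"
      using Comp_neg[OF h complex_Hom(3)[OF Y]] neg_Comp[OF complex_Hom(2)[OF X] T(3)] by auto
    have O: "COb X i \<in> Ob A" "COb Y i \<in> Ob A" using complex_Hom X Y by auto
    have "Add A (f i) (Add A (neg A ?a) (neg A ?b))
      = Add A (g i) (Add A (Add A ?a ?b) (Add A (neg A ?a) (neg A ?b)))"
      unfolding e by (intro Add_assoc[where X="COb X i" and Y="COb Y i"] g Add_Hom T neg_Hom)
    also have "Add A (Add A ?a ?b) (Add A (neg A ?a) (neg A ?b))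
      = Add A (Add A ?a (neg A ?a)) (Add A ?b (neg A ?b))"
      by (intro Add_swap[where X="COb X i" and Y="COb Y i"] T neg_Hom)
    also have "\<dots> = ZeroArr A (COb X i) (COb Y i)"
      using Add_neg[OF T(1)] Add_neg[OF T(2)] Add_ZeroArr[OF ZeroArr_Hom[OF O]] by simp
    finally show ?thesis using n Add_ZeroArr[OF g] by simp
  qed
  then show ?thesis unfolding homotopic_def using neg_Hom[OF h] by (intro exI[of _ ?h]) blast
qed

lemma homotopic_trans:
  assumes X: "is_complex A X" and Y: "is_complex A Y"
    and k: "chain_map A X Y k" and fg: "homotopic A X Y f g" and gk: "homotopic A X Y g k"
  shows "homotopic A X Y f k"
proof -
  obtain h where h: "\<And>i. h i \<in> Hom A (COb X i) (COb Y (i - 1))"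
    and e: "\<And>i. f i = Add A (g i) (Add A (Comp A (Diff Y (i - 1)) (h i)) (Comp A (h (i + 1)) (Diff X i)))"
    using fg unfolding homotopic_def by blast
  obtain h' where h': "\<And>i. h' i \<in> Hom A (COb X i) (COb Y (i - 1))"
    and e': "\<And>i. g i = Add A (k i) (Add A (Comp A (Diff Y (i - 1)) (h' i)) (Comp A (h' (i + 1)) (Diff X i)))"
    using gk unfolding homotopic_def by blast
  note T = homotopy_terms[OF X Y h] and T' = homotopy_terms[OF X Y h']
  let ?h = "\<lambda>i. Add A (h' i) (h i)"
  have k: "k i \<in> Hom A (COb X i) (COb Y i)" for i using k by (simp add: chain_map_def)
  have "f i = Add A (k i) (Add A (Comp A (Diff Y (i - 1)) (?h i)) (Comp A (?h (i + 1)) (Diff X i)))" for i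
  proof -
    let ?a = "Comp A (Diff Y (i - 1)) (h i)" and ?b = "Comp A (h (i + 1)) (Diff X i)"
    let ?a' = "Comp A (Diff Y (i - 1)) (h' i)" and ?b' = "Comp A (h' (i + 1)) (Diff X i)"
    have n: "Comp A (Diff Y (i - 1)) (?h i) = Add A ?a' ?a" "Comp A (?h (i + 1)) (Diff X i) = Add A ?b' ?b"
      using Comp_Add_right[OF h' h complex_Hom(3)[OF Y]]
        Comp_Add_left[OF complex_Hom(2)[OF X] T'(3) T(3)] by auto
    have "f i = Add A (k i) (Add A (Add A ?a' ?b') (Add A ?a ?b))"
      unfolding e[of i] e'[of i]
      by (intro Add_assoc[where X="COb X i" and Y="COb Y i"] k Add_Hom T T')
    also have "Add A (Add A ?a' ?b') (Add A ?a ?b) = Add A (Add A ?a' ?a) (Add A ?b' ?b)"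
      by (intro Add_swap[where X="COb X i" and Y="COb Y i"] T T')
    finally show ?thesis using n by simp
  qed
  then show ?thesis unfolding homotopic_def using Add_Hom[OF h' h] by (intro exI[of _ ?h]) blast
qed

lemma chain_map_Comp:
  assumes X: "is_complex A X" and Y: "is_complex A Y" and Z: "is_complex A Z"
    and f: "chain_map A X Y f" and g: "chain_map A Y Z g"
  shows "chain_map A X Z (\<lambda>i. Comp A (g i) (f i))"
  unfolding chain_map_def
proof (intro allI conjI)
  fix i
  have F: "f j \<in> Hom A (COb X j) (COb Y j)" and G: "g j \<in> Hom A (COb Y j) (COb Z j)" for j
    using f g by (auto simp: chain_map_def)
  show "Comp A (g i) (f i) \<in> Hom A (COb X i) (COb Z i)" using Comp_Hom F G by blast
  have "Comp A (Diff Z i) (Comp A (g i) (f i)) = Comp A (Comp A (g (i + 1)) (Diff Y i)) (f i)"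
    using Comp_assoc[OF F G complex_Hom(2)[OF Z]] g by (simp add: chain_map_def)
  also have "\<dots> = Comp A (g (i + 1)) (Comp A (f (i + 1)) (Diff X i))"
    using Comp_assoc[OF F complex_Hom(2)[OF Y] G] f by (simp add: chain_map_def)
  also have "\<dots> = Comp A (Comp A (g (i + 1)) (f (i + 1))) (Diff X i)"
    using Comp_assoc[OF complex_Hom(2)[OF X] F G] .
  finally show "Comp A (Diff Z i) (Comp A (g i) (f i)) = Comp A (Comp A (g (i + 1)) (f (i + 1))) (Diff X i)" .
qed

lemma homotopic_Comp_left:
  assumes X: "is_complex A X" and Y: "is_complex A Y" and Z: "is_complex A Z"
    and f': "chain_map A X Y f'" and g: "chain_map A Y Z g" and ff: "homotopic A X Y f f'"
  shows "homotopic A X Z (\<lambda>i. Comp A (g i) (f i)) (\<lambda>i. Comp A (g i) (f' i))"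
proof -
  obtain h where h: "\<And>i. h i \<in> Hom A (COb X i) (COb Y (i - 1))"
    and e: "\<And>i. f i = Add A (f' i) (Add A (Comp A (Diff Y (i - 1)) (h i)) (Comp A (h (i + 1)) (Diff X i)))"
    using ff unfolding homotopic_def by blast
  note T = homotopy_terms[OF X Y h]
  have F: "f' j \<in> Hom A (COb X j) (COb Y j)" and G: "g j \<in> Hom A (COb Y j) (COb Z j)" for j
    using f' g by (auto simp: chain_map_def)
  let ?h = "\<lambda>i. Comp A (g (i - 1)) (h i)"
  have H: "?h i \<in> Hom A (COb X i) (COb Z (i - 1))" for i using Comp_Hom[OF h G] .
  have "Comp A (g i) (f i) = Add A (Comp A (g i) (f' i))
      (Add A (Comp A (Diff Z (i - 1)) (?h i)) (Comp A (?h (i + 1)) (Diff X i)))" for i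
  proof -
    have c: "Comp A (Diff Z (i - 1)) (g (i - 1)) = Comp A (g i) (Diff Y (i - 1))"
      using spec[OF g[unfolded chain_map_def], of "i - 1"] by simp
    have "Comp A (Diff Z (i - 1)) (?h i) = Comp A (g i) (Comp A (Diff Y (i - 1)) (h i))"
      using Comp_assoc[OF h G complex_Hom(3)[OF Z]] c Comp_assoc[OF h complex_Hom(3)[OF Y] G] by simp
    moreover have "Comp A (?h (i + 1)) (Diff X i) = Comp A (g i) (Comp A (h (i + 1)) (Diff X i))"
      using Comp_assoc[OF complex_Hom(2)[OF X] T(3) G] by simp
    ultimately show ?thesis
      unfolding e[of i]
      using Comp_Add_right[OF F Add_Hom[OF T(1,2)] G] Comp_Add_right[OF T(1,2) G] by simp
  qed
  then show ?thesis unfolding homotopic_def using H by (intro exI[of _ ?h]) blast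
qed

lemma homotopic_Comp_right:
  assumes X: "is_complex A X" and Y: "is_complex A Y" and Z: "is_complex A Z"
    and f: "chain_map A X Y f" and g': "chain_map A Y Z g'" and gg: "homotopic A Y Z g g'"
  shows "homotopic A X Z (\<lambda>i. Comp A (g i) (f i)) (\<lambda>i. Comp A (g' i) (f i))"
proof -
  obtain h where h: "\<And>i. h i \<in> Hom A (COb Y i) (COb Z (i - 1))"
    and e: "\<And>i. g i = Add A (g' i) (Add A (Comp A (Diff Z (i - 1)) (h i)) (Comp A (h (i + 1)) (Diff Y i)))"
    using gg unfolding homotopic_def by blast
  note T = homotopy_terms[OF Y Z h]
  have F: "f j \<in> Hom A (COb X j) (COb Y j)" and G: "g' j \<in> Hom A (COb Y j) (COb Z j)" for j
    using f g' by (auto simp: chain_map_def)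
  let ?h = "\<lambda>i. Comp A (h i) (f i)"
  have H: "?h i \<in> Hom A (COb X i) (COb Z (i - 1))" for i using Comp_Hom[OF F h] .
  have "Comp A (g i) (f i) = Add A (Comp A (g' i) (f i))
      (Add A (Comp A (Diff Z (i - 1)) (?h i)) (Comp A (?h (i + 1)) (Diff X i)))" for i
  proof -
    have c: "Comp A (Diff Y i) (f i) = Comp A (f (i + 1)) (Diff X i)"
      using f by (simp add: chain_map_def)
    have "Comp A (?h (i + 1)) (Diff X i) = Comp A (Comp A (h (i + 1)) (Diff Y i)) (f i)"
      using Comp_assoc[OF complex_Hom(2)[OF X] F h, of i] c
        Comp_assoc[OF F complex_Hom(2)[OF Y] T(3), of i] by simp
    moreover have "Comp A (Diff Z (i - 1)) (?h i) = Comp A (Comp A (Diff Z (i - 1)) (h i)) (f i)"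
      using Comp_assoc[OF F h complex_Hom(3)[OF Z]] .
    ultimately show ?thesis
      unfolding e[of i]
      using Comp_Add_left[OF F G Add_Hom[OF T(1,2)]] Comp_Add_left[OF F T(1,2)] by simp
  qed
  then show ?thesis unfolding homotopic_def using H by (intro exI[of _ ?h]) blast
qed

lemma ho_class_eq_iff:
  assumes "is_complex A X" "is_complex A Y" "chain_map A X Y f" "chain_map A X Y g"
  shows "ho_class A X Y f = ho_class A X Y g \<longleftrightarrow> homotopic A X Y f g"
  using assms homotopic_refl homotopic_sym homotopic_trans unfolding ho_class_def by blast

lemma Kb_Comp:
  assumes X: "is_complex A X" and Y: "is_complex A Y" and Z: "is_complex A Z"
    and f: "chain_map A X Y f" and g: "chain_map A Y Z g"
  shows "Comp (Kb A) (ho_class A Y Z g) (ho_class A X Y f) = ho_class A X Z (\<lambda>i. Comp A (g i) (f i))"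
proof -
  have "(\<exists>f'. (chain_map A X Y f' \<and> homotopic A X Y f f') \<and> (\<exists>g'. (chain_map A Y Z g' \<and> homotopic A Y Z g g')
      \<and> homotopic A X Z (\<lambda>i. Comp A (g' i) (f' i)) u))
    \<longleftrightarrow> homotopic A X Z (\<lambda>i. Comp A (g i) (f i)) u" (is "?L \<longleftrightarrow> ?R") if u: "chain_map A X Z u" for u
  proof
    assume ?L
    then obtain f' g' where 1: "chain_map A X Y f'" "homotopic A X Y f f'"
      "chain_map A Y Z g'" "homotopic A Y Z g g'" "homotopic A X Z (\<lambda>i. Comp A (g' i) (f' i)) u"
      by blast
    have "homotopic A X Z (\<lambda>i. Comp A (g i) (f i)) (\<lambda>i. Comp A (g i) (f' i))"
      using homotopic_Comp_left[OF X Y Z 1(1) g 1(2)] .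
    moreover have "homotopic A X Z (\<lambda>i. Comp A (g i) (f' i)) (\<lambda>i. Comp A (g' i) (f' i))"
      using homotopic_Comp_right[OF X Y Z 1(1,3,4)] .
    ultimately show ?R
      using 1(5) homotopic_trans[OF X Z] chain_map_Comp[OF X Y Z 1(1,3)] u by blast
  next
    assume ?R
    then show ?L using f g homotopic_refl X Y Z by blast
  qed
  then show ?thesis by (auto simp: Kb_def ho_class_def)
qed

lemma Kb_Hom_iff:
  "a \<in> Hom (Kb A) X Y \<longleftrightarrow> bounded_complex A X \<and> bounded_complex A Y \<and>
    (\<exists>f. chain_map A X Y f \<and> a = ho_class A X Y f)"
  by (auto simp: Kb_def Hom_def ho_class_def)

lemma chain_map_Ident:
  assumes "is_complex A X" shows "chain_map A X X (\<lambda>i. Ident A (COb X i))"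
  using complex_Hom[OF assms] Ident_Hom Comp_Ident[OF complex_Hom(2)[OF assms]]
    Ident_Comp[OF complex_Hom(2)[OF assms]]
  by (simp add: chain_map_def)

theorem Kb_category: "category (Kb A)"
proof
  fix a assume "a \<in> Arr (Kb A)"
  then show "Dom (Kb A) a \<in> Ob (Kb A)" "Cod (Kb A) a \<in> Ob (Kb A)"
    by (auto simp: Kb_def ho_class_def)
next
  fix X assume "X \<in> Ob (Kb A)"
  then have "bounded_complex A X" by (simp add: Kb_def)
  then have "ho_class A X X (\<lambda>i. Ident A (COb X i)) \<in> Hom (Kb A) X X"
    using chain_map_Ident by (auto simp: Kb_Hom_iff bounded_complex_def)
  then show "Ident (Kb A) X \<in> Hom (Kb A) X X" by (simp add: Kb_def)
next
  fix a b X Y Z assume ab: "a \<in> Hom (Kb A) X Y" "b \<in> Hom (Kb A) Y Z"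
  then obtain f g where X: "is_complex A X" and Y: "is_complex A Y" and Z: "is_complex A Z"
    and f: "chain_map A X Y f" and g: "chain_map A Y Z g"
    and e: "a = ho_class A X Y f" "b = ho_class A Y Z g"
    by (auto simp: Kb_Hom_iff bounded_complex_def)
  show "Comp (Kb A) b a \<in> Hom (Kb A) X Z"
    using ab chain_map_Comp[OF X Y Z f g] unfolding e Kb_Comp[OF X Y Z f g] Kb_Hom_iff by blast
next
  fix a X Y assume "a \<in> Hom (Kb A) X Y"
  then obtain f where X: "is_complex A X" and Y: "is_complex A Y" and f: "chain_map A X Y f"
    and a: "a = ho_class A X Y f"
    by (auto simp: Kb_Hom_iff bounded_complex_def)
  have F: "f i \<in> Hom A (COb X i) (COb Y i)" for i using f by (auto simp: chain_map_def)
  have K: "Ident (Kb A) Z = ho_class A Z Z (\<lambda>i. Ident A (COb Z i))" for Z by (simp add: Kb_def)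
  show "Comp (Kb A) a (Ident (Kb A) X) = a"
    using Kb_Comp[OF X X Y chain_map_Ident[OF X] f] Comp_Ident[OF F] by (simp add: a K)
  show "Comp (Kb A) (Ident (Kb A) Y) a = a"
    using Kb_Comp[OF X Y Y f chain_map_Ident[OF Y]] Ident_Comp[OF F] by (simp add: a K)
next
  fix a b c X Y Z W
  assume "a \<in> Hom (Kb A) X Y" "b \<in> Hom (Kb A) Y Z" "c \<in> Hom (Kb A) Z W"
  then obtain f g h where X: "is_complex A X" and Y: "is_complex A Y" and Z: "is_complex A Z"
    and W: "is_complex A W" and f: "chain_map A X Y f" and g: "chain_map A Y Z g" and h: "chain_map A Z W h"
    and a: "a = ho_class A X Y f" and b: "b = ho_class A Y Z g" and c: "c = ho_class A Z W h"
    by (auto simp: Kb_Hom_iff bounded_complex_def)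
  have F: "f i \<in> Hom A (COb X i) (COb Y i)" and G: "g i \<in> Hom A (COb Y i) (COb Z i)"
    and H: "h i \<in> Hom A (COb Z i) (COb W i)" for i using f g h by (auto simp: chain_map_def)
  show "Comp (Kb A) c (Comp (Kb A) b a) = Comp (Kb A) (Comp (Kb A) c b) a"
    unfolding a b c
    using Kb_Comp[OF X Y Z f g] Kb_Comp[OF X Z W chain_map_Comp[OF X Y Z f g] h]
      Kb_Comp[OF Y Z W g h] Kb_Comp[OF X Y W f chain_map_Comp[OF Y Z W g h]] Comp_assoc[OF F G H] by simp
qed

lemma ZeroOb_Ob: "ZeroOb A \<in> Ob A"
  using zero_object_ZeroOb by (simp add: zero_object_def)

lemma stalk_bounded: "X \<in> Ob A \<Longrightarrow> bounded_complex A (stalk A X)"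
  unfolding bounded_complex_def is_complex_def
  using ZeroOb_Ob zero_object_ZeroOb
  by (auto simp: stalk_def ZeroArr_Hom intro!: exI[of _ 0] Comp_ZeroArr)

lemma stalk_chain_map:
  assumes f: "f \<in> Hom A X Y"
  shows "chain_map A (stalk A X) (stalk A Y) (stalk_map A f)"
  unfolding chain_map_def
proof (intro allI conjI)
  fix i
  have Z: "is_complex A (stalk A X)" "is_complex A (stalk A Y)"
    using stalk_bounded Hom_Ob[OF f] by (auto simp: bounded_complex_def)
  have H: "stalk_map A f j \<in> Hom A (COb (stalk A X) j) (COb (stalk A Y) j)" for j
    using f ZeroArr_Hom[OF ZeroOb_Ob ZeroOb_Ob] by (simp add: stalk_def stalk_map_def)
  then show "stalk_map A f i \<in> Hom A (COb (stalk A X) i) (COb (stalk A Y) i)" .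
  have "Diff (stalk A V) i = ZeroArr A (COb (stalk A V) i) (COb (stalk A V) (i + 1))" for V
    by (simp add: stalk_def)
  then show "Comp A (Diff (stalk A Y) i) (stalk_map A f i)
      = Comp A (stalk_map A f (i + 1)) (Diff (stalk A X) i)"
    using Comp_ZeroArr[OF complex_Hom(1)[OF Z(1)] H, of "i + 1" i]
      ZeroArr_Comp[OF complex_Hom(1)[OF Z(2)] H, of i "i + 1"] by simp
qed

lemma stalk_map_Comp:
  "f \<in> Hom A X Y \<Longrightarrow> g \<in> Hom A Y Z \<Longrightarrow>
    stalk_map A (Comp A g f) = (\<lambda>i. Comp A (stalk_map A g i) (stalk_map A f i))"
  using Comp_ZeroArr[OF ZeroOb_Ob ZeroArr_Hom[OF ZeroOb_Ob ZeroOb_Ob]] by (auto simp: stalk_map_def)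

lemma ZeroOb_Ident: "Ident A (ZeroOb A) = ZeroArr A (ZeroOb A) (ZeroOb A)"
  using zero_object_ZeroOb Ident_Hom[OF ZeroOb_Ob] ZeroArr_Hom[OF ZeroOb_Ob ZeroOb_Ob]
  unfolding zero_object_def by blast

theorem Kb_embed_functor: "is_functor A (Kb A) (Kb_embed A)"
proof -
  interpret K: category "Kb A" by (rule Kb_category)
  show ?thesis
  proof
    fix X assume X: "X \<in> Ob A"
    then show "ObMap (Kb_embed A) X \<in> Ob (Kb A)"
      using stalk_bounded by (simp add: Kb_embed_def Kb_def)
    have "stalk_map A (Ident A X) = (\<lambda>i. Ident A (COb (stalk A X) i))"
      by (auto simp: stalk_map_def stalk_def ZeroOb_Ident)
    then show "ArrMap (Kb_embed A) (Ident A X) = Ident (Kb A) (ObMap (Kb_embed A) X)"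
      using HomD[OF Ident_Hom[OF X]] by (simp add: Kb_embed_def Kb_def)
  next
    fix f X Y assume f: "f \<in> Hom A X Y"
    then show "ArrMap (Kb_embed A) f \<in> Hom (Kb A) (ObMap (Kb_embed A) X) (ObMap (Kb_embed A) Y)"
      using stalk_chain_map[OF f] stalk_bounded Hom_Ob[OF f] HomD[OF f]
      by (auto simp: Kb_embed_def Kb_Hom_iff)
  next
    fix f g X Y Z assume f: "f \<in> Hom A X Y" and g: "g \<in> Hom A Y Z"
    have "is_complex A (stalk A X)" "is_complex A (stalk A Y)" "is_complex A (stalk A Z)"
      using stalk_bounded Hom_Ob[OF f] Hom_Ob[OF g] by (auto simp: bounded_complex_def)
    from Kb_Comp[OF this stalk_chain_map[OF f] stalk_chain_map[OF g]]
    show "ArrMap (Kb_embed A) (Comp A g f) = Comp (Kb A) (ArrMap (Kb_embed A) g) (ArrMap (Kb_embed A) f)"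
      using HomD[OF f] HomD[OF g] HomD[OF Comp_Hom[OF f g]] stalk_map_Comp[OF f g]
      by (simp add: Kb_embed_def)
  qed
qed

lemma cone_in_Arr: "cone_in A P \<subseteq> Arr (Kb A)"
  by (auto simp: cone_in_def Kb_def)

lemma gz_add_loc_ArrMap:
  "f \<in> Arr A \<Longrightarrow> ArrMap (gz_add_loc A S) f
    = ArrMap (gz_loc (Kb A) (cone_in A (cone_subcat A S))) (ArrMap (Kb_embed A) f)"
  by (simp add: gz_add_loc_def fcomp_def)

lemma gz_add_Hom_iff:
  "f \<in> Hom (gz_add A S) X Y \<longleftrightarrow> f \<in> Hom (verdier_quotient A (cone_subcat A S)) X Y \<and>
    X \<in> stalk A ` Ob A \<and> Y \<in> stalk A ` Ob A"
  by (auto simp: gz_add_def full_subcat_def Hom_def)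

theorem gz_add_category: "category (gz_add A S)"
  unfolding gz_add_def verdier_quotient_def
  by (intro full_subcat_category category.gz_category Kb_category cone_in_Arr)

theorem gz_add_loc_functor: "is_functor A (gz_add A S) (gz_add_loc A S)"
proof -
  let ?W = "cone_in A (cone_subcat A S)"
  interpret V: category "gz_add A S" by (rule gz_add_category)
  interpret E: is_functor A "Kb A" "Kb_embed A" by (rule Kb_embed_functor)
  interpret L: is_functor "Kb A" "gz (Kb A) ?W" "gz_loc (Kb A) ?W"
    by (rule category.gz_loc_functor[OF Kb_category cone_in_Arr])
  have ops: "Ident (gz_add A S) = Ident (gz (Kb A) ?W)" "Comp (gz_add A S) = Comp (gz (Kb A) ?W)"
    by (simp_all add: gz_add_def full_subcat_def verdier_quotient_def)
  have stalk: "ObMap (gz_add_loc A S) X = stalk A X" for X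
    by (simp add: gz_add_loc_def fcomp_def gz_loc_def Kb_embed_def)
  show ?thesis
  proof
    fix X assume X: "X \<in> Ob A"
    then show "ObMap (gz_add_loc A S) X \<in> Ob (gz_add A S)"
      using stalk_bounded unfolding stalk
      by (simp add: gz_add_def full_subcat_def verdier_quotient_def gz_def Kb_def)
    show "ArrMap (gz_add_loc A S) (Ident A X) = Ident (gz_add A S) (ObMap (gz_add_loc A S) X)"
      using X E.ArrMap_Ident[OF X] L.ArrMap_Ident[OF E.ObMap_Ob[OF X]]
      by (simp add: gz_add_loc_def fcomp_def ops)
  next
    fix f X Y assume f: "f \<in> Hom A X Y"
    then show "ArrMap (gz_add_loc A S) f \<in> Hom (gz_add A S) (ObMap (gz_add_loc A S) X) (ObMap (gz_add_loc A S) Y)"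
      using L.ArrMap_Hom[OF E.ArrMap_Hom[OF f]] Hom_Ob[OF f]
      by (auto simp: gz_add_Hom_iff verdier_quotient_def gz_add_loc_def fcomp_def gz_loc_def Kb_embed_def)
  next
    fix f g X Y Z assume f: "f \<in> Hom A X Y" and g: "g \<in> Hom A Y Z"
    then show "ArrMap (gz_add_loc A S) (Comp A g f)
        = Comp (gz_add A S) (ArrMap (gz_add_loc A S) g) (ArrMap (gz_add_loc A S) f)"
      using L.ArrMap_Comp[OF E.ArrMap_Hom[OF f] E.ArrMap_Hom[OF g]] E.ArrMap_Comp[OF f g]
      by (simp add: gz_add_loc_def fcomp_def ops)
  qed
qed

theorem gz_add_loc_inverts:
  assumes S: "S \<subseteq> Arr A" and s: "s \<in> S"
  shows "is_iso (gz_add A S) (ArrMap (gz_add_loc A S) s)"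
proof -
  let ?W = "cone_in A (cone_subcat A S)"
  let ?f = "ArrMap (gz_add_loc A S) s"
  interpret V: is_functor A "gz_add A S" "gz_add_loc A S" by (rule gz_add_loc_functor)
  have s': "s \<in> Hom A (Dom A s) (Cod A s)" using s S by (auto simp: Hom_def)
  have "cone A (stalk A (Dom A s)) (stalk A (Cod A s)) (stalk_map A s) \<in> cone_subcat A S"
    using s by (auto simp: cone_subcat_def)
  then have "ArrMap (Kb_embed A) s \<in> ?W"
    using stalk_chain_map[OF s'] stalk_bounded Hom_Ob[OF s'] by (auto simp: cone_in_def Kb_embed_def)
  from category.gz_loc_inverts[OF Kb_category cone_in_Arr this]
  obtain g where g: "inverse_arrows (gz (Kb A) ?W) ?f g"
    using s S by (auto simp: is_iso_def gz_add_loc_ArrMap)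
  have f: "?f \<in> Hom (gz_add A S) (ObMap (gz_add_loc A S) (Dom A s)) (ObMap (gz_add_loc A S) (Cod A s))"
    using V.ArrMap_Hom[OF s'] .
  have ops: "Ident (gz_add A S) = Ident (gz (Kb A) ?W)" "Comp (gz_add A S) = Comp (gz (Kb A) ?W)"
    "Dom (gz_add A S) = Dom (gz (Kb A) ?W)" "Cod (gz_add A S) = Cod (gz (Kb A) ?W)"
    by (simp_all add: gz_add_def full_subcat_def verdier_quotient_def)
  have "inverse_arrows (gz_add A S) ?f g"
    using f g HomD[OF f] unfolding inverse_arrows_def ops gz_add_Hom_iff verdier_quotient_def by auto
  then show ?thesis unfolding is_iso_def by blast
qed

theorem gz_to_gz_add_functor:
  assumes S: "S \<subseteq> Arr A"
  shows "is_functor (gz A S) (gz_add A S) (gz_to_gz_add A S)"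
    "feq A (fcomp (gz_to_gz_add A S) (gz_loc A S)) (gz_add_loc A S)"
  unfolding gz_to_gz_add_def
  by (rule gz_universal(1)[OF S gz_add_loc_functor gz_add_loc_inverts[OF S]]
    gz_universal(2)[OF S gz_add_loc_functor gz_add_loc_inverts[OF S]], assumption)+

end

end

theory Submission
  imports Defs
begin

text \<open>
  Write \<open>B\<close> for \<open>\<A>[S\<inverse>]\<close> and \<open>V\<close> for the Verdier quotient of \<open>K\<^sup>b(\<A>)\<close>.

  \<^emph>\<open>Faithfulness.\<close>  Since \<open>S\<close> contains the identities and is closed under direct sums, the functors
  \<open>- \<oplus> Z\<close> and \<open>Z \<oplus> -\<close> descend to \<open>B\<close>, which therefore inherits binary products, and with them an
  addition, from \<open>\<A>\<close>: \<open>B\<close> is additive.  The induced functor \<open>K\<^sup>b(\<A>) \<rightarrow> K\<^sup>b(B)\<close> makes the cones of \<open>S\<close>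
  contractible, so it inverts the maps with cone in the triangulated subcategory that they generate
  and factors through \<open>V\<close>.  Its composite with \<open>Q\<close> is the embedding of \<open>B\<close> in \<open>K\<^sup>b(B)\<close>.

  \<^emph>\<open>Fullness.\<close>  Fix \<open>X\<close> in \<open>\<A>\<close> and consider pairs of a bounded complex \<open>Z\<close> that vanishes in negative
  degrees and a morphism \<open>\<phi> : X \<rightarrow> Z\<close> of \<open>V\<close> whose composite with the projection of \<open>Z\<close> to its term in
  degree \<open>0\<close> lies in the image of \<open>Q\<close>.  If \<open>g : Z \<rightarrow> C\<close> is a map to a shift of the cone of some
  \<open>s \<in> S\<close>, then \<open>\<phi>\<close> lifts to such a pair on which \<open>g\<close> vanishes: \<open>g\<close> is zero if \<open>C\<close> lives in negative
  degrees, and otherwise the cocone of \<open>g\<close> will do.  The complexes \<open>C\<close> with this lifting property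
  form a triangulated subcategory, hence include all complexes that are annihilated in \<open>V\<close>.  It follows that each
  morphism \<open>X \<rightarrow> M\<close> of \<open>V\<close> is a composite \<open>f \<circ> \<phi>\<close> with \<open>f\<close> in \<open>K\<^sup>b(\<A>)\<close>, and if \<open>M\<close> is concentrated in
  degree \<open>0\<close>, then \<open>f\<close> factors through the projection to degree \<open>0\<close>.
\<close>

section \<open>Rewrite rules for composites and a criterion for isomorphisms of categories\<close>

section \<open>Categories and functors\<close>

context category
begin

text \<open>The axioms are stated with \<open>Hom\<close>; the rules here and below restate them
  with \<open>Arr\<close>, \<open>Dom\<close> and \<open>Cod\<close>, whose side conditions can be
  discharged by rewriting. Composites are normalized to be nested to the right.\<close>

lemma Ident_simps [simp]:
  "X \<in> Ob C \<Longrightarrow> Ident C X \<in> Arr C" "X \<in> Ob C \<Longrightarrow> Dom C (Ident C X) = X"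
  "X \<in> Ob C \<Longrightarrow> Cod C (Ident C X) = X"
  using Ident_Hom[of X] by (auto simp: Hom_def)

lemma Comp_simps [simp]:
  assumes "f \<in> Arr C" "g \<in> Arr C" "Dom C g = Cod C f"
  shows "Comp C g f \<in> Arr C" "Dom C (Comp C g f) = Dom C f" "Cod C (Comp C g f) = Cod C g"
  using Comp_Hom[of f "Dom C f" "Cod C f" g "Cod C g"] assms by (auto simp: Hom_def)

lemma Comp_Ident_simp [simp]: "f \<in> Arr C \<Longrightarrow> Dom C f = X \<Longrightarrow> Comp C f (Ident C X) = f"
  by (rule Comp_Ident) (auto simp: Hom_def)

lemma Ident_Comp_simp [simp]: "f \<in> Arr C \<Longrightarrow> Cod C f = X \<Longrightarrow> Comp C (Ident C X) f = f"
  by (rule Ident_Comp) (auto simp: Hom_def)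

lemma Comp_assoc_simp [simp]:
  assumes "f \<in> Arr C" "g \<in> Arr C" "h \<in> Arr C" "Dom C g = Cod C f" "Dom C h = Cod C g"
  shows "Comp C (Comp C h g) f = Comp C h (Comp C g f)"
  by (rule Comp_assoc[symmetric]) (use assms in \<open>auto simp: Hom_def\<close>)

lemma Dom_Ob_simp [simp]: "f \<in> Arr C \<Longrightarrow> Dom C f \<in> Ob C"
  by (rule Dom_Ob)

lemma Cod_Ob_simp [simp]: "f \<in> Arr C \<Longrightarrow> Cod C f \<in> Ob C"
  by (rule Cod_Ob)

lemma is_isoI:
  assumes "f \<in> Hom C X Y" "g \<in> Hom C Y X" "Comp C g f = Ident C X" "Comp C f g = Ident C Y"
  shows "is_iso C f"
  unfolding is_iso_def inverse_arrows_def using assms HomD[OF assms(1)] by auto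

lemma is_isoE:
  assumes "is_iso C f" "f \<in> Hom C X Y"
  obtains g where "g \<in> Hom C Y X" "Comp C g f = Ident C X" "Comp C f g = Ident C Y"
  using assms HomD[OF assms(2)] unfolding is_iso_def inverse_arrows_def by auto

lemma is_iso_Comp:
  assumes "is_iso C f" "is_iso C g" "f \<in> Hom C X Y" "g \<in> Hom C Y Z"
  shows "is_iso C (Comp C g f)"
proof -
  obtain f' where f': "f' \<in> Hom C Y X" "Comp C f' f = Ident C X" "Comp C f f' = Ident C Y"
    using is_isoE assms(1,3) by blast
  obtain g' where g': "g' \<in> Hom C Z Y" "Comp C g' g = Ident C Y" "Comp C g g' = Ident C Z"
    using is_isoE assms(2,4) by blast
  have "Comp C (Comp C f' g') (Comp C g f) = Comp C f' (Comp C (Comp C g' g) f)"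
    "Comp C (Comp C g f) (Comp C f' g') = Comp C g (Comp C (Comp C f f') g')"
    using assms f'(1) g'(1) by (simp_all add: Hom_def del: f' g')
  then show ?thesis
    using assms f' g' by (intro is_isoI[of _ X Z "Comp C f' g'"]) (auto simp: Comp_Hom Ident_Comp)
qed

end

lemma fid_functor: "category C \<Longrightarrow> is_functor C C fid"
  by (simp add: is_functor_def is_functor_axioms_def fid_def)

lemma const_functor:
  "category C \<Longrightarrow> category D \<Longrightarrow> Z \<in> Ob D \<Longrightarrow> is_functor C D \<lparr>ObMap = \<lambda>X. Z, ArrMap = \<lambda>f. Ident D Z\<rparr>"
  by (auto simp: is_functor_def is_functor_axioms_def category.Ident_Hom category.Comp_Ident_simp category.Ident_simps)

lemma fcomp_functor:
  assumes "is_functor C D F" "is_functor D E G" shows "is_functor C E (fcomp G F)"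
proof -
  interpret F: is_functor C D F by fact
  interpret G: is_functor D E G by fact
  show ?thesis
    by unfold_locales
      (auto simp: fcomp_def F.ObMap_Ob G.ObMap_Ob F.ArrMap_Ident G.ArrMap_Ident F.ArrMap_Comp
        intro: F.ArrMap_Hom G.ArrMap_Hom G.ArrMap_Comp)
qed

context is_functor
begin

lemma ArrMap_simps [simp]:
  assumes "f \<in> Arr C"
  shows "ArrMap F f \<in> Arr D" "Dom D (ArrMap F f) = ObMap F (Dom C f)" "Cod D (ArrMap F f) = ObMap F (Cod C f)"
  using ArrMap_Hom[of f "Dom C f" "Cod C f"] assms by (auto simp: Hom_def)

lemma ArrMap_Comp_simp:
  assumes "f \<in> Arr C" "g \<in> Arr C" "Dom C g = Cod C f"
  shows "ArrMap F (Comp C g f) = Comp D (ArrMap F g) (ArrMap F f)"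
  using ArrMap_Comp[of f "Dom C f" "Cod C f" g "Cod C g"] assms by (auto simp: Hom_def)

lemma ArrMap_is_iso:
  assumes "is_iso C f" "f \<in> Arr C" shows "is_iso D (ArrMap F f)"
proof -
  obtain g where g: "g \<in> Hom C (Cod C f) (Dom C f)" "Comp C g f = Ident C (Dom C f)" "Comp C f g = Ident C (Cod C f)"
    using dom.is_isoE[OF assms(1), of "Dom C f" "Cod C f"] assms(2) by (auto simp: Hom_def)
  have f: "f \<in> Hom C (Dom C f) (Cod C f)" using assms(2) by (simp add: Hom_def)
  show ?thesis
    by (rule cod.is_isoI[OF ArrMap_Hom[OF f] ArrMap_Hom[OF g(1)]])
      (use assms(2) ArrMap_Comp[OF f g(1)] ArrMap_Comp[OF g(1) f] g in \<open>simp_all add: ArrMap_Ident\<close>)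
qed

end

text \<open>Injectivity on objects makes arrows with equal images parallel, so injectivity on hom
  sets gives injectivity on all arrows; the set-theoretic inverses then form the inverse
  functor.\<close>

lemma cat_isomorphismI:
  assumes F: "is_functor C D F" and inj: "inj_on (ObMap F) (Ob C)" and surj: "Ob D \<subseteq> ObMap F ` Ob C"
    and faithful: "\<And>X Y. X \<in> Ob C \<Longrightarrow> Y \<in> Ob C \<Longrightarrow> inj_on (ArrMap F) (Hom C X Y)"
    and full: "\<And>X Y. X \<in> Ob C \<Longrightarrow> Y \<in> Ob C \<Longrightarrow> Hom D (ObMap F X) (ObMap F Y) \<subseteq> ArrMap F ` Hom C X Y"
  shows "cat_isomorphism C D F"
proof -
  interpret F: is_functor C D F by fact
  have "f = g" if f: "f \<in> Arr C" and g: "g \<in> Arr C" and e: "ArrMap F f = ArrMap F g" for f g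
  proof -
    have "Dom C f = Dom C g" "Cod C f = Cod C g"
      using F.ArrMap_simps(2,3)[OF f] F.ArrMap_simps(2,3)[OF g] e inj f g F.dom.Dom_Ob F.dom.Cod_Ob
      by (metis inj_onD)+
    then show ?thesis
      using faithful[OF F.dom.Dom_Ob[OF f] F.dom.Cod_Ob[OF f]] f g e by (auto simp: Hom_def inj_on_def)
  qed
  then have injA: "inj_on (ArrMap F) (Arr C)" by (auto simp: inj_on_def)
  define G where "G = \<lparr>ObMap = inv_into (Ob C) (ObMap F), ArrMap = inv_into (Arr C) (ArrMap F)\<rparr>"
  have GO [simp]: "ObMap G (ObMap F X) = X" if "X \<in> Ob C" for X using that inj by (simp add: G_def)
  have GA [simp]: "ArrMap G (ArrMap F f) = f" if "f \<in> Arr C" for f using that injA by (simp add: G_def)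
  have O: "\<exists>X'. X' \<in> Ob C \<and> X = ObMap F X'" if "X \<in> Ob D" for X using that surj by blast
  have H: "\<exists>X' Y' f'. f' \<in> Hom C X' Y' \<and> X' \<in> Ob C \<and> Y' \<in> Ob C \<and> X = ObMap F X' \<and> Y = ObMap F Y' \<and> f = ArrMap F f'"
    if f: "f \<in> Hom D X Y" for f X Y
  proof -
    obtain X' Y' where "X' \<in> Ob C" "X = ObMap F X'" "Y' \<in> Ob C" "Y = ObMap F Y'"
      using O F.cod.Hom_Ob[OF f] by metis
    then show ?thesis using f full[of X' Y'] by blast
  qed
  have "is_functor D C G"
  proof (intro is_functor.intro is_functor_axioms.intro F.dom.category_axioms F.cod.category_axioms)
    fix X assume "X \<in> Ob D"
    then obtain X' where "X' \<in> Ob C" "X = ObMap F X'" using O by blast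
    then show "ObMap G X \<in> Ob C" "ArrMap G (Ident D X) = Ident C (ObMap G X)"
      by (simp_all add: F.ArrMap_Ident[symmetric])
  next
    fix f X Y assume "f \<in> Hom D X Y"
    from H[OF this] show "ArrMap G f \<in> Hom C (ObMap G X) (ObMap G Y)" by (auto simp: Hom_def)
  next
    fix f g X Y Z assume f: "f \<in> Hom D X Y" and g: "g \<in> Hom D Y Z"
    obtain X' Y' f' where 1: "f' \<in> Hom C X' Y'" "Y' \<in> Ob C" "Y = ObMap F Y'" "f = ArrMap F f'" using H[OF f] by blast
    obtain Y'' Z' g' where 2: "g' \<in> Hom C Y'' Z'" "Y'' \<in> Ob C" "Y = ObMap F Y''" "g = ArrMap F g'" using H[OF g] by blast
    \<comment> \<open>The preimages of the middle object coming from \<open>f\<close> and from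
      \<open>g\<close> are obtained separately; that they agree makes \<open>f'\<close> and
      \<open>g'\<close> composable.\<close>
    have "Y'' = Y'" using 1 2 inj by (auto simp: inj_on_def)
    then show "ArrMap G (Comp D g f) = Comp C (ArrMap G g) (ArrMap G f)"
      using F.ArrMap_Comp[OF 1(1), of g' Z', symmetric] F.dom.Comp_Hom[OF 1(1), of g' Z'] 1 2 HomD[OF 1(1)] HomD[OF 2(1)]
      by (simp add: Hom_def)
  qed
  moreover have "ObMap F (ObMap G X) = X" if X: "X \<in> Ob D" for X using O[OF X] by auto
  moreover have "ArrMap F (ArrMap G f) = f" if "f \<in> Arr D" for f
  proof -
    have "f \<in> Hom D (Dom D f) (Cod D f)" using that by (simp add: Hom_def)
    from H[OF this] show ?thesis by (auto simp: Hom_def)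
  qed
  ultimately show ?thesis
    unfolding cat_isomorphism_def feq_def fcomp_def fid_def using F by (intro conjI exI[of _ G]) simp_all
qed

text \<open>Serves to compose the natural functor, whose target is a full subcategory, with a
  functor defined on the whole Verdier quotient.\<close>

lemma full_subcat_inclusion:
  assumes "category C" shows "is_functor (full_subcat C P) C fid"
proof -
  have "\<And>f X Y. f \<in> Hom (full_subcat C P) X Y \<Longrightarrow> f \<in> Hom C X Y" by (auto simp: full_subcat_def Hom_def)
  then show ?thesis
    using assms full_subcat_category[OF assms]
    by (auto simp: is_functor_def is_functor_axioms_def fid_def full_subcat_def)
qed

section \<open>Calculation in hom groups and with biproducts\<close>

section \<open>Additive categories\<close>

context additive_category
begin

lemma Add_simps [simp]:
  assumes "f \<in> Arr A" "g \<in> Arr A" "Dom A f = Dom A g" "Cod A f = Cod A g"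
  shows "Add A f g \<in> Arr A" "Dom A (Add A f g) = Dom A g" "Cod A (Add A f g) = Cod A g"
  using Add_Hom[of f "Dom A f" "Cod A f" g] assms by (auto simp: Hom_def)

lemma neg_simps [simp]:
  assumes "f \<in> Arr A"
  shows "neg A f \<in> Arr A" "Dom A (neg A f) = Dom A f" "Cod A (neg A f) = Cod A f"
  using neg_Hom[of f "Dom A f" "Cod A f"] assms by (auto simp: Hom_def)

lemma ZeroArr_simps [simp]:
  assumes "X \<in> Ob A" "Y \<in> Ob A"
  shows "ZeroArr A X Y \<in> Arr A" "Dom A (ZeroArr A X Y) = X" "Cod A (ZeroArr A X Y) = Y"
  using ZeroArr_Hom[OF assms] by (auto simp: Hom_def)

lemma DSum_simps [simp]:
  assumes "X \<in> Ob A" "Y \<in> Ob A"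
  shows "DSum A X Y \<in> Ob A"
    "In1 A X Y \<in> Arr A" "Dom A (In1 A X Y) = X" "Cod A (In1 A X Y) = DSum A X Y"
    "In2 A X Y \<in> Arr A" "Dom A (In2 A X Y) = Y" "Cod A (In2 A X Y) = DSum A X Y"
    "Pr1 A X Y \<in> Arr A" "Dom A (Pr1 A X Y) = DSum A X Y" "Cod A (Pr1 A X Y) = X"
    "Pr2 A X Y \<in> Arr A" "Dom A (Pr2 A X Y) = DSum A X Y" "Cod A (Pr2 A X Y) = Y"
    "Comp A (Pr1 A X Y) (In1 A X Y) = Ident A X"
    "Comp A (Pr2 A X Y) (In2 A X Y) = Ident A Y"
    "Comp A (Pr1 A X Y) (In2 A X Y) = ZeroArr A Y X"
    "Comp A (Pr2 A X Y) (In1 A X Y) = ZeroArr A X Y"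
  using DSum_Ob[OF assms] In1_Hom[OF assms] In2_Hom[OF assms] Pr1_Hom[OF assms] Pr2_Hom[OF assms]
    Pr1_In1[OF assms] Pr2_In2[OF assms] Pr1_In2[OF assms] Pr2_In1[OF assms]
  by (auto simp: Hom_def)

lemma ZeroOb_simp [simp]: "ZeroOb A \<in> Ob A"
  by (rule ZeroOb_Ob)

lemma Add_ZeroArr_simp [simp]:
  assumes "f \<in> Arr A" "Dom A f = X" "Cod A f = Y"
  shows "Add A f (ZeroArr A X Y) = f" "Add A (ZeroArr A X Y) f = f"
  using assms Add_ZeroArr[of f X Y] Add_comm[of f X Y "ZeroArr A X Y"] ZeroArr_Hom[of X Y]
  by (auto simp: Hom_def)

lemma Comp_ZeroArr_simp [simp]:
  assumes "f \<in> Arr A"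
  shows "X \<in> Ob A \<Longrightarrow> Dom A f = Y \<Longrightarrow> Comp A f (ZeroArr A X Y) = ZeroArr A X (Cod A f)"
    "X \<in> Ob A \<Longrightarrow> Cod A f = Y \<Longrightarrow> Comp A (ZeroArr A Y X) f = ZeroArr A (Dom A f) X"
  using assms Comp_ZeroArr[of X f Y "Cod A f"] ZeroArr_Comp[of X f "Dom A f" Y] by (auto simp: Hom_def)

lemma Comp_Add_simp [simp]:
  assumes "f \<in> Arr A" "g \<in> Arr A" "h \<in> Arr A" "Dom A g = Dom A h" "Cod A g = Cod A h"
  shows "Dom A h = Cod A f \<Longrightarrow> Comp A (Add A g h) f = Add A (Comp A g f) (Comp A h f)"
    "Dom A f = Cod A h \<Longrightarrow> Comp A f (Add A g h) = Add A (Comp A f g) (Comp A f h)"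
  using assms Comp_Add_left[of f "Dom A f" "Cod A f" g "Cod A g" h]
    Comp_Add_right[of g "Dom A g" "Cod A g" h f "Cod A f"] by (auto simp: Hom_def)

lemma Comp_neg_simp [simp]:
  assumes "f \<in> Arr A" "g \<in> Arr A" "Dom A g = Cod A f"
  shows "Comp A (neg A g) f = neg A (Comp A g f)" "Comp A g (neg A f) = neg A (Comp A g f)"
  using assms Comp_neg[of f "Dom A f" "Cod A f" g "Cod A g"] neg_Comp[of f "Dom A f" "Cod A f" g "Cod A g"]
  by (auto simp: Hom_def)

lemma Add_comm_Arr:
  assumes "f \<in> Arr A" "g \<in> Arr A" "Dom A f = Dom A g" "Cod A f = Cod A g"
  shows "Add A f g = Add A g f"
  using assms Add_comm[of f "Dom A f" "Cod A f" g] by (auto simp: Hom_def)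

lemma Add_assoc_Arr [simp]:
  assumes "f \<in> Arr A" "g \<in> Arr A" "h \<in> Arr A" "Dom A f = Dom A g" "Cod A f = Cod A g"
    "Dom A g = Dom A h" "Cod A g = Cod A h"
  shows "Add A (Add A f g) h = Add A f (Add A g h)"
  using assms Add_assoc[of f "Dom A f" "Cod A f" g h] by (auto simp: Hom_def)

lemma Add_left_comm_Arr:
  assumes "f \<in> Arr A" "g \<in> Arr A" "h \<in> Arr A" "Dom A f = Dom A g" "Cod A f = Cod A g"
    "Dom A g = Dom A h" "Cod A g = Cod A h"
  shows "Add A f (Add A g h) = Add A g (Add A f h)"
  using assms Add_assoc_Arr[of f g h] Add_assoc_Arr[of g f h] Add_comm_Arr[of f g] by simp

lemma Add_neg_simp [simp]:
  assumes "f \<in> Arr A"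
  shows "Add A f (neg A f) = ZeroArr A (Dom A f) (Cod A f)"
    "Add A (neg A f) f = ZeroArr A (Dom A f) (Cod A f)"
  using assms Add_neg[of f "Dom A f" "Cod A f"] Add_comm_Arr[of f "neg A f"] by (auto simp: Hom_def)

lemma Add_neg_cancel [simp]:
  assumes "f \<in> Arr A" "g \<in> Arr A" "Dom A f = Dom A g" "Cod A f = Cod A g"
  shows "Add A f (Add A (neg A f) g) = g" "Add A (neg A f) (Add A f g) = g"
proof -
  have "Add A f (Add A (neg A f) g) = Add A (Add A f (neg A f)) g"
    "Add A (neg A f) (Add A f g) = Add A (Add A (neg A f) f) g"
    using assms by (simp_all del: Add_neg_simp)
  then show "Add A f (Add A (neg A f) g) = g" "Add A (neg A f) (Add A f g) = g"
    using assms by simp_all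
qed

text \<open>Reordering a sum may leave a summand and its negative separated by another summand;
  these rules cancel them in that position.\<close>

lemma Add_neg_cancel_left_comm:
  assumes "f \<in> Arr A" "g \<in> Arr A" "h \<in> Arr A" "Dom A f = Dom A g" "Cod A f = Cod A g"
    "Dom A f = Dom A h" "Cod A f = Cod A h"
  shows "Add A f (Add A g (neg A f)) = g" "Add A (neg A f) (Add A g f) = g"
    "Add A f (Add A g (Add A (neg A f) h)) = Add A g h" "Add A (neg A f) (Add A g (Add A f h)) = Add A g h"
  using assms by (simp_all add: Add_left_comm_Arr[of f g] Add_left_comm_Arr[of "neg A f" g])

lemmas Add_ac = Add_comm_Arr Add_left_comm_Arr Add_neg_cancel_left_comm

lemma neg_neg [simp]: "f \<in> Arr A \<Longrightarrow> neg A (neg A f) = f"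
  using neg_unique[of "neg A f" "Dom A f" "Cod A f" f] by (simp add: Hom_def)

lemma neg_ZeroArr [simp]: "X \<in> Ob A \<Longrightarrow> Y \<in> Ob A \<Longrightarrow> neg A (ZeroArr A X Y) = ZeroArr A X Y"
  using neg_unique[of "ZeroArr A X Y" X Y "ZeroArr A X Y"] by (simp add: Hom_def)

lemma neg_Add [simp]:
  assumes "f \<in> Arr A" "g \<in> Arr A" "Dom A f = Dom A g" "Cod A f = Cod A g"
  shows "neg A (Add A f g) = Add A (neg A f) (neg A g)"
proof (rule neg_unique[symmetric])
  show "Add A (Add A f g) (Add A (neg A f) (neg A g)) = ZeroArr A (Dom A f) (Cod A f)"
    using assms by (simp add: Add_left_comm_Arr[of g "neg A f" "neg A g"])
qed (use assms in \<open>auto simp: Hom_def\<close>)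

lemma Add_cancel_left:
  assumes "f \<in> Arr A" "g \<in> Arr A" "h \<in> Arr A" "Dom A f = Dom A g" "Cod A f = Cod A g"
    "Dom A f = Dom A h" "Cod A f = Cod A h" "Add A f g = Add A f h"
  shows "g = h"
proof -
  have "g = Add A (neg A f) (Add A f g)" using assms(1-7) by simp
  also have "\<dots> = h" using assms(1-7) unfolding assms(8) by simp
  finally show ?thesis .
qed

text \<open>Since composites are nested to the right, a projection after an inclusion is no subterm
  of a longer composite. The rules are therefore repeated with a further arrow attached;
  \<open>chain_mapD'\<close> and \<open>cone_Diff'\<close> have the same purpose.\<close>

lemma Pr_In_simps [simp]:
  assumes "X \<in> Ob A" "Y \<in> Ob A" "f \<in> Arr A"
  shows "Cod A f = X \<Longrightarrow> Comp A (Pr1 A X Y) (Comp A (In1 A X Y) f) = f"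
    "Cod A f = Y \<Longrightarrow> Comp A (Pr2 A X Y) (Comp A (In2 A X Y) f) = f"
    "Cod A f = Y \<Longrightarrow> Comp A (Pr1 A X Y) (Comp A (In2 A X Y) f) = ZeroArr A (Dom A f) X"
    "Cod A f = X \<Longrightarrow> Comp A (Pr2 A X Y) (Comp A (In1 A X Y) f) = ZeroArr A (Dom A f) Y"
  using assms Comp_assoc_simp[of f "In1 A X Y" "Pr1 A X Y"] Comp_assoc_simp[of f "In2 A X Y" "Pr2 A X Y"]
    Comp_assoc_simp[of f "In2 A X Y" "Pr1 A X Y"] Comp_assoc_simp[of f "In1 A X Y" "Pr2 A X Y"]
  by (simp_all del: Comp_assoc_simp)

lemma In_Pr_expand:
  assumes "X \<in> Ob A" "Y \<in> Ob A" "f \<in> Arr A" "Cod A f = DSum A X Y"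
  shows "Add A (Comp A (In1 A X Y) (Comp A (Pr1 A X Y) f)) (Comp A (In2 A X Y) (Comp A (Pr2 A X Y) f)) = f"
proof -
  have "Comp A (Add A (Comp A (In1 A X Y) (Pr1 A X Y)) (Comp A (In2 A X Y) (Pr2 A X Y))) f = f"
    using assms In_Pr_sum[of X Y] by (simp del: Comp_Add_simp)
  then show ?thesis using assms by simp
qed

text \<open>By \<open>In_Pr_expand\<close> an arrow into a sum is recovered from its two components.
  Identities between arrows into cones are checked in this way.\<close>

lemma DSum_eqI:
  assumes "X \<in> Ob A" "Y \<in> Ob A" "f \<in> Arr A" "g \<in> Arr A" "Cod A f = DSum A X Y" "Cod A g = DSum A X Y"
    "Comp A (Pr1 A X Y) f = Comp A (Pr1 A X Y) g" "Comp A (Pr2 A X Y) f = Comp A (Pr2 A X Y) g"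
  shows "f = g"
  by (metis In_Pr_expand assms)

lemma zero_object_to:
  "zero_object A Z \<Longrightarrow> f \<in> Hom A X Z \<Longrightarrow> f = ZeroArr A X Z"
  using ZeroArr_Hom[of X Z] Hom_Ob[of f X Z] unfolding zero_object_def by blast

lemma zero_object_from:
  "zero_object A Z \<Longrightarrow> f \<in> Hom A Z X \<Longrightarrow> f = ZeroArr A Z X"
  using ZeroArr_Hom[of Z X] Hom_Ob[of f Z X] unfolding zero_object_def by blast

text \<open>Every arrow into or out of \<open>Z\<close> is a composite with the identity of
  \<open>Z\<close>, hence zero.\<close>

lemma zero_objectI:
  assumes "Z \<in> Ob A" "Ident A Z = ZeroArr A Z Z"
  shows "zero_object A Z"
proof -
  have "f = ZeroArr A X Z" if f: "f \<in> Hom A X Z" for f X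
    using Ident_Comp[OF f] ZeroArr_Comp[OF assms(1) f] unfolding assms(2) by simp
  moreover have "f = ZeroArr A Z X" if f: "f \<in> Hom A Z X" for f X
    using Comp_Ident[OF f] Comp_ZeroArr[OF assms(1) f] unfolding assms(2) by simp
  ultimately show ?thesis
    unfolding zero_object_def using assms(1) ZeroArr_Hom by blast
qed

lemma zero_object_Ident: "zero_object A Z \<Longrightarrow> Ident A Z = ZeroArr A Z Z"
  using zero_object_to[of Z "Ident A Z" Z] Ident_Hom[of Z] by (simp add: zero_object_def)

lemma zero_object_DSum:
  assumes "zero_object A X" "zero_object A Y" shows "zero_object A (DSum A X Y)"
proof (rule zero_objectI)
  have [simp]: "X \<in> Ob A" "Y \<in> Ob A" using assms by (auto simp: zero_object_def)
  show "DSum A X Y \<in> Ob A" by simp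
  show "Ident A (DSum A X Y) = ZeroArr A (DSum A X Y) (DSum A X Y)"
    using zero_object_to[OF assms(1) Pr1_Hom[of X Y]] zero_object_to[OF assms(2) Pr2_Hom[of X Y]]
    by - (rule DSum_eqI[of X Y], simp_all)
qed

lemma zero_object_to_eq: "zero_object A Z \<Longrightarrow> f \<in> Hom A X Z \<Longrightarrow> g \<in> Hom A X Z \<Longrightarrow> f = g"
  using zero_object_to by metis

section \<open>Direct sums of arrows, zero summands and transvections\<close>

lemma dsum_arr_simps [simp]:
  assumes "f \<in> Arr A" "g \<in> Arr A"
  shows "dsum_arr A f g \<in> Arr A" "Dom A (dsum_arr A f g) = DSum A (Dom A f) (Dom A g)"
    "Cod A (dsum_arr A f g) = DSum A (Cod A f) (Cod A g)"
    "X = Cod A f \<Longrightarrow> Y = Cod A g \<Longrightarrow>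
      Comp A (Pr1 A X Y) (dsum_arr A f g) = Comp A f (Pr1 A (Dom A f) (Dom A g))"
    "X = Cod A f \<Longrightarrow> Y = Cod A g \<Longrightarrow>
      Comp A (Pr2 A X Y) (dsum_arr A f g) = Comp A g (Pr2 A (Dom A f) (Dom A g))"
  using assms by (simp_all add: dsum_arr_def)

lemma Comp_dsum_arr_simps [simp]:
  assumes "f \<in> Arr A" "g \<in> Arr A" "h \<in> Arr A" "Cod A h = DSum A (Dom A f) (Dom A g)" "X = Cod A f" "Y = Cod A g"
  shows "Comp A (Pr1 A X Y) (Comp A (dsum_arr A f g) h) = Comp A f (Comp A (Pr1 A (Dom A f) (Dom A g)) h)"
    "Comp A (Pr2 A X Y) (Comp A (dsum_arr A f g) h) = Comp A g (Comp A (Pr2 A (Dom A f) (Dom A g)) h)"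
  using assms Comp_assoc_simp[of h "dsum_arr A f g" "Pr1 A X Y"] Comp_assoc_simp[of h "dsum_arr A f g" "Pr2 A X Y"]
  by (simp_all del: Comp_assoc_simp) simp_all

lemma dsum_arr_Comp:
  assumes "f \<in> Arr A" "g \<in> Arr A" "f' \<in> Arr A" "g' \<in> Arr A" "Dom A f' = Cod A f" "Dom A g' = Cod A g"
  shows "dsum_arr A (Comp A f' f) (Comp A g' g) = Comp A (dsum_arr A f' g') (dsum_arr A f g)"
  by (rule DSum_eqI[of "Cod A f'" "Cod A g'"]) (use assms in simp_all)

lemma dsum_arr_Ident: "X \<in> Ob A \<Longrightarrow> Y \<in> Ob A \<Longrightarrow> dsum_arr A (Ident A X) (Ident A Y) = Ident A (DSum A X Y)"
  by (rule DSum_eqI[of X Y]) simp_all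

text \<open>The sum is treated as a functor in each variable separately, because the universal
  property of the localization applies to functors of one variable.\<close>

definition dsum_right :: "'o \<Rightarrow> ('o, 'm, 'o, 'm) fctr" where
  "dsum_right Z = \<lparr>ObMap = \<lambda>X. DSum A X Z, ArrMap = \<lambda>f. dsum_arr A f (Ident A Z)\<rparr>"

definition dsum_left :: "'o \<Rightarrow> ('o, 'm, 'o, 'm) fctr" where
  "dsum_left Z = \<lparr>ObMap = \<lambda>X. DSum A Z X, ArrMap = \<lambda>f. dsum_arr A (Ident A Z) f\<rparr>"

lemma dsum_functor:
  assumes "Z \<in> Ob A" shows "is_functor A A (dsum_right Z)" "is_functor A A (dsum_left Z)"
  by (unfold_locales; use assms dsum_arr_Comp[of _ "Ident A Z" _ "Ident A Z"] dsum_arr_Comp[of "Ident A Z" _ "Ident A Z"]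
    in \<open>auto simp: dsum_right_def dsum_left_def Hom_def dsum_arr_Ident\<close>)+

text \<open>Used to compare the differential \<open>X \<oplus> 0 \<rightarrow> 0 \<oplus> Y\<close>
  of the cone of \<open>s : X \<rightarrow> Y\<close> with \<open>s\<close> itself.\<close>

lemma zero_summand_iso:
  assumes Z: "zero_object A Z" and X: "X \<in> Ob A"
  shows "is_iso A (Pr1 A X Z)" "is_iso A (In2 A Z X)"
proof -
  have [simp]: "X \<in> Ob A" "Z \<in> Ob A" using assms by (simp_all add: zero_object_def)
  have "Comp A (In1 A X Z) (Pr1 A X Z) = Ident A (DSum A X Z)"
  proof (rule DSum_eqI[of X Z])
    show "Comp A (Pr2 A X Z) (Comp A (In1 A X Z) (Pr1 A X Z)) = Comp A (Pr2 A X Z) (Ident A (DSum A X Z))"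
      by (rule zero_object_to_eq[OF Z, of _ "DSum A X Z"]) (simp_all add: Hom_def)
  qed simp_all
  then show "is_iso A (Pr1 A X Z)"
    by (intro is_isoI[of _ "DSum A X Z" X "In1 A X Z"]) (simp_all add: Hom_def)
  have "Comp A (In2 A Z X) (Pr2 A Z X) = Ident A (DSum A Z X)"
  proof (rule DSum_eqI[of Z X])
    show "Comp A (Pr1 A Z X) (Comp A (In2 A Z X) (Pr2 A Z X)) = Comp A (Pr1 A Z X) (Ident A (DSum A Z X))"
      by (rule zero_object_to_eq[OF Z, of _ "DSum A Z X"]) (simp_all add: Hom_def)
  qed simp_all
  then show "is_iso A (In2 A Z X)"
    by (intro is_isoI[of _ X "DSum A Z X" "Pr2 A Z X"]) (simp_all add: Hom_def)
qed

text \<open>The second summand has square zero because \<open>Pr1\<close> after \<open>In2\<close>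
  vanishes, so the inverse is obtained by changing its sign.\<close>

lemma transvection_iso:
  assumes g: "g \<in> Hom A U R"
  shows "is_iso A (Add A (Ident A (DSum A U R)) (Comp A (In2 A U R) (Comp A g (Pr1 A U R))))"
proof -
  have [simp]: "U \<in> Ob A" "R \<in> Ob A" "g \<in> Arr A" "Dom A g = U" "Cod A g = R"
    using g Hom_Ob[OF g] by (auto simp: Hom_def)
  show ?thesis
    by (rule is_isoI[of _ "DSum A U R" "DSum A U R"
        "Add A (Ident A (DSum A U R)) (neg A (Comp A (In2 A U R) (Comp A g (Pr1 A U R))))"])
      (simp_all add: Hom_def Add_ac)
qed

end

section \<open>Complexes, shifts and cones\<close>

text \<open>Terms of complexes match only if their degrees agree syntactically; these rules give the
  degrees that arise from cones and homotopies a common form.\<close>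

lemma int_index [simp]: "i + 1 + 1 = i + (2 :: int)" "i + 2 - 1 = i + (1 :: int)" "i - 1 + 2 = i + (1 :: int)"
  by simp_all

context additive_category
begin

lemma complex_simps [simp]:
  assumes "is_complex A X"
  shows "COb X i \<in> Ob A" "Diff X i \<in> Arr A" "Dom A (Diff X i) = COb X i" "Cod A (Diff X i) = COb X (i + 1)"
    "j = i + 1 \<Longrightarrow> Comp A (Diff X j) (Diff X i) = ZeroArr A (COb X i) (COb X (i + 2))"
  using assms by (auto simp: is_complex_def Hom_def)

lemma complex_simps' [simp]:
  assumes "is_complex A X" "f \<in> Arr A" "Cod A f = COb X i" "j = i + 1"
  shows "Comp A (Diff X j) (Comp A (Diff X i) f) = ZeroArr A (Dom A f) (COb X (i + 2))"
  using assms Comp_assoc_simp[of f "Diff X i" "Diff X j"] by (simp del: Comp_assoc_simp)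

lemma chain_mapD:
  assumes "chain_map A X Y f"
  shows "f i \<in> Arr A" "Dom A (f i) = COb X i" "Cod A (f i) = COb Y i"
    "Comp A (Diff Y i) (f i) = Comp A (f (i + 1)) (Diff X i)"
  using assms by (auto simp: chain_map_def Hom_def)

lemma chain_mapD':
  assumes f: "chain_map A X Y f" and X: "is_complex A X" and Y: "is_complex A Y" and g: "g \<in> Arr A"
    and c: "Cod A g = COb X i"
  shows "Comp A (Diff Y i) (Comp A (f i) g) = Comp A (f (i + 1)) (Comp A (Diff X i) g)"
  using Comp_assoc_simp[of g "f i" "Diff Y i"] Comp_assoc_simp[of g "Diff X i" "f (i + 1)"]
    chain_mapD[OF f] X Y g c by (simp del: Comp_assoc_simp)

lemma chain_mapI:
  assumes "\<And>i. f i \<in> Arr A" "\<And>i. Dom A (f i) = COb X i" "\<And>i. Cod A (f i) = COb Y i"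
    "\<And>i. Comp A (Diff Y i) (f i) = Comp A (f (i + 1)) (Diff X i)"
  shows "chain_map A X Y f"
  using assms by (auto simp: chain_map_def Hom_def)

text \<open>The homotopy is an argument, so that it can be composed, added and decomposed
  explicitly. Homotopies between two chain maps are null-homotopies of their difference by
  \<open>homotopicI_nullhtp\<close> and \<open>homotopicE_nullhtp\<close>.\<close>

definition nullhtp :: "('o, 'm) cplx \<Rightarrow> ('o, 'm) cplx \<Rightarrow> (int \<Rightarrow> 'm) \<Rightarrow> (int \<Rightarrow> 'm) \<Rightarrow> bool" where
  "nullhtp X Y f h \<longleftrightarrow> (\<forall>i. h i \<in> Hom A (COb X i) (COb Y (i - 1)) \<and>
     f i = Add A (Comp A (Diff Y (i - 1)) (h i)) (Comp A (h (i + 1)) (Diff X i)))"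

lemma nullhtpD:
  assumes "nullhtp X Y f h"
  shows "h i \<in> Arr A" "Dom A (h i) = COb X i" "Cod A (h i) = COb Y (i - 1)"
    "f i = Add A (Comp A (Diff Y (i - 1)) (h i)) (Comp A (h (i + 1)) (Diff X i))"
  using assms by (auto simp: nullhtp_def Hom_def)

lemma nullhtpI:
  assumes "\<And>i. h i \<in> Arr A" "\<And>i. Dom A (h i) = COb X i" "\<And>i. Cod A (h i) = COb Y (i - 1)"
    "\<And>i. f i = Add A (Comp A (Diff Y (i - 1)) (h i)) (Comp A (h (i + 1)) (Diff X i))"
  shows "nullhtp X Y f h"
  using assms by (auto simp: nullhtp_def Hom_def)

lemma homotopic_zero_iff:
  assumes "is_complex A X" "is_complex A Y"
  shows "homotopic A X Y f (\<lambda>i. ZeroArr A (COb X i) (COb Y i)) \<longleftrightarrow> (\<exists>h. nullhtp X Y f h)"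
proof -
  have "(h i \<in> Hom A (COb X i) (COb Y (i - 1)) \<and> f i = Add A (ZeroArr A (COb X i) (COb Y i))
      (Add A (Comp A (Diff Y (i - 1)) (h i)) (Comp A (h (i + 1)) (Diff X i)))) \<longleftrightarrow>
    (h i \<in> Hom A (COb X i) (COb Y (i - 1)) \<and> f i =
      Add A (Comp A (Diff Y (i - 1)) (h i)) (Comp A (h (i + 1)) (Diff X i)))"
    if "\<And>i. h i \<in> Hom A (COb X i) (COb Y (i - 1))" for h i
  proof -
    have "h i \<in> Arr A" "Dom A (h i) = COb X i" "Cod A (h i) = COb Y (i - 1)" for i
      using that[of i] by (auto simp: Hom_def)
    then show ?thesis using assms by simp
  qed
  then show ?thesis unfolding homotopic_def nullhtp_def by meson
qed

lemma homotopicI_nullhtp: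
  assumes X: "is_complex A X" and Y: "is_complex A Y" and f: "chain_map A X Y f" and g: "chain_map A X Y g"
    and h: "nullhtp X Y (\<lambda>i. Add A (f i) (neg A (g i))) h"
  shows "homotopic A X Y f g"
proof -
  note [simp] = X Y chain_mapD(1-3)[OF f] chain_mapD(1-3)[OF g] nullhtpD(1-3)[OF h]
  have "f i = Add A (g i) (Add A (f i) (neg A (g i)))" for i
    by (simp add: Add_comm_Arr[of "f i" "neg A (g i)"])
  then have "f i = Add A (g i) (Add A (Comp A (Diff Y (i - 1)) (h i)) (Comp A (h (i + 1)) (Diff X i)))" for i
    using nullhtpD(4)[OF h, of i] by metis
  then show ?thesis unfolding homotopic_def using nullhtpD(1-3)[OF h] by (auto simp: Hom_def intro!: exI[of _ h])
qed

lemma homotopicE_nullhtp: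
  assumes X: "is_complex A X" and Y: "is_complex A Y" and f: "chain_map A X Y f" and g: "chain_map A X Y g"
    and fg: "homotopic A X Y f g"
  obtains h where "nullhtp X Y (\<lambda>i. Add A (f i) (neg A (g i))) h"
proof -
  obtain h where "\<forall>i. h i \<in> Hom A (COb X i) (COb Y (i - 1)) \<and>
     f i = Add A (g i) (Add A (Comp A (Diff Y (i - 1)) (h i)) (Comp A (h (i + 1)) (Diff X i)))"
    using fg unfolding homotopic_def by blast
  then have h [simp]: "h i \<in> Arr A" "Dom A (h i) = COb X i" "Cod A (h i) = COb Y (i - 1)"
    and e: "f i = Add A (g i) (Add A (Comp A (Diff Y (i - 1)) (h i)) (Comp A (h (i + 1)) (Diff X i)))" for i
    by (auto simp: Hom_def)
  note [simp] = X Y chain_mapD(1-3)[OF g]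
  have "nullhtp X Y (\<lambda>i. Add A (f i) (neg A (g i))) h"
    by (rule nullhtpI) (simp_all add: e Add_ac)
  then show ?thesis using that by blast
qed

lemma nullhtp_Comp_left:
  assumes X: "is_complex A X" and Y: "is_complex A Y" and Z: "is_complex A Z"
    and h: "nullhtp X Y f h" and g: "chain_map A Y Z g"
  shows "nullhtp X Z (\<lambda>i. Comp A (g i) (f i)) (\<lambda>i. Comp A (g (i - 1)) (h i))"
proof -
  note [simp] = X Y Z chain_mapD(1-3)[OF g] nullhtpD(1-3)[OF h] chain_mapD'[OF g Y Z]
  show ?thesis by (rule nullhtpI) (simp_all add: nullhtpD(4)[OF h])
qed

lemma nullhtp_Comp_right:
  assumes X: "is_complex A X" and Y: "is_complex A Y" and Z: "is_complex A Z"
    and h: "nullhtp Y Z f h" and g: "chain_map A X Y g"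
  shows "nullhtp X Z (\<lambda>i. Comp A (f i) (g i)) (\<lambda>i. Comp A (h i) (g i))"
proof -
  note [simp] = X Y Z chain_mapD[OF g] nullhtpD(1-3)[OF h]
  show ?thesis by (rule nullhtpI) (simp_all add: nullhtpD(4)[OF h])
qed

lemma nullhtp_Add:
  assumes X: "is_complex A X" and Y: "is_complex A Y"
    and h: "nullhtp X Y f h" and k: "nullhtp X Y g k"
  shows "nullhtp X Y (\<lambda>i. Add A (f i) (g i)) (\<lambda>i. Add A (h i) (k i))"
proof -
  note [simp] = X Y nullhtpD(1-3)[OF h] nullhtpD(1-3)[OF k]
  show ?thesis
    by (rule nullhtpI) (simp_all add: nullhtpD(4)[OF h] nullhtpD(4)[OF k] Add_ac)
qed

section \<open>Shifts\<close>

lemma shift_simps [simp]: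
  "COb (shift A n X) i = COb X (i + n)"
  "Diff (shift A n X) i = (if even n then Diff X (i + n) else neg A (Diff X (i + n)))"
  by (simp_all add: shift_def)

lemma is_complexI:
  assumes "\<And>i. COb X i \<in> Ob A" "\<And>i. Diff X i \<in> Arr A" "\<And>i. Dom A (Diff X i) = COb X i"
    "\<And>i. Cod A (Diff X i) = COb X (i + 1)"
    "\<And>i. Comp A (Diff X (i + 1)) (Diff X i) = ZeroArr A (COb X i) (COb X (i + 2))"
  shows "is_complex A X"
  unfolding is_complex_def Hom_def using assms by blast

lemma shift_index: "i + 1 + n = i + n + (1 :: int)" "i + 2 + n = i + n + (2 :: int)" "i - 1 + n = i + n - (1 :: int)"
  by simp_all

lemma shift_complex [simp]: "is_complex A X \<Longrightarrow> is_complex A (shift A n X)"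
  by (rule is_complexI) (simp_all add: shift_index[of _ n])

lemma shift_bounded:
  assumes "bounded_complex A X" shows "bounded_complex A (shift A n X)"
proof -
  obtain m where m: "\<And>i. \<bar>i\<bar> > m \<Longrightarrow> zero_object A (COb X i)"
    using assms by (auto simp: bounded_complex_def)
  have "zero_object A (COb (shift A n X) i)" if "\<bar>i\<bar> > m + \<bar>n\<bar>" for i
    using m[of "i + n"] that by simp
  then show ?thesis using assms by (auto simp: bounded_complex_def)
qed

text \<open>Two odd shifts negate each differential twice; the negations cancel because the
  differentials of a complex are arrows.\<close>

lemma shift_shift: "is_complex A X \<Longrightarrow> shift A m (shift A n X) = shift A (n + m) X"
  unfolding shift_def by (auto simp: fun_eq_iff algebra_simps)

lemma chain_map_shift:
  assumes X: "is_complex A X" and Y: "is_complex A Y" and f: "chain_map A X Y f"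
  shows "chain_map A (shift A n X) (shift A n Y) (\<lambda>i. f (i + n))"
  by (rule chain_mapI) (simp_all add: shift_index[of _ n] X Y chain_mapD[OF f])

text \<open>For odd \<open>n\<close> the differentials of both shifts change sign, and so the
  homotopy has to change sign as well.\<close>

lemma nullhtp_shift:
  assumes X: "is_complex A X" and Y: "is_complex A Y" and h: "nullhtp X Y f h"
  shows "nullhtp (shift A n X) (shift A n Y) (\<lambda>i. f (i + n))
    (\<lambda>i. if even n then h (i + n) else neg A (h (i + n)))"
  by (rule nullhtpI) (simp_all add: shift_index[of _ n] X Y nullhtpD[OF h])

section \<open>Cones\<close>

lemma cone_COb [simp]: "COb (cone A X Y f) i = DSum A (COb X (i + 1)) (COb Y i)"
  by (simp add: cone_def)

lemma cone_Diff:
  assumes X: "is_complex A X" and Y: "is_complex A Y" and f: "chain_map A X Y f"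
  shows "Diff (cone A X Y f) i \<in> Arr A"
    "Dom A (Diff (cone A X Y f) i) = DSum A (COb X (i + 1)) (COb Y i)"
    "Cod A (Diff (cone A X Y f) i) = DSum A (COb X (i + 2)) (COb Y (i + 1))"
    "j = i + 2 \<Longrightarrow> k = i + 1 \<Longrightarrow> Comp A (Pr1 A (COb X j) (COb Y k)) (Diff (cone A X Y f) i)
      = neg A (Comp A (Diff X (i + 1)) (Pr1 A (COb X (i + 1)) (COb Y i)))"
    "j = i + 2 \<Longrightarrow> k = i + 1 \<Longrightarrow> Comp A (Pr2 A (COb X j) (COb Y k)) (Diff (cone A X Y f) i)
      = Add A (Comp A (f (i + 1)) (Pr1 A (COb X (i + 1)) (COb Y i))) (Comp A (Diff Y i) (Pr2 A (COb X (i + 1)) (COb Y i)))"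
  by (simp_all add: cone_def X Y chain_mapD(1-3)[OF f])

lemma cone_Diff':
  assumes X: "is_complex A X" and Y: "is_complex A Y" and f: "chain_map A X Y f"
    and g: "g \<in> Arr A" "Cod A g = DSum A (COb X (i + 1)) (COb Y i)" and j: "j = i + 2" "k = i + 1"
  shows "Comp A (Pr1 A (COb X j) (COb Y k)) (Comp A (Diff (cone A X Y f) i) g)
      = neg A (Comp A (Diff X (i + 1)) (Comp A (Pr1 A (COb X (i + 1)) (COb Y i)) g))"
    "Comp A (Pr2 A (COb X j) (COb Y k)) (Comp A (Diff (cone A X Y f) i) g)
      = Add A (Comp A (f (i + 1)) (Comp A (Pr1 A (COb X (i + 1)) (COb Y i)) g))
          (Comp A (Diff Y i) (Comp A (Pr2 A (COb X (i + 1)) (COb Y i)) g))"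
proof -
  note [simp] = X Y g chain_mapD(1-3)[OF f] cone_Diff[OF X Y f]
  show "Comp A (Pr1 A (COb X j) (COb Y k)) (Comp A (Diff (cone A X Y f) i) g)
      = neg A (Comp A (Diff X (i + 1)) (Comp A (Pr1 A (COb X (i + 1)) (COb Y i)) g))"
    using Comp_assoc_simp[of g "Diff (cone A X Y f) i" "Pr1 A (COb X (i + 2)) (COb Y (i + 1))"]
    by (simp add: j del: Comp_assoc_simp) simp
  show "Comp A (Pr2 A (COb X j) (COb Y k)) (Comp A (Diff (cone A X Y f) i) g)
      = Add A (Comp A (f (i + 1)) (Comp A (Pr1 A (COb X (i + 1)) (COb Y i)) g))
          (Comp A (Diff Y i) (Comp A (Pr2 A (COb X (i + 1)) (COb Y i)) g))"
    using Comp_assoc_simp[of g "Diff (cone A X Y f) i" "Pr2 A (COb X (i + 2)) (COb Y (i + 1))"]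
    by (simp add: j del: Comp_assoc_simp) simp
qed

text \<open>In the first component the square of the differential of \<open>X\<close> appears; in
  the second the mixed terms \<open>d f\<close> and \<open>f (- d)\<close> cancel since
  \<open>f\<close> is a chain map.\<close>

lemma cone_complex:
  assumes X: "is_complex A X" and Y: "is_complex A Y" and f: "chain_map A X Y f"
  shows "is_complex A (cone A X Y f)"
proof (rule is_complexI)
  note [simp] = X Y chain_mapD(1-3)[OF f] chain_mapD'[OF f X Y] cone_Diff[OF X Y f] cone_Diff'[OF X Y f]
  fix i
  show "COb (cone A X Y f) i \<in> Ob A" "Diff (cone A X Y f) i \<in> Arr A"
    "Dom A (Diff (cone A X Y f) i) = COb (cone A X Y f) i"
    "Cod A (Diff (cone A X Y f) i) = COb (cone A X Y f) (i + 1)" by simp_all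
  show "Comp A (Diff (cone A X Y f) (i + 1)) (Diff (cone A X Y f) i)
      = ZeroArr A (COb (cone A X Y f) i) (COb (cone A X Y f) (i + 2))"
    by (rule DSum_eqI[of "COb X (3 + i)" "COb Y (i + 2)"]) simp_all
qed

lemma shift_0: "shift A 0 X = X"
  by (simp add: shift_def)

lemma cone_bounded:
  assumes X: "bounded_complex A X" and Y: "bounded_complex A Y" and f: "chain_map A X Y f"
  shows "bounded_complex A (cone A X Y f)"
proof -
  obtain m n where m: "\<And>i. \<bar>i\<bar> > m \<Longrightarrow> zero_object A (COb X i)" and n: "\<And>i. \<bar>i\<bar> > n \<Longrightarrow> zero_object A (COb Y i)"
    using X Y by (auto simp: bounded_complex_def)
  have "zero_object A (COb (cone A X Y f) i)" if "\<bar>i\<bar> > \<bar>m\<bar> + \<bar>n\<bar> + 1" for i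
    using m[of "i + 1"] n[of i] that by (simp add: zero_object_DSum)
  then show ?thesis using assms cone_complex by (auto simp: bounded_complex_def)
qed

lemma Kb_Ob_iff: "X \<in> Ob (Kb A) \<longleftrightarrow> bounded_complex A X"
  by (simp add: Kb_def)

lemma Kb_Ident: "Ident (Kb A) X = ho_class A X X (\<lambda>i. Ident A (COb X i))"
  by (simp add: Kb_def)

lemma bounded_is_complex [simp]: "bounded_complex A X \<Longrightarrow> is_complex A X"
  by (simp add: bounded_complex_def)

lemma ZeroArr_chain_map:
  "is_complex A X \<Longrightarrow> is_complex A Y \<Longrightarrow> chain_map A X Y (\<lambda>i. ZeroArr A (COb X i) (COb Y i))"
  by (rule chain_mapI) simp_all

text \<open>The identity and the zero map represent the same endomorphism of a zero object, hence
  they are homotopic.\<close>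

lemma Kb_zero_object_nullhtp:
  assumes "zero_object (Kb A) X"
  obtains h where "nullhtp X X (\<lambda>i. Ident A (COb X i)) h"
proof -
  have X: "bounded_complex A X" using assms by (simp add: zero_object_def Kb_Ob_iff)
  then have I: "chain_map A X X (\<lambda>i. Ident A (COb X i))" "chain_map A X X (\<lambda>i. ZeroArr A (COb X i) (COb X i))"
    using chain_map_Ident ZeroArr_chain_map by simp_all
  have "ho_class A X X (\<lambda>i. Ident A (COb X i)) = ho_class A X X (\<lambda>i. ZeroArr A (COb X i) (COb X i))"
    using assms X I unfolding zero_object_def by (metis Kb_Hom_iff)
  then show ?thesis
    using that ho_class_eq_iff[OF _ _ I] homotopic_zero_iff X by auto
qed

end

lemma strict_triangulatedD:
  assumes "strict_triangulated A P"
  shows "zero_object (Kb A) Z \<Longrightarrow> Z \<in> P"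
    and "X \<in> P \<Longrightarrow> Y \<in> Ob (Kb A) \<Longrightarrow> isomorphic (Kb A) X Y \<Longrightarrow> Y \<in> P"
    and "X \<in> P \<Longrightarrow> shift A n X \<in> P"
    and "X \<in> P \<Longrightarrow> Y \<in> P \<Longrightarrow> chain_map A X Y f \<Longrightarrow> cone A X Y f \<in> P"
  using assms unfolding strict_triangulated_def by auto

lemma strict_triangulatedI:
  assumes "P \<subseteq> Ob (Kb A)" "\<And>Z. zero_object (Kb A) Z \<Longrightarrow> Z \<in> P"
    and "\<And>X Y. X \<in> P \<Longrightarrow> Y \<in> Ob (Kb A) \<Longrightarrow> isomorphic (Kb A) X Y \<Longrightarrow> Y \<in> P"
    and "\<And>X n. X \<in> P \<Longrightarrow> shift A n X \<in> P"
    and "\<And>X Y f. X \<in> P \<Longrightarrow> Y \<in> P \<Longrightarrow> chain_map A X Y f \<Longrightarrow> cone A X Y f \<in> P"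
  shows "strict_triangulated A P"
  using assms unfolding strict_triangulated_def by blast

section \<open>Triangulated subcategories of killed complexes\<close>

text \<open>There are two instances.  With trivial refinements the killed complexes are the contractible
  ones.  In the proof of fullness the points are the pairs \<open>(Z, \<phi>)\<close> described above, and a refinement
  of such a pair is a lift of \<open>\<phi>\<close>.\<close>

locale refinement = additive_category A
  for A :: "('o, 'm, 'x) addcat_scheme" +
  fixes pts :: "'p set" and cx :: "'p \<Rightarrow> ('o, 'm) cplx" and refines :: "'p \<Rightarrow> 'p \<Rightarrow> (int \<Rightarrow> 'm) \<Rightarrow> bool"
  assumes cx_complex: "p \<in> pts \<Longrightarrow> is_complex A (cx p)"
    and refines_chain_map: "p \<in> pts \<Longrightarrow> p' \<in> pts \<Longrightarrow> refines p' p r \<Longrightarrow> chain_map A (cx p') (cx p) r"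
    and refines_refl: "p \<in> pts \<Longrightarrow> refines p p (\<lambda>i. Ident A (COb (cx p) i))"
    and refines_trans: "p \<in> pts \<Longrightarrow> p' \<in> pts \<Longrightarrow> p'' \<in> pts \<Longrightarrow> refines p' p r \<Longrightarrow> refines p'' p' r' \<Longrightarrow>
      refines p'' p (\<lambda>i. Comp A (r i) (r' i))"
begin

text \<open>Maps from points into \<open>Z\<close> have to vanish locally, that is, after a
  refinement. Testing all shifts at once makes the class closed under shifts.\<close>

definition killed :: "('o, 'm) cplx \<Rightarrow> bool" where
  "killed Z \<longleftrightarrow> (\<forall>n. \<forall>p \<in> pts. \<forall>g. chain_map A (cx p) (shift A n Z) g \<longrightarrow>
     (\<exists>p' \<in> pts. \<exists>r h. refines p' p r \<and> nullhtp (cx p') (shift A n Z) (\<lambda>i. Comp A (g i) (r i)) h))"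

lemma killedE:
  assumes "killed Z" "p \<in> pts" "chain_map A (cx p) (shift A n Z) g"
  obtains p' r h where "p' \<in> pts" "refines p' p r"
    "nullhtp (cx p') (shift A n Z) (\<lambda>i. Comp A (g i) (r i)) h"
  using assms unfolding killed_def by blast

lemma killed_shift:
  assumes "killed X" "is_complex A X" shows "killed (shift A n X)"
  using assms unfolding killed_def by (simp add: shift_shift)

text \<open>The identity refinement suffices: \<open>g\<close> factors through the identity of a
  shift of \<open>Z\<close>, which is null-homotopic.\<close>

lemma killed_contractible:
  assumes Z: "is_complex A Z" and h: "nullhtp Z Z (\<lambda>i. Ident A (COb Z i)) h"
  shows "killed Z"
  unfolding killed_def
proof (intro allI ballI impI)
  fix n p g assume p: "p \<in> pts" and g: "chain_map A (cx p) (shift A n Z) g"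
  note r = refines_refl[OF p]
  from nullhtp_Comp_right[OF _ _ _ nullhtp_shift[OF Z Z h, of n] g]
  have "\<exists>h. nullhtp (cx p) (shift A n Z) (\<lambda>i. Comp A (g i) (Ident A (COb (cx p) i))) h"
    using cx_complex[OF p] Z chain_mapD[OF g] by auto
  with p r show "\<exists>p' \<in> pts. \<exists>r h. refines p' p r \<and> nullhtp (cx p') (shift A n Z) (\<lambda>i. Comp A (g i) (r i)) h"
    by blast
qed

lemma killed_zero: "zero_object (Kb A) Z \<Longrightarrow> killed Z"
  using Kb_zero_object_nullhtp killed_contractible by (metis Kb_Ob_iff bounded_is_complex zero_object_def)

text \<open>Let \<open>u\<close> and \<open>v\<close> be mutually inverse up to homotopy and split
  \<open>g\<close> as \<open>u v g + (1 - u v) g\<close>. The first summand vanishes after a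
  refinement since \<open>v g\<close> does; the second is null-homotopic because
  \<open>1 - u v\<close> is.\<close>

lemma killed_iso:
  assumes Z: "killed Z" "bounded_complex A Z" and Z': "bounded_complex A Z'" and i: "isomorphic (Kb A) Z Z'"
  shows "killed Z'"
  unfolding killed_def
proof (intro allI ballI impI)
  fix n p g assume p: "p \<in> pts" and g: "chain_map A (cx p) (shift A n Z') g"
  interpret K: category "Kb A" by (rule Kb_category)
  have C: "is_complex A Z" "is_complex A Z'" "is_complex A (cx p)" using Z Z' cx_complex[OF p] by simp_all
  obtain a b where ab: "a \<in> Hom (Kb A) Z Z'" "b \<in> Hom (Kb A) Z' Z" "Comp (Kb A) a b = Ident (Kb A) Z'"
    using i K.is_isoE unfolding isomorphic_def by metis
  then obtain u v where u: "chain_map A Z Z' u" "a = ho_class A Z Z' u" and v: "chain_map A Z' Z v" "b = ho_class A Z' Z v"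
    by (auto simp: Kb_Hom_iff)
  have uv: "chain_map A Z' Z' (\<lambda>i. Comp A (u i) (v i))" using chain_map_Comp[OF C(2,1,2) v(1) u(1)] .
  have I: "chain_map A Z' Z' (\<lambda>i. Ident A (COb Z' i))" using chain_map_Ident[OF C(2)] .
  have "homotopic A Z' Z' (\<lambda>i. Ident A (COb Z' i)) (\<lambda>i. Comp A (u i) (v i))"
    using ab(3) ho_class_eq_iff[OF C(2,2) I uv] Kb_Comp[OF C(2,1,2) v(1) u(1)]
    unfolding u(2) v(2) Kb_Ident by simp
  then obtain k where k: "nullhtp Z' Z' (\<lambda>i. Add A (Ident A (COb Z' i)) (neg A (Comp A (u i) (v i)))) k"
    using homotopicE_nullhtp[OF C(2,2) I uv] by blast
  let ?vg = "\<lambda>i. Comp A (v (i + n)) (g i)"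
  have vg: "chain_map A (cx p) (shift A n Z) ?vg"
    using chain_map_Comp[OF _ _ _ g chain_map_shift[OF C(2,1) v(1), of n]] C by simp
  obtain p' r h where p': "p' \<in> pts" and r: "refines p' p r"
    and h: "nullhtp (cx p') (shift A n Z) (\<lambda>i. Comp A (?vg i) (r i)) h"
    using killedE[OF Z(1) p vg] .
  note C = C cx_complex[OF p']
  note rc = refines_chain_map[OF p p' r]
  note gr = chain_map_Comp[OF C(4,3) _ rc g]
  have "nullhtp (cx p') (shift A n Z')
    (\<lambda>i. Add A (Comp A (u (i + n)) (Comp A (?vg i) (r i)))
        (Comp A (Add A (Ident A (COb Z' (i + n))) (neg A (Comp A (u (i + n)) (v (i + n))))) (Comp A (g i) (r i))))
    (\<lambda>i. Add A (Comp A (u (i - 1 + n)) (h i))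
      (Comp A (if even n then k (i + n) else neg A (k (i + n))) (Comp A (g i) (r i))))"
    using C nullhtp_Add[OF _ _ nullhtp_Comp_left[OF _ _ _ h chain_map_shift[OF C(1,2) u(1), of n]]
      nullhtp_Comp_right[OF _ _ _ nullhtp_shift[OF C(2,2) k, of n] gr]] by simp
  moreover have "Add A (Comp A (u (i + n)) (Comp A (?vg i) (r i)))
        (Comp A (Add A (Ident A (COb Z' (i + n))) (neg A (Comp A (u (i + n)) (v (i + n))))) (Comp A (g i) (r i)))
     = Comp A (g i) (r i)" for i
    using C by (simp add: chain_mapD(1-3)[OF u(1)] chain_mapD(1-3)[OF v(1)] chain_mapD(1-3)[OF g]
      chain_mapD(1-3)[OF rc] Add_ac)
  ultimately show "\<exists>p' \<in> pts. \<exists>r h. refines p' p r \<and> nullhtp (cx p') (shift A n Z') (\<lambda>i. Comp A (g i) (r i)) h"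
    using p' r by auto
qed

text \<open>Two successive refinements: the first kills the component of \<open>g\<close> in
  \<open>X\<close>, with homotopy \<open>h1\<close>; the second kills the component in
  \<open>Y\<close>, which becomes a chain map after a correction by \<open>f h1\<close>.\<close>

lemma killed_cone:
  assumes X: "killed X" "is_complex A X" and Y: "killed Y" "is_complex A Y" and f: "chain_map A X Y f"
  shows "killed (cone A X Y f)"
  unfolding killed_def
proof (intro allI ballI impI)
  fix n p g assume p: "p \<in> pts" and g: "chain_map A (cx p) (shift A n (cone A X Y f)) g"
  note C [simp] = X(2) Y(2) cx_complex[OF p] cone_complex[OF X(2) Y(2) f]
  note F [simp] = chain_mapD(1-3)[OF f] chain_mapD'[OF f X(2) Y(2)] cone_Diff[OF X(2) Y(2) f] cone_Diff'[OF X(2) Y(2) f]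
  have G: "g i \<in> Arr A" "Dom A (g i) = COb (cx p) i"
    "Cod A (g i) = DSum A (COb X (i + n + 1)) (COb Y (i + n))" for i
    using chain_mapD(1-3)[OF g, of i] by simp_all
  have dg: "Comp A (g (i + 1)) (Diff (cx p) i) = Comp A (Diff (shift A n (cone A X Y f)) i) (g i)" for i
    using chain_mapD(4)[OF g, of i] by simp
  note [simp] = G shift_index[of _ n]
  let ?p1 = "\<lambda>i. Pr1 A (COb X (i + n + 1)) (COb Y (i + n))"
  let ?p2 = "\<lambda>i. Pr2 A (COb X (i + n + 1)) (COb Y (i + n))"
  let ?g1 = "\<lambda>i. Comp A (?p1 i) (g i)"
  have g1: "chain_map A (cx p) (shift A (n + 1) X) ?g1"
    by (rule chain_mapI) (simp_all add: dg add.assoc[symmetric])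
  obtain q r1 h1 where q: "q \<in> pts" and r1: "refines q p r1"
    and h1: "nullhtp (cx q) (shift A (n + 1) X) (\<lambda>i. Comp A (?g1 i) (r1 i)) h1"
    using killedE[OF X(1) p g1] .
  note R1 = refines_chain_map[OF p q r1]
  note [simp] = cx_complex[OF q] chain_mapD(1-3)[OF R1]
  have H1 [simp]: "h1 i \<in> Arr A" "Dom A (h1 i) = COb (cx q) i" "Cod A (h1 i) = COb X (i + n)" for i
    using nullhtpD(1-3)[OF h1, of i] by simp_all
  let ?e = "\<lambda>x. if even n then x else neg A x"
  \<comment> \<open>The sign is opposite to that of \<open>?e\<close> because \<open>h1\<close> is a
    homotopy into the shift of \<open>X\<close> by \<open>n + 1\<close>, whose parity differs from
    that of \<open>n\<close>.\<close>
  have e1: "Comp A (?p1 i) (Comp A (g i) (r1 i)) = Add A (neg A (?e (Comp A (Diff X (i + n)) (h1 i)))) (Comp A (h1 (i + 1)) (Diff (cx q) i))" for i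
    using nullhtpD(4)[OF h1, of i] by (simp split: if_splits)
  have e2: "Comp A (Pr2 A (COb X (i + n + 2)) (COb Y (i + n + 1))) (Comp A (g (i + 1)) (Comp A (r1 (i + 1)) (Diff (cx q) i)))
     = ?e (Add A (Comp A (f (i + n + 1)) (Comp A (?p1 i) (Comp A (g i) (r1 i))))
       (Comp A (Diff Y (i + n)) (Comp A (?p2 i) (Comp A (g i) (r1 i)))))" for i
  proof -
    have "Comp A (?p2 (i + 1)) (Comp A (g (i + 1)) (Comp A (r1 (i + 1)) (Diff (cx q) i)))
       = Comp A (?p2 (i + 1)) (Comp A (Comp A (g (i + 1)) (Diff (cx p) i)) (r1 i))"
      by (simp add: chain_mapD(4)[OF R1, symmetric])
    then show ?thesis by (simp add: dg)
  qed
  \<comment> \<open>The projection of the cone to \<open>Y\<close> is no chain map, because the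
    differential has the entry \<open>f\<close>. The subtracted term compensates for this
    entry.\<close>
  let ?g2 = "\<lambda>i. Add A (Comp A (?p2 i) (Comp A (g i) (r1 i))) (neg A (?e (Comp A (f (i + n)) (h1 i))))"
  have g2: "chain_map A (cx q) (shift A n Y) ?g2"
    by (rule chain_mapI) (simp_all add: e1 e2 Add_ac)
  obtain q' r2 h2 where q': "q' \<in> pts" and r2: "refines q' q r2"
    and h2: "nullhtp (cx q') (shift A n Y) (\<lambda>i. Comp A (?g2 i) (r2 i)) h2"
    using killedE[OF Y(1) q g2] .
  note R2 = refines_chain_map[OF q q' r2]
  note [simp] = cx_complex[OF q'] chain_mapD(1-3)[OF R2]
  have H2 [simp]: "h2 i \<in> Arr A" "Dom A (h2 i) = COb (cx q') i" "Cod A (h2 i) = COb Y (i + n - 1)" for i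
    using nullhtpD(1-3)[OF h2, of i] by simp_all
  have e3: "Comp A (?p1 i) (Comp A (g i) (Comp A (r1 i) (r2 i)))
      = Add A (neg A (?e (Comp A (Diff X (i + n)) (Comp A (h1 i) (r2 i))))) (Comp A (h1 (i + 1)) (Comp A (r2 (i + 1)) (Diff (cx q') i)))" for i
  proof -
    have "Comp A (?p1 i) (Comp A (g i) (Comp A (r1 i) (r2 i))) = Comp A (Comp A (?p1 i) (Comp A (g i) (r1 i))) (r2 i)"
      by simp
    also have "\<dots> = Add A (neg A (?e (Comp A (Diff X (i + n)) (Comp A (h1 i) (r2 i))))) (Comp A (h1 (i + 1)) (Comp A (r2 (i + 1)) (Diff (cx q') i)))"
      unfolding e1 by (simp add: chain_mapD(4)[OF R2])
    finally show ?thesis .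
  qed
  have e4: "Comp A (?p2 i) (Comp A (g i) (Comp A (r1 i) (r2 i)))
      = Add A (?e (Comp A (f (i + n)) (Comp A (h1 i) (r2 i))))
          (Add A (?e (Comp A (Diff Y (i + n - 1)) (h2 i))) (Comp A (h2 (i + 1)) (Diff (cx q') i)))" for i
  proof -
    have "Comp A (?p2 i) (Comp A (g i) (Comp A (r1 i) (r2 i)))
        = Add A (?e (Comp A (f (i + n)) (Comp A (h1 i) (r2 i)))) (Comp A (?g2 i) (r2 i))"
      by (simp add: Add_ac)
    also have "Comp A (?g2 i) (r2 i) = Add A (?e (Comp A (Diff Y (i + n - 1)) (h2 i))) (Comp A (h2 (i + 1)) (Diff (cx q') i))"
      using nullhtpD(4)[OF h2, of i] by (simp split: if_splits)
    finally show ?thesis .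
  qed
  \<comment> \<open>The homotopy with components \<open>h1 r2\<close> and \<open>h2\<close>; the
    equations \<open>e3\<close> and \<open>e4\<close> are the two components of the required
    identity.\<close>
  let ?k = "\<lambda>i. Add A (Comp A (In1 A (COb X (i + n)) (COb Y (i + n - 1))) (Comp A (h1 i) (r2 i)))
    (Comp A (In2 A (COb X (i + n)) (COb Y (i + n - 1))) (h2 i))"
  have "nullhtp (cx q') (shift A n (cone A X Y f)) (\<lambda>i. Comp A (g i) (Comp A (r1 i) (r2 i))) ?k"
  proof (rule nullhtpI)
    fix i
    show "Comp A (g i) (Comp A (r1 i) (r2 i)) = Add A (Comp A (Diff (shift A n (cone A X Y f)) (i - 1)) (?k i))
        (Comp A (?k (i + 1)) (Diff (cx q') i))"
      by (rule DSum_eqI[of "COb X (i + n + 1)" "COb Y (i + n)"]) (simp_all add: e3 e4 Add_ac)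
  qed simp_all
  then show "\<exists>p' \<in> pts. \<exists>r h. refines p' p r \<and> nullhtp (cx p') (shift A n (cone A X Y f)) (\<lambda>i. Comp A (g i) (r i)) h"
    using q' refines_trans[OF p q q' r1 r2] by blast
qed

text \<open>Reduces a statement about all of \<open>cone_subcat\<close> to the cones of the elements
  of \<open>S\<close>, since \<open>cone_subcat\<close> is the smallest class of this kind that
  contains them.\<close>

theorem killed_strict_triangulated: "strict_triangulated A {Z. bounded_complex A Z \<and> killed Z}"
  unfolding strict_triangulated_def
  using killed_zero killed_iso killed_shift killed_cone shift_bounded cone_bounded
  by (auto simp: Kb_Ob_iff zero_object_def)

end

section \<open>Contractible complexes and contractible cones\<close>

context additive_category
begin

definition contractible :: "('o, 'm) cplx \<Rightarrow> bool" where
  "contractible X \<longleftrightarrow> (\<exists>h. nullhtp X X (\<lambda>i. Ident A (COb X i)) h)"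

text \<open>Take all bounded complexes as points and only identities as refinements. A killed
  complex is then contractible, as one sees by testing its own identity in shift
  \<open>0\<close>.\<close>

lemma contractible_strict_triangulated: "strict_triangulated A {Z. bounded_complex A Z \<and> contractible Z}"
proof -
  interpret R: refinement A "{Z. bounded_complex A Z}" id "\<lambda>Y X r. Y = X \<and> r = (\<lambda>i. Ident A (COb X i))"
    by unfold_locales (auto intro: chain_map_Ident)
  have "contractible Z" if Z: "bounded_complex A Z" "R.killed Z" for Z
  proof -
    have "shift A 0 Z = Z" by (simp add: shift_def)
    moreover have "chain_map A Z Z (\<lambda>i. Ident A (COb Z i))" using Z chain_map_Ident by simp
    ultimately obtain h where "nullhtp Z Z (\<lambda>i. Comp A (Ident A (COb Z i)) (Ident A (COb Z i))) h"
      using R.killedE[OF Z(2), of Z 0 "\<lambda>i. Ident A (COb Z i)"] Z by auto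
    then show ?thesis using Z unfolding contractible_def by auto
  qed
  then have "R.killed Z \<longleftrightarrow> contractible Z" if "bounded_complex A Z" for Z
    using that R.killed_contractible unfolding contractible_def by auto
  then have "{Z. bounded_complex A Z \<and> R.killed Z} = {Z. bounded_complex A Z \<and> contractible Z}" by blast
  then show ?thesis using R.killed_strict_triangulated by simp
qed

lemma cone_Diff_In:
  assumes X: "is_complex A X" and Y: "is_complex A Y" and f: "chain_map A X Y f" and j: "j = i + 1"
  shows "Comp A (Diff (cone A X Y f) i) (In1 A (COb X j) (COb Y i))
      = Add A (neg A (Comp A (In1 A (COb X (i + 2)) (COb Y (i + 1))) (Diff X (i + 1))))
          (Comp A (In2 A (COb X (i + 2)) (COb Y (i + 1))) (f (i + 1)))"
    "Comp A (Diff (cone A X Y f) i) (In2 A (COb X j) (COb Y i))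
      = Comp A (In2 A (COb X (i + 2)) (COb Y (i + 1))) (Diff Y i)"
  by (simp_all add: cone_def X Y chain_mapD(1-3)[OF f] j)

text \<open>The components of a contraction of the cone of \<open>f\<close> are a homotopy inverse of \<open>f\<close> and the two
  homotopies that witness this.\<close>

lemma cone_contractible_iso:
  assumes X: "bounded_complex A X" and Y: "bounded_complex A Y" and f: "chain_map A X Y f"
    and "contractible (cone A X Y f)"
  shows "is_iso (Kb A) (ho_class A X Y f)"
proof -
  obtain h where h: "nullhtp (cone A X Y f) (cone A X Y f) (\<lambda>i. Ident A (COb (cone A X Y f) i)) h"
    using assms(4) unfolding contractible_def by blast
  have XY: "is_complex A X" "is_complex A Y" using X Y by simp_all
  note [simp] = XY chain_mapD(1-3)[OF f] cone_Diff[OF XY f] cone_Diff'[OF XY f] cone_Diff_In[OF XY f]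
  have H [simp]: "h i \<in> Arr A" "Dom A (h i) = DSum A (COb X (i + 1)) (COb Y i)"
    "Cod A (h i) = DSum A (COb X i) (COb Y (i - 1))" for i
    using nullhtpD(1-3)[OF h, of i] by simp_all
  have hD: "Comp A (h (i + 1)) (Diff (cone A X Y f) i) = Add A (Ident A (DSum A (COb X (i + 1)) (COb Y i)))
    (neg A (Comp A (Diff (cone A X Y f) (i - 1)) (h i)))" for i
    using nullhtpD(4)[OF h, of i] by (simp add: Add_ac)
  let ?b = "\<lambda>i. Comp A (Pr1 A (COb X i) (COb Y (i - 1))) (Comp A (h i) (In2 A (COb X (i + 1)) (COb Y i)))"
  let ?e = "\<lambda>i. Comp A (Pr2 A (COb X i) (COb Y (i - 1))) (Comp A (h i) (In2 A (COb X (i + 1)) (COb Y i)))"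
  \<comment> \<open>The cone contains \<open>X\<close> in degree \<open>i\<close> as a summand of
    its term in degree \<open>i - 1\<close>, and the differential of \<open>X\<close> enters with a
    minus sign; this explains the index and the sign.\<close>
  let ?a = "\<lambda>i. neg A (Comp A (Pr1 A (COb X (i - 1)) (COb Y (i - 2))) (Comp A (h (i - 1)) (In1 A (COb X i) (COb Y (i - 1)))))"
  \<comment> \<open>On the summand \<open>Y\<close> the contraction equation says that
    \<open>?b\<close> is a chain map and \<open>?e\<close> a homotopy; on the summand
    \<open>X\<close>, in \<open>hIn1\<close>, it gives the homotopy \<open>?a\<close>.\<close>
  have hIn2: "Comp A (h (i + 1)) (Comp A (In2 A (COb X (i + 2)) (COb Y (i + 1))) (Diff Y i))
    = Add A (In2 A (COb X (i + 1)) (COb Y i))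
      (neg A (Comp A (Diff (cone A X Y f) (i - 1)) (Comp A (h i) (In2 A (COb X (i + 1)) (COb Y i)))))" for i
    using arg_cong[OF hD[of i], of "\<lambda>x. Comp A x (In2 A (COb X (i + 1)) (COb Y i))"] by simp
  have hIn1: "Comp A (h i) (Comp A (In2 A (COb X (i + 1)) (COb Y i)) (f i))
    = Add A (Comp A (h i) (Comp A (In1 A (COb X (i + 1)) (COb Y i)) (Diff X i))) (Add A (In1 A (COb X i) (COb Y (i - 1)))
      (neg A (Comp A (Diff (cone A X Y f) (i - 2)) (Comp A (h (i - 1)) (In1 A (COb X i) (COb Y (i - 1)))))))" for i
  proof -
    let ?u = "Comp A (h i) (Comp A (In1 A (COb X (i + 1)) (COb Y i)) (Diff X i))"
    let ?v = "Comp A (h i) (Comp A (In2 A (COb X (i + 1)) (COb Y i)) (f i))"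
    have "?v = Add A ?u (Add A (neg A ?u) ?v)" by simp
    also have "Add A (neg A ?u) ?v = Add A (In1 A (COb X i) (COb Y (i - 1)))
      (neg A (Comp A (Diff (cone A X Y f) (i - 2)) (Comp A (h (i - 1)) (In1 A (COb X i) (COb Y (i - 1))))))"
      using arg_cong[OF hD[of "i - 1"], of "\<lambda>x. Comp A x (In1 A (COb X i) (COb Y (i - 1)))"] by simp
    finally show ?thesis .
  qed
  have b: "chain_map A Y X ?b"
    by (rule chain_mapI) (simp_all add: hIn2)
  have e: "nullhtp Y Y (\<lambda>i. Add A (Ident A (COb Y i)) (neg A (Comp A (f i) (?b i)))) ?e"
    by (rule nullhtpI) (simp_all add: hIn2 Add_ac)
  have a: "nullhtp X X (\<lambda>i. Add A (Ident A (COb X i)) (neg A (Comp A (?b i) (f i)))) ?a"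
    by (rule nullhtpI) (simp_all add: hIn1 Add_ac)
  have fb: "chain_map A Y Y (\<lambda>i. Comp A (f i) (?b i))" using chain_map_Comp[OF XY(2,1,2) b f] .
  have bf: "chain_map A X X (\<lambda>i. Comp A (?b i) (f i))" using chain_map_Comp[OF XY(1,2,1) f b] .
  note I = chain_map_Ident[OF XY(1)] chain_map_Ident[OF XY(2)]
  have "ho_class A Y Y (\<lambda>i. Ident A (COb Y i)) = ho_class A Y Y (\<lambda>i. Comp A (f i) (?b i))"
    unfolding ho_class_eq_iff[OF XY(2,2) I(2) fb] by (rule homotopicI_nullhtp[OF XY(2,2) I(2) fb e])
  moreover have "ho_class A X X (\<lambda>i. Ident A (COb X i)) = ho_class A X X (\<lambda>i. Comp A (?b i) (f i))"
    unfolding ho_class_eq_iff[OF XY(1,1) I(1) bf] by (rule homotopicI_nullhtp[OF XY(1,1) I(1) bf a])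
  ultimately show ?thesis
    using X Y f b Kb_Comp[OF XY(1,2,1) f b] Kb_Comp[OF XY(2,1,2) b f]
    by (intro category.is_isoI[OF Kb_category, of _ X Y "ho_class A Y X ?b"]) (auto simp: Kb_Hom_iff Kb_Ident)
qed

section \<open>Cones of isomorphisms between complexes concentrated in degree
  \<open>0\<close>\<close>

lemma stalk_simps [simp]:
  "COb (stalk A X) i = (if i = 0 then X else ZeroOb A)"
  "Diff (stalk A X) i = ZeroArr A (COb (stalk A X) i) (COb (stalk A X) (i + 1))"
  by (simp_all add: stalk_def)

lemma stalk_map_simps [simp]:
  "stalk_map A f 0 = f" "i \<noteq> 0 \<Longrightarrow> stalk_map A f i = ZeroArr A (ZeroOb A) (ZeroOb A)"
  by (simp_all add: stalk_map_def)

lemma stalk_complex [simp]: "X \<in> Ob A \<Longrightarrow> is_complex A (stalk A X)"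
  using stalk_bounded by simp

text \<open>The inverse \<open>t\<close> of \<open>s\<close>, as an arrow from degree
  \<open>0\<close> to degree \<open>-1\<close>, is a contraction. All terms of the cone in other
  degrees are zero objects.\<close>

lemma iso_cone_contractible:
  assumes s: "s \<in> Hom A X Y" and "is_iso A s"
  shows "contractible (cone A (stalk A X) (stalk A Y) (stalk_map A s))"
proof -
  obtain t where t: "t \<in> Hom A Y X" "Comp A t s = Ident A X" "Comp A s t = Ident A Y"
    using is_isoE assms by blast
  have [simp]: "X \<in> Ob A" "Y \<in> Ob A" using Hom_Ob[OF s] by simp_all
  have [simp]: "s \<in> Arr A" "Dom A s = X" "Cod A s = Y" "t \<in> Arr A" "Dom A t = Y" "Cod A t = X"
    using s t(1) by (auto simp: Hom_def)
  let ?C = "cone A (stalk A X) (stalk A Y) (stalk_map A s)"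
  have XY: "is_complex A (stalk A X)" "is_complex A (stalk A Y)" by simp_all
  note f = stalk_chain_map[OF s]
  note [simp] = cone_Diff(1-3)[OF XY f] cone_complex[OF XY f]
  have D: "Comp A (Pr2 A (ZeroOb A) Y) (Diff ?C (-1)) = Comp A s (Pr1 A X (ZeroOb A))"
    using cone_Diff(5)[OF XY f, where i = "-1" and j = 1 and k = 0] by simp
  have D': "Comp A (Pr2 A (ZeroOb A) Y) (Comp A (Diff ?C (-1)) g) = Comp A s (Comp A (Pr1 A X (ZeroOb A)) g)"
    if "g \<in> Arr A" "Cod A g = DSum A X (ZeroOb A)" for g
    using that arg_cong[OF D, of "\<lambda>x. Comp A x g"] by simp
  have ts: "Comp A t (Comp A s g) = g" if "g \<in> Arr A" "Cod A g = X" for g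
    using that arg_cong[OF t(2), of "\<lambda>x. Comp A x g"] by simp
  have st: "Comp A s (Comp A t g) = g" if "g \<in> Arr A" "Cod A g = Y" for g
    using that arg_cong[OF t(3), of "\<lambda>x. Comp A x g"] by simp
  let ?h = "\<lambda>i :: int. if i = 0 then Comp A (In1 A X (ZeroOb A)) (Comp A t (Pr2 A (ZeroOb A) Y))
    else ZeroArr A (COb ?C i) (COb ?C (i - 1))"
  have H: "?h i \<in> Hom A (COb ?C i) (COb ?C (i - 1))" for i by (auto simp: Hom_def)
  have "Ident A (COb ?C i) = Add A (Comp A (Diff ?C (i - 1)) (?h i)) (Comp A (?h (i + 1)) (Diff ?C i))" (is "_ = ?r") for i
  proof -
    have C: "is_complex A ?C" by simp
    have r: "?r \<in> Hom A (COb ?C i) (COb ?C i)"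
      using homotopy_terms[OF C C H] by (intro Add_Hom) 
    consider "i = 0" | "i = -1" | "i \<noteq> 0" "i \<noteq> -1" by blast
    then show ?thesis
    proof cases
      case 1
      show ?thesis
      proof (rule DSum_eqI[of "ZeroOb A" Y])
        show "Comp A (Pr1 A (ZeroOb A) Y) (Ident A (COb ?C i)) = Comp A (Pr1 A (ZeroOb A) Y) ?r"
          by (rule zero_object_to_eq[OF zero_object_ZeroOb, where X = "COb ?C i"])
            (use r 1 in \<open>simp_all add: Hom_def\<close>)
        show "Comp A (Pr2 A (ZeroOb A) Y) (Ident A (COb ?C i)) = Comp A (Pr2 A (ZeroOb A) Y) ?r"
          using 1 by (simp add: D' st)
      qed (use r 1 in \<open>simp_all add: Hom_def\<close>)
    next
      case 2
      show ?thesis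
      proof (rule DSum_eqI[of X "ZeroOb A"])
        show "Comp A (Pr2 A X (ZeroOb A)) (Ident A (COb ?C i)) = Comp A (Pr2 A X (ZeroOb A)) ?r"
          by (rule zero_object_to_eq[OF zero_object_ZeroOb, where X = "COb ?C i"])
            (use r 2 in \<open>simp_all add: Hom_def\<close>)
        show "Comp A (Pr1 A X (ZeroOb A)) (Ident A (COb ?C i)) = Comp A (Pr1 A X (ZeroOb A)) ?r"
          using 2 by (simp add: D ts)
      qed (use r 2 in \<open>simp_all add: Hom_def\<close>)
    next
      case 3
      then have "i + 1 \<noteq> 0" by simp
      with 3 have "zero_object A (COb ?C i)" using zero_object_DSum[OF zero_object_ZeroOb zero_object_ZeroOb] by simp
      then show ?thesis using zero_object_to_eq r Ident_Hom[of "COb ?C i"] unfolding zero_object_def by blast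
    qed
  qed
  then have "nullhtp ?C ?C (\<lambda>i. Ident A (COb ?C i)) ?h" using H unfolding nullhtp_def by blast
  then show ?thesis unfolding contractible_def by blast
qed

text \<open>In terms of elements, the homotopy equivalence between \<open>C\<close> and the cone of \<open>r\<close> is given by
  \<open>c \<mapsto> (0, c, 0)\<close> and \<open>(z', c, z) \<mapsto> c - g z\<close>, with homotopy \<open>(z', c, z) \<mapsto> (z, 0, 0)\<close>.\<close>

lemma cocone_isomorphic:
  assumes Z: "bounded_complex A Z" and C: "bounded_complex A C" and g: "chain_map A Z C g"
  defines "Z' \<equiv> shift A (-1) (cone A Z C g)"
  defines "r \<equiv> \<lambda>i. Pr1 A (COb Z i) (COb C (i - 1))"
  shows "chain_map A Z' Z r" "\<exists>h. nullhtp Z' C (\<lambda>i. Comp A (g i) (r i)) h"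
    "isomorphic (Kb A) C (cone A Z' Z r)"
proof -
  have ZC [simp]: "is_complex A Z" "is_complex A C" using Z C by simp_all
  note G [simp] = chain_mapD(1-3)[OF g] cone_Diff[OF ZC g] cone_Diff'[OF ZC g] chain_mapD[OF g] chain_mapD'[OF g ZC]
  have Z': "is_complex A Z'" unfolding Z'_def using cone_complex[OF ZC g] by simp
  have Z'b: "bounded_complex A Z'" unfolding Z'_def by (rule shift_bounded[OF cone_bounded[OF Z C g]])
  have ZO [simp]: "COb Z' i = DSum A (COb Z i) (COb C (i - 1))" for i by (simp add: Z'_def)
  have ZD: "Diff Z' i = neg A (Diff (cone A Z C g) (i - 1))" for i by (simp add: Z'_def)
  show r: "chain_map A Z' Z r"
    by (rule chain_mapI) (simp_all add: r_def ZD)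
  \<comment> \<open>The minus sign in front of the projection to \<open>C\<close> undoes the one
    that the shift by \<open>-1\<close> puts on the differential of the cone.\<close>
  have "nullhtp Z' C (\<lambda>i. Comp A (g i) (r i)) (\<lambda>i. neg A (Pr2 A (COb Z i) (COb C (i - 1))))"
    by (rule nullhtpI) (simp_all add: r_def ZD Add_ac)
  then show "\<exists>h. nullhtp Z' C (\<lambda>i. Comp A (g i) (r i)) h" by blast
  have rI: "r i = Pr1 A (COb Z i) (COb C (i - 1))" for i by (simp add: r_def)
  let ?K = "cone A Z' Z r"
  note [simp] = chain_mapD(1-3)[OF r] cone_Diff(1-3)[OF Z' ZC(1) r]
  let ?q1 = "\<lambda>i. Pr1 A (DSum A (COb Z (i + 1)) (COb C i)) (COb Z i)"
    and ?q2 = "\<lambda>i. Pr2 A (DSum A (COb Z (i + 1)) (COb C i)) (COb Z i)"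
  have KD [simp]: "Comp A (Pr1 A (DSum A (COb Z j) (COb C k)) (COb Z k)) (Diff ?K i) = neg A (Comp A (Diff Z' k) (?q1 i))"
    "Comp A (Pr2 A (DSum A (COb Z j) (COb C k)) (COb Z k)) (Diff ?K i)
      = Add A (Comp A (r k) (?q1 i)) (Comp A (Diff Z i) (?q2 i))"
    if "j = i + 2" "k = i + 1" for i j k
    using cone_Diff(4,5)[OF Z' ZC(1) r, of j i k] that by simp_all
  have KD' [simp]: "Comp A (Pr1 A (DSum A (COb Z j) (COb C k)) (COb Z k)) (Comp A (Diff ?K i) f) = neg A (Comp A (Diff Z' k) (Comp A (?q1 i) f))"
    "Comp A (Pr2 A (DSum A (COb Z j) (COb C k)) (COb Z k)) (Comp A (Diff ?K i) f)
      = Add A (Comp A (r k) (Comp A (?q1 i) f)) (Comp A (Diff Z i) (Comp A (?q2 i) f))"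
    if "j = i + 2" "k = i + 1" "f \<in> Arr A" "Cod A f = DSum A (DSum A (COb Z (i + 1)) (COb C i)) (COb Z i)" for i j k f
    using cone_Diff'[OF Z' ZC(1) r, of f i j k] that by simp_all
  have K: "is_complex A ?K" "bounded_complex A ?K"
    using cone_complex[OF Z' ZC(1) r] cone_bounded[OF Z'b Z r] by simp_all
  let ?u = "\<lambda>i. Comp A (In1 A (DSum A (COb Z (i + 1)) (COb C i)) (COb Z i)) (In2 A (COb Z (i + 1)) (COb C i))"
  let ?v = "\<lambda>i. Add A (Comp A (Pr2 A (COb Z (i + 1)) (COb C i)) (Pr1 A (DSum A (COb Z (i + 1)) (COb C i)) (COb Z i)))
     (neg A (Comp A (g i) (Pr2 A (DSum A (COb Z (i + 1)) (COb C i)) (COb Z i))))"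
  have u: "chain_map A C ?K ?u"
  proof (rule chain_mapI)
    fix i
    have "Comp A (Diff Z' (i + 1)) (In2 A (COb Z (i + 1)) (COb C i))
        = neg A (Comp A (In2 A (COb Z (i + 2)) (COb C (i + 1))) (Diff C i))"
      by (rule DSum_eqI[of "COb Z (i + 2)" "COb C (i + 1)"]) (simp_all add: ZD)
    then show "Comp A (Diff ?K i) (?u i) = Comp A (?u (i + 1)) (Diff C i)"
      by - (rule DSum_eqI[of "DSum A (COb Z (i + 2)) (COb C (i + 1))" "COb Z (i + 1)"], simp_all add: rI)
  qed simp_all
  have v: "chain_map A ?K C ?v"
    by (rule chain_mapI) (simp_all add: ZD Add_ac rI)
  have vu: "chain_map A C C (\<lambda>i. Comp A (?v i) (?u i))" and uv: "chain_map A ?K ?K (\<lambda>i. Comp A (?u i) (?v i))"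
    using chain_map_Comp[OF ZC(2) K(1) ZC(2) u v] chain_map_Comp[OF K(1) ZC(2) K(1) v u] .
  have "(\<lambda>i. Comp A (?v i) (?u i)) = (\<lambda>i. Ident A (COb C i))" by simp
  moreover have "nullhtp ?K ?K (\<lambda>i. Add A (Ident A (COb ?K i)) (neg A (Comp A (?u i) (?v i))))
     (\<lambda>i. Comp A (In1 A (DSum A (COb Z i) (COb C (i - 1))) (COb Z (i - 1)))
       (Comp A (In1 A (COb Z i) (COb C (i - 1))) (Pr2 A (DSum A (COb Z (i + 1)) (COb C i)) (COb Z i))))"
  proof (rule nullhtpI)
    fix i
    let ?h = "\<lambda>i. Comp A (In1 A (DSum A (COb Z i) (COb C (i - 1))) (COb Z (i - 1)))
       (Comp A (In1 A (COb Z i) (COb C (i - 1))) (?q2 i))"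
    have 1: "Comp A (?q1 i) (Add A (Ident A (COb ?K i)) (neg A (Comp A (?u i) (?v i))))
      = Comp A (?q1 i) (Add A (Comp A (Diff ?K (i - 1)) (?h i)) (Comp A (?h (i + 1)) (Diff ?K i)))"
      by (rule DSum_eqI[of "COb Z (i + 1)" "COb C i"]) (simp_all add: ZD rI Add_ac)
    show "Add A (Ident A (COb ?K i)) (neg A (Comp A (?u i) (?v i)))
      = Add A (Comp A (Diff ?K (i - 1)) (?h i)) (Comp A (?h (i + 1)) (Diff ?K i))"
      by (rule DSum_eqI[OF _ _ _ _ _ _ 1]) (simp_all add: rI)
  qed simp_all
  then have "ho_class A ?K ?K (\<lambda>i. Ident A (COb ?K i)) = ho_class A ?K ?K (\<lambda>i. Comp A (?u i) (?v i))"
    unfolding ho_class_eq_iff[OF K(1,1) chain_map_Ident[OF K(1)] uv]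
    by (rule homotopicI_nullhtp[OF K(1,1) chain_map_Ident[OF K(1)] uv])
  ultimately have "is_iso (Kb A) (ho_class A C ?K ?u)"
    using u v C K Kb_Comp[OF ZC(2) K(1) ZC(2) u v] Kb_Comp[OF K(1) ZC(2) K(1) v u]
    by (intro category.is_isoI[OF Kb_category, of _ C ?K "ho_class A ?K C ?v"]) (auto simp: Kb_Hom_iff Kb_Ident)
  moreover have "ho_class A C ?K ?u \<in> Hom (Kb A) C ?K" using C K u by (auto simp: Kb_Hom_iff)
  ultimately show "isomorphic (Kb A) C ?K" unfolding isomorphic_def by blast
qed

section \<open>Chain maps and homotopies into complexes concentrated in degree
  \<open>0\<close>\<close>

lemma to_stalk_eqI:
  assumes f: "chain_map A Z (stalk A Y) f" and g: "chain_map A Z (stalk A Y) g" and "f 0 = g 0"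
  shows "f = g"
proof
  fix i
  have "f i = g i" if "i \<noteq> 0"
    using that chain_mapD[OF f, of i] chain_mapD[OF g, of i]
    by (intro zero_object_to_eq[OF zero_object_ZeroOb, of _ "COb Z i"]) (auto simp: Hom_def)
  then show "f i = g i" using assms(3) by blast
qed

text \<open>The one condition is that \<open>a\<close> annihilates the differential from degree
  \<open>-1\<close>, which starts at a zero object.\<close>

lemma to_stalk_chain_map:
  assumes Z: "is_complex A Z" and "zero_object A (COb Z (-1))" and a: "a \<in> Hom A (COb Z 0) Y"
  shows "chain_map A Z (stalk A Y) (\<lambda>i. if i = 0 then a else ZeroArr A (COb Z i) (ZeroOb A))"
proof -
  have [simp]: "a \<in> Arr A" "Dom A a = COb Z 0" "Cod A a = Y" using a by (auto simp: Hom_def)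
  have [simp]: "Y \<in> Ob A" using Hom_Ob[OF a] by simp
  have "Comp A a (Diff Z (-1)) = ZeroArr A (COb Z (-1)) Y"
    using assms(2) Z by (intro zero_object_from) (simp_all add: Hom_def)
  then show ?thesis using Z by (intro chain_mapI) (auto simp: minus_equation_iff[of _ 1] eq_neg_iff_add_eq_0[symmetric])
qed

text \<open>A homotopy lowers the degree by one, so its only component with target \<open>Y\<close>
  is the one in degree \<open>1\<close>, namely \<open>b\<close>.\<close>

lemma to_stalk_homotopic:
  assumes Z: "is_complex A Z" and Y: "Y \<in> Ob A"
    and f: "chain_map A Z (stalk A Y) f" and g: "chain_map A Z (stalk A Y) g"
    and b: "b \<in> Hom A (COb Z 1) Y" and e: "f 0 = Add A (g 0) (Comp A b (Diff Z 0))"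
  shows "homotopic A Z (stalk A Y) f g"
proof -
  have [simp]: "b \<in> Arr A" "Dom A b = COb Z 1" "Cod A b = Y" using b by (auto simp: Hom_def)
  note [simp] = Z Y chain_mapD(1-3)[OF f] chain_mapD(1-3)[OF g]
  let ?h = "\<lambda>i. if i = 1 then b else ZeroArr A (COb Z i) (COb (stalk A Y) (i - 1))"
  have H: "?h i \<in> Hom A (COb Z i) (COb (stalk A Y) (i - 1))" for i by (auto simp: Hom_def)
  have "f i = Add A (g i) (Add A (Comp A (Diff (stalk A Y) (i - 1)) (?h i)) (Comp A (?h (i + 1)) (Diff Z i)))" (is "_ = ?r") for i
  proof (cases "i = 0")
    case True
    then show ?thesis using e chain_mapD(1-3)[OF g, of 0] by simp
  next
    case False
    have "?r \<in> Hom A (COb Z i) (COb (stalk A Y) i)"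
      using homotopy_terms[OF Z stalk_complex[OF Y] H] g unfolding chain_map_def by (intro Add_Hom) blast+
    then show ?thesis
      using False chain_mapD(1-3)[OF f, of i] by (intro zero_object_to_eq[OF zero_object_ZeroOb, of _ "COb Z i"]) (auto simp: Hom_def)
  qed
  then show ?thesis unfolding homotopic_def using H by (intro exI[of _ ?h]) blast
qed

text \<open>Shows that this differential is \<open>s\<close> up to zero summands, so that it becomes
  invertible together with \<open>s\<close>.\<close>

lemma stalk_cone_Diff:
  assumes s: "s \<in> Hom A X Y"
  shows "Diff (cone A (stalk A X) (stalk A Y) (stalk_map A s)) (-1)
    = Comp A (In2 A (ZeroOb A) Y) (Comp A s (Pr1 A X (ZeroOb A)))" (is "?d = ?e")
proof -
  have [simp]: "X \<in> Ob A" "Y \<in> Ob A" using Hom_Ob[OF s] by simp_all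
  have [simp]: "s \<in> Arr A" "Dom A s = X" "Cod A s = Y" using s by (auto simp: Hom_def)
  have XY: "is_complex A (stalk A X)" "is_complex A (stalk A Y)" by simp_all
  note D = cone_Diff[OF XY stalk_chain_map[OF s], where i = "-1"]
  have d: "?d \<in> Arr A" "Dom A ?d = DSum A X (ZeroOb A)" "Cod A ?d = DSum A (ZeroOb A) Y"
    using D(1-3) by simp_all
  show ?thesis
  proof (rule DSum_eqI[of "ZeroOb A" Y])
    show "Comp A (Pr1 A (ZeroOb A) Y) ?d = Comp A (Pr1 A (ZeroOb A) Y) ?e"
      by (rule zero_object_to_eq[OF zero_object_ZeroOb, of _ "DSum A X (ZeroOb A)"]) (simp_all add: d Hom_def)
    show "Comp A (Pr2 A (ZeroOb A) Y) ?d = Comp A (Pr2 A (ZeroOb A) Y) ?e"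
      using D(5)[of 1 0] by simp
  qed (simp_all add: d)
qed

text \<open>The component of \<open>h\<close> in \<open>M'\<close> is the lift \<open>f'\<close> and
  the component in \<open>M\<close> is the homotopy from \<open>f\<close> to \<open>u f'\<close>.
  This is exactness of maps out of \<open>Z\<close> on the triangle of \<open>u\<close>.\<close>

lemma lift_along_null_cone:
  assumes M': "is_complex A M'" and M: "is_complex A M" and Z: "is_complex A Z"
    and u: "chain_map A M' M u" and f: "chain_map A Z M f"
    and h: "nullhtp Z (cone A M' M u) (\<lambda>i. Comp A (In2 A (COb M' (i + 1)) (COb M i)) (f i)) h"
  obtains f' where "chain_map A Z M' f'" "homotopic A Z M f (\<lambda>i. Comp A (u i) (f' i))"
proof -
  note [simp] = M' M Z chain_mapD(1-3)[OF u] chain_mapD(1-3)[OF f] cone_Diff[OF M' M u] cone_Diff'[OF M' M u]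
  have [simp]: "h i \<in> Arr A" "Dom A (h i) = COb Z i" "Cod A (h i) = DSum A (COb M' i) (COb M (i - 1))" for i
    using nullhtpD(1-3)[OF h, of i] by simp_all
  note e = nullhtpD(4)[OF h]
  let ?f' = "\<lambda>i. Comp A (Pr1 A (COb M' i) (COb M (i - 1))) (h i)"
  have 1: "ZeroArr A (COb Z i) (COb M' (i + 1))
    = Add A (neg A (Comp A (Diff M' i) (?f' i))) (Comp A (Pr1 A (COb M' (i + 1)) (COb M i)) (Comp A (h (i + 1)) (Diff Z i)))" for i
    using arg_cong[OF e[of i], of "Comp A (Pr1 A (COb M' (i + 1)) (COb M i))"] by simp
  have 2: "f i = Add A (Comp A (u i) (?f' i)) (Add A (Comp A (Diff M (i - 1)) (Comp A (Pr2 A (COb M' i) (COb M (i - 1))) (h i)))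
      (Comp A (Pr2 A (COb M' (i + 1)) (COb M i)) (Comp A (h (i + 1)) (Diff Z i))))" for i
    using arg_cong[OF e[of i], of "Comp A (Pr2 A (COb M' (i + 1)) (COb M i))"] by simp
  have f': "chain_map A Z M' ?f'"
  proof (rule chain_mapI)
    fix i
    have "Add A (Comp A (Diff M' i) (?f' i)) (ZeroArr A (COb Z i) (COb M' (i + 1)))
      = Comp A (Pr1 A (COb M' (i + 1)) (COb M i)) (Comp A (h (i + 1)) (Diff Z i))"
      unfolding 1 by simp
    then show "Comp A (Diff M' i) (?f' i) = Comp A (?f' (i + 1)) (Diff Z i)" by simp
  qed simp_all
  have "homotopic A Z M f (\<lambda>i. Comp A (u i) (?f' i))"
    unfolding homotopic_def
  proof (intro exI[of _ "\<lambda>i. Comp A (Pr2 A (COb M' i) (COb M (i - 1))) (h i)"] allI conjI)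
    fix i
    show "f i = Add A (Comp A (u i) (?f' i)) (Add A (Comp A (Diff M (i - 1)) (Comp A (Pr2 A (COb M' i) (COb M (i - 1))) (h i)))
      (Comp A (Comp A (Pr2 A (COb M' (i + 1)) (COb M (i + 1 - 1))) (h (i + 1))) (Diff Z i)))"
      using 2[of i] by simp
  qed (simp add: Hom_def)
  with f' that show ?thesis by blast
qed

text \<open>The differentials of complexes concentrated in degree \<open>0\<close> vanish, so
  homotopic maps between them are equal in degree \<open>0\<close>.\<close>

lemma Kb_embed_faithful:
  assumes f: "f \<in> Hom A X Y" and g: "g \<in> Hom A X Y" and e: "ArrMap (Kb_embed A) f = ArrMap (Kb_embed A) g"
  shows "f = g"
proof -
  have [simp]: "X \<in> Ob A" "Y \<in> Ob A" using Hom_Ob[OF f] by simp_all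
  have C: "is_complex A (stalk A X)" "is_complex A (stalk A Y)" by simp_all
  have "homotopic A (stalk A X) (stalk A Y) (stalk_map A f) (stalk_map A g)"
    using e HomD[OF f] HomD[OF g] ho_class_eq_iff[OF C stalk_chain_map[OF f] stalk_chain_map[OF g]]
    by (simp add: Kb_embed_def)
  then obtain h where h: "\<And>i. h i \<in> Hom A (COb (stalk A X) i) (COb (stalk A Y) (i - 1))"
    and "stalk_map A f 0 = Add A (stalk_map A g 0) (Add A (Comp A (Diff (stalk A Y) (0 - 1)) (h 0)) (Comp A (h (0 + 1)) (Diff (stalk A X) 0)))"
    unfolding homotopic_def by blast
  then show ?thesis
    using h[of 0] h[of 1] f g by (simp add: Hom_def)
qed

end

section \<open>Localizations\<close>

locale localization = category C
  for C :: "('o, 'm, 'x) cat_scheme" +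
  fixes S :: "'m set"
  assumes S_Arr: "S \<subseteq> Arr C"
begin

abbreviation "loc \<equiv> ArrMap (gz_loc C S)"

sublocale L: category "gz C S"
  by (rule gz_category[OF S_Arr])

sublocale P: is_functor C "gz C S" "gz_loc C S"
  by (rule gz_loc_functor[OF S_Arr])

declare gz_Ident [simp del]
lemmas L_Ob [simp] = gz_Ob[OF S_Arr]

lemma L_Dom_Cod_Ob [simp]:
  "f \<in> Arr (gz C S) \<Longrightarrow> Dom (gz C S) f \<in> Ob C" "f \<in> Arr (gz C S) \<Longrightarrow> Cod (gz C S) f \<in> Ob C"
  using L.Dom_Ob L.Cod_Ob by simp_all

lemma loc_ObMap [simp]: "ObMap (gz_loc C S) X = X"
  by (simp add: gz_loc_def)

lemma loc_Ident: "X \<in> Ob C \<Longrightarrow> loc (Ident C X) = Ident (gz C S) X"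
  using P.ArrMap_Ident by simp

text \<open>An arrow of the localization is the class of a zigzag, hence a composite of images of
  arrows and of inverses of elements of \<open>S\<close>. The inverses are given by their equations
  alone, so that later proofs avoid zigzags.\<close>

lemma gz_induct [consumes 1, case_names Ident loc inverse Comp]:
  assumes \<phi>: "\<phi> \<in> Arr (gz C S)"
    and "\<And>X. X \<in> Ob C \<Longrightarrow> P (Ident (gz C S) X)"
    and "\<And>f. f \<in> Arr C \<Longrightarrow> P (loc f)"
    and "\<And>s t. s \<in> S \<Longrightarrow> t \<in> Arr (gz C S) \<Longrightarrow> Dom (gz C S) t = Cod C s \<Longrightarrow> Cod (gz C S) t = Dom C s \<Longrightarrow>
      Comp (gz C S) t (loc s) = Ident (gz C S) (Dom C s) \<Longrightarrow>
      Comp (gz C S) (loc s) t = Ident (gz C S) (Cod C s) \<Longrightarrow> P t"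
    and comp: "\<And>f g. f \<in> Arr (gz C S) \<Longrightarrow> g \<in> Arr (gz C S) \<Longrightarrow> Dom (gz C S) g = Cod (gz C S) f \<Longrightarrow> P f \<Longrightarrow> P g \<Longrightarrow>
      P (Comp (gz C S) g f)"
  shows "P \<phi>"
proof -
  have "P (gz_class C S X Y w)" if "gz_path C S X Y w" for X Y w
    using that
  proof (induction rule: gz_path.induct)
    case (nil X)
    then show ?case using assms(2)[of X] by (simp add: gz_Ident[OF S_Arr])
  next
    case (fwd f Y w)
    have p: "gz_path C S (Dom C f) (Cod C f) [Fwd f]" using fwd by (auto simp: gz_path_simps)
    have "gz_class C S (Dom C f) Y (Fwd f # w) = Comp (gz C S) (gz_class C S (Cod C f) Y w) (loc f)"
      using gz_Comp[OF S_Arr p fwd(2)] by (simp add: gz_loc_def)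
    moreover have "gz_class C S (Cod C f) Y w \<in> Hom (gz C S) (Cod C f) Y"
      using fwd(2) gz_Hom_iff[OF S_Arr] by blast
    ultimately show ?case using fwd assms(3)[of f] comp[of "loc f" "gz_class C S (Cod C f) Y w"]
      by (simp add: Hom_def)
  next
    case (bwd s Y w)
    let ?t = "gz_class C S (Cod C s) (Dom C s) [Bwd s]"
    have s: "s \<in> Arr C" using bwd S_Arr by blast
    have p: "gz_path C S (Cod C s) (Dom C s) [Bwd s]" using bwd s by (auto simp: gz_path_simps)
    have "gz_class C S (Cod C s) Y (Bwd s # w) = Comp (gz C S) (gz_class C S (Dom C s) Y w) ?t"
      using gz_Comp[OF S_Arr p bwd(2)] by simp
    moreover have "gz_class C S (Dom C s) Y w \<in> Hom (gz C S) (Dom C s) Y" "?t \<in> Hom (gz C S) (Cod C s) (Dom C s)"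
      using bwd(2) p gz_Hom_iff[OF S_Arr] by blast+
    moreover have "P ?t"
      using gz_inverse[OF S_Arr bwd(1)] s by (intro assms(4)[of s]) (auto simp: inverse_arrows_def Hom_def bwd(1))
    ultimately show ?case using bwd comp[of ?t "gz_class C S (Dom C s) Y w"] by (simp add: Hom_def)
  qed
  moreover obtain w where "gz_path C S (Dom (gz C S) \<phi>) (Cod (gz C S) \<phi>) w"
    "\<phi> = gz_class C S (Dom (gz C S) \<phi>) (Cod (gz C S) \<phi>) w"
    using \<phi> gz_Hom_iff[OF S_Arr, of \<phi>] by (auto simp: Hom_def)
  ultimately show ?thesis by metis
qed

text \<open>Naturality passes to composites, and from \<open>s\<close> to its inverse
  \<open>t\<close> by composing the square for \<open>s\<close> with the images of \<open>t\<close>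
  on both sides.\<close>

lemma natural:
  assumes F: "is_functor (gz C S) D F" and G: "is_functor (gz C S) D G"
    and \<eta>: "\<And>X. X \<in> Ob C \<Longrightarrow> \<eta> X \<in> Arr D" "\<And>X. X \<in> Ob C \<Longrightarrow> Dom D (\<eta> X) = ObMap F X"
      "\<And>X. X \<in> Ob C \<Longrightarrow> Cod D (\<eta> X) = ObMap G X"
    and nat: "\<And>f. f \<in> Arr C \<Longrightarrow>
      Comp D (\<eta> (Cod C f)) (ArrMap F (loc f)) = Comp D (ArrMap G (loc f)) (\<eta> (Dom C f))"
    and \<phi>: "\<phi> \<in> Arr (gz C S)"
  shows "Comp D (\<eta> (Cod (gz C S) \<phi>)) (ArrMap F \<phi>) = Comp D (ArrMap G \<phi>) (\<eta> (Dom (gz C S) \<phi>))"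
  using \<phi>
proof (induction rule: gz_induct)
  interpret F: is_functor "gz C S" D F by fact
  interpret G: is_functor "gz C S" D G by fact
  note [simp] = \<eta>
  {
    case (Ident X)
    then show ?case by (simp add: F.ArrMap_Ident G.ArrMap_Ident)
  next
    case (loc f)
    then show ?case using nat by simp
  next
    case (inverse s t)
    then have s [simp]: "s \<in> Arr C" using S_Arr by blast
    note [simp] = inverse(2-4)
    have F: "Comp D (ArrMap F (loc s)) (ArrMap F t) = Ident D (ObMap F (Cod C s))"
      using F.ArrMap_Comp_simp[of t "loc s"] inverse F.ArrMap_Ident by simp
    have G: "Comp D (ArrMap G t) (ArrMap G (loc s)) = Ident D (ObMap G (Dom C s))"
      using G.ArrMap_Comp_simp[of "loc s" t] inverse G.ArrMap_Ident by simp
    have "Comp D (\<eta> (Dom C s)) (ArrMap F t) = Comp D (Comp D (ArrMap G t) (ArrMap G (loc s))) (Comp D (\<eta> (Dom C s)) (ArrMap F t))"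
      unfolding G by simp
    also have "\<dots> = Comp D (ArrMap G t) (Comp D (Comp D (ArrMap G (loc s)) (\<eta> (Dom C s))) (ArrMap F t))"
      by simp
    also have "\<dots> = Comp D (ArrMap G t) (Comp D (\<eta> (Cod C s)) (Comp D (ArrMap F (loc s)) (ArrMap F t)))"
      unfolding nat[OF s, symmetric] by simp
    also have "\<dots> = Comp D (ArrMap G t) (\<eta> (Cod C s))"
      unfolding F by simp
    finally show ?case by simp
  next
    case (Comp f g)
    note [simp] = Comp(1-3)
    have "Comp D (\<eta> (Cod (gz C S) g)) (ArrMap F (Comp (gz C S) g f))
        = Comp D (Comp D (\<eta> (Cod (gz C S) g)) (ArrMap F g)) (ArrMap F f)"
      by (simp add: F.ArrMap_Comp_simp)
    also have "\<dots> = Comp D (ArrMap G g) (Comp D (\<eta> (Cod (gz C S) f)) (ArrMap F f))"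
      unfolding Comp(5) by simp
    also have "\<dots> = Comp D (ArrMap G (Comp (gz C S) g f)) (\<eta> (Dom (gz C S) f))"
      unfolding Comp(4) by (simp add: G.ArrMap_Comp_simp)
    finally show ?case by simp
  }
qed

text \<open>The identities form a natural family on arrows of \<open>C\<close>; by
  \<open>natural\<close> they are natural on the whole localization, which means that both functors
  agree.\<close>

lemma functor_eqI:
  assumes F: "is_functor (gz C S) D F" and G: "is_functor (gz C S) D G"
    and "\<And>X. X \<in> Ob C \<Longrightarrow> ObMap F X = ObMap G X" "\<And>f. f \<in> Arr C \<Longrightarrow> ArrMap F (loc f) = ArrMap G (loc f)"
    and \<phi>: "\<phi> \<in> Arr (gz C S)"
  shows "ArrMap F \<phi> = ArrMap G \<phi>"
proof -
  interpret F: is_functor "gz C S" D F by fact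
  interpret G: is_functor "gz C S" D G by fact
  show ?thesis
    using natural[OF F G, of "\<lambda>X. Ident D (ObMap F X)" \<phi>] \<phi> F.ObMap_Ob G.ObMap_Ob
    by (simp add: assms(3,4))
qed

section \<open>Endofunctors induced on the localization\<close>

definition gz_map :: "('o, 'm, 'o, 'm) fctr \<Rightarrow> ('o, ('o, 'm) gz_arr, 'o, ('o, 'm) gz_arr) fctr" where
  "gz_map F = gz_lift C (gz C S) (fcomp (gz_loc C S) F)"

lemma gz_map:
  assumes F: "is_functor C C F" and s: "\<And>s. s \<in> S \<Longrightarrow> ArrMap F s \<in> S"
  shows "is_functor (gz C S) (gz C S) (gz_map F)"
    and "ObMap (gz_map F) X = ObMap F X"
    and "f \<in> Arr C \<Longrightarrow> ArrMap (gz_map F) (loc f) = loc (ArrMap F f)"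
proof -
  interpret F: is_functor C C F by fact
  have *: "is_functor C (gz C S) (fcomp (gz_loc C S) F)"
    by (rule fcomp_functor[OF F P.is_functor_axioms])
  have i: "is_iso (gz C S) (ArrMap (fcomp (gz_loc C S) F) t)" if "t \<in> S" for t
    using that s gz_loc_inverts[OF S_Arr] by (simp add: fcomp_def)
  show "is_functor (gz C S) (gz C S) (gz_map F)"
    unfolding gz_map_def by (rule gz_universal(1)[OF S_Arr * i])
  show "ObMap (gz_map F) X = ObMap F X"
    by (simp add: gz_map_def gz_lift_def fcomp_def)
  show "f \<in> Arr C \<Longrightarrow> ArrMap (gz_map F) (loc f) = loc (ArrMap F f)"
    using gz_universal(2)[OF S_Arr * i] unfolding gz_map_def by (simp add: feq_def fcomp_def)
qed

end

section \<open>The localization of an additive category is additive\<close>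

locale additive_localization = additive_category A
  for A :: "('o, 'm, 'x) addcat_scheme" +
  fixes S :: "'m set"
  assumes S_sub: "S \<subseteq> Arr A"
    and S_Ident: "X \<in> Ob A \<Longrightarrow> Ident A X \<in> S"
    and S_dsum: "s \<in> S \<Longrightarrow> t \<in> S \<Longrightarrow> dsum_arr A s t \<in> S"
begin

sublocale localization A S
  by unfold_locales (rule S_sub)

abbreviation "L \<equiv> gz A S"

section \<open>The direct sum as a bifunctor on the localization\<close>

definition sum_right :: "'o \<Rightarrow> ('o, 'm) gz_arr \<Rightarrow> ('o, 'm) gz_arr" where
  "sum_right Z = ArrMap (gz_map (dsum_right Z))"

definition sum_left :: "'o \<Rightarrow> ('o, 'm) gz_arr \<Rightarrow> ('o, 'm) gz_arr" where
  "sum_left Z = ArrMap (gz_map (dsum_left Z))"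

text \<open>For \<open>s \<in> S\<close> the arrows \<open>s \<oplus> 1\<close> and
  \<open>1 \<oplus> s\<close> lie in \<open>S\<close>: here both hypotheses on \<open>S\<close>
  enter, identities and closure under sums.\<close>

lemma sum_functor:
  assumes Z: "Z \<in> Ob A"
  shows "is_functor L L (gz_map (dsum_right Z))" "is_functor L L (gz_map (dsum_left Z))"
    "ObMap (gz_map (dsum_right Z)) X = DSum A X Z" "ObMap (gz_map (dsum_left Z)) X = DSum A Z X"
    "f \<in> Arr A \<Longrightarrow> sum_right Z (loc f) = loc (dsum_arr A f (Ident A Z))"
    "f \<in> Arr A \<Longrightarrow> sum_left Z (loc f) = loc (dsum_arr A (Ident A Z) f)"
  using gz_map[OF dsum_functor(1)[OF Z]] gz_map[OF dsum_functor(2)[OF Z]] S_Ident[OF Z] S_dsum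
  unfolding sum_right_def sum_left_def by (simp_all add: dsum_right_def dsum_left_def)

lemma sum_simps [simp]:
  assumes Z: "Z \<in> Ob A" and f: "f \<in> Arr L"
  shows "sum_right Z f \<in> Arr L" "Dom L (sum_right Z f) = DSum A (Dom L f) Z" "Cod L (sum_right Z f) = DSum A (Cod L f) Z"
    "sum_left Z f \<in> Arr L" "Dom L (sum_left Z f) = DSum A Z (Dom L f)" "Cod L (sum_left Z f) = DSum A Z (Cod L f)"
  using is_functor.ArrMap_simps[OF sum_functor(1)[OF Z] f] is_functor.ArrMap_simps[OF sum_functor(2)[OF Z] f]
  by (simp_all add: sum_right_def sum_left_def sum_functor(3,4)[OF Z])

lemma sum_Comp:
  assumes Z: "Z \<in> Ob A" and f: "f \<in> Arr L" "g \<in> Arr L" "Dom L g = Cod L f"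
  shows "sum_right Z (Comp L g f) = Comp L (sum_right Z g) (sum_right Z f)"
    "sum_left Z (Comp L g f) = Comp L (sum_left Z g) (sum_left Z f)"
  using is_functor.ArrMap_Comp_simp[OF sum_functor(1)[OF Z] f] is_functor.ArrMap_Comp_simp[OF sum_functor(2)[OF Z] f]
  by (simp_all add: sum_right_def sum_left_def)

lemma sum_Ident:
  assumes "Z \<in> Ob A" "X \<in> Ob A"
  shows "sum_right Z (Ident L X) = Ident L (DSum A X Z)" "sum_left Z (Ident L X) = Ident L (DSum A Z X)"
  using is_functor.ArrMap_Ident[OF sum_functor(1), of Z X] is_functor.ArrMap_Ident[OF sum_functor(2), of Z X] assms
  by (simp_all add: sum_right_def sum_left_def sum_functor(3,4))

lemma loc_Comp: "f \<in> Arr A \<Longrightarrow> g \<in> Arr A \<Longrightarrow> Dom A g = Cod A f \<Longrightarrow> Comp L (loc g) (loc f) = loc (Comp A g f)"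
  by (simp add: P.ArrMap_Comp_simp)

lemma loc_Comp': "f \<in> Arr A \<Longrightarrow> g \<in> Arr A \<Longrightarrow> h \<in> Arr L \<Longrightarrow> Dom A g = Cod A f \<Longrightarrow> Cod L h = Dom A f \<Longrightarrow>
  Comp L (loc g) (Comp L (loc f) h) = Comp L (loc (Comp A g f)) h"
  by (simp add: P.ArrMap_Comp_simp)

text \<open>In \<open>A\<close> the projections are natural transformations from
  \<open>- \<oplus> Z\<close> to the identity functor and to a constant functor;
  \<open>natural\<close> carries this over to \<open>L\<close>.\<close>

lemma sum_right_natural:
  assumes Z: "Z \<in> Ob A" and f: "f \<in> Arr L"
  shows "Comp L (loc (Pr1 A (Cod L f) Z)) (sum_right Z f) = Comp L f (loc (Pr1 A (Dom L f) Z))"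
    "Comp L (loc (Pr2 A (Cod L f) Z)) (sum_right Z f) = loc (Pr2 A (Dom L f) Z)"
  using natural[OF sum_functor(1)[OF Z] fid_functor[OF L.category_axioms], of "\<lambda>X. loc (Pr1 A X Z)" f]
    natural[OF sum_functor(1)[OF Z] const_functor[OF L.category_axioms L.category_axioms], of Z "\<lambda>X. loc (Pr2 A X Z)" f] Z f
  by (simp_all add: sum_functor[OF Z] fid_def sum_right_def[symmetric] loc_Comp)

lemma sum_left_natural:
  assumes Z: "Z \<in> Ob A" and f: "f \<in> Arr L"
  shows "Comp L (loc (Pr1 A Z (Cod L f))) (sum_left Z f) = loc (Pr1 A Z (Dom L f))"
    "Comp L (loc (Pr2 A Z (Cod L f))) (sum_left Z f) = Comp L f (loc (Pr2 A Z (Dom L f)))"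
  using natural[OF sum_functor(2)[OF Z] fid_functor[OF L.category_axioms], of "\<lambda>X. loc (Pr2 A Z X)" f]
    natural[OF sum_functor(2)[OF Z] const_functor[OF L.category_axioms L.category_axioms], of Z "\<lambda>X. loc (Pr1 A Z X)" f] Z f
  by (simp_all add: sum_functor[OF Z] fid_def sum_left_def[symmetric] loc_Comp)

text \<open>\<open>natural\<close> is applied once in each variable: first an arrow \<open>h\<close>
  of \<open>L\<close> is interchanged with an arrow \<open>a\<close> of \<open>A\<close>, and then
  the arrows \<open>sum_right X f\<close> are natural in \<open>X\<close> on all of
  \<open>L\<close>.\<close>

lemma interchange:
  assumes f: "f \<in> Arr L" and g: "g \<in> Arr L"
  shows "Comp L (sum_right (Cod L g) f) (sum_left (Dom L f) g) = Comp L (sum_left (Cod L f) g) (sum_right (Dom L g) f)"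
proof -
  have *: "Comp L (sum_right (Cod A a) h) (loc (dsum_arr A (Ident A (Dom L h)) a))
      = Comp L (loc (dsum_arr A (Ident A (Cod L h)) a)) (sum_right (Dom A a) h)" if a: "a \<in> Arr A" and h: "h \<in> Arr L" for a h
    using natural[OF sum_functor(1)[of "Dom A a"] sum_functor(1)[of "Cod A a"], of "\<lambda>X. loc (dsum_arr A (Ident A X) a)" h] a h
    by (simp add: sum_functor sum_right_def[symmetric] loc_Comp dsum_arr_Comp[symmetric])
  show ?thesis
    using natural[OF sum_functor(2)[of "Dom L f"] sum_functor(2)[of "Cod L f"], of "\<lambda>X. sum_right X f" g] f g
    by (simp add: sum_functor sum_left_def[symmetric] *)
qed

section \<open>Diagonals and binary products in the localization\<close>

definition diag :: "'o \<Rightarrow> ('o, 'm) gz_arr" where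
  "diag X = loc (Add A (In1 A X X) (In2 A X X))"

lemma diag_simps [simp]:
  assumes "X \<in> Ob A"
  shows "diag X \<in> Arr L" "Dom L (diag X) = X" "Cod L (diag X) = DSum A X X"
  using assms by (simp_all add: diag_def)

text \<open>The arrow with components \<open>f\<close> and \<open>g\<close>, built as the diagonal
  followed by \<open>f \<oplus> 1\<close> and \<open>1 \<oplus> g\<close>.\<close>

definition pair :: "('o, 'm) gz_arr \<Rightarrow> ('o, 'm) gz_arr \<Rightarrow> ('o, 'm) gz_arr" where
  "pair f g = Comp L (sum_left (Cod L f) g) (Comp L (sum_right (Dom L f) f) (diag (Dom L f)))"

lemma pair_simps [simp]:
  assumes "f \<in> Arr L" "g \<in> Arr L" "Dom L f = Dom L g"
  shows "pair f g \<in> Arr L" "Dom L (pair f g) = Dom L g" "Cod L (pair f g) = DSum A (Cod L f) (Cod L g)"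
    "X = Cod L f \<Longrightarrow> Y = Cod L g \<Longrightarrow> Comp L (loc (Pr1 A X Y)) (pair f g) = f"
    "X = Cod L f \<Longrightarrow> Y = Cod L g \<Longrightarrow> Comp L (loc (Pr2 A X Y)) (pair f g) = g"
proof -
  show "pair f g \<in> Arr L" "Dom L (pair f g) = Dom L g" "Cod L (pair f g) = DSum A (Cod L f) (Cod L g)"
    using assms by (simp_all add: pair_def)
  note [simp] = assms
  have r: "Comp L (loc (Pr1 A (Cod L f) (Dom L g))) (Comp L (sum_right (Dom L g) f) (diag (Dom L g))) = f"
    "Comp L (loc (Pr2 A (Cod L f) (Dom L g))) (Comp L (sum_right (Dom L g) f) (diag (Dom L g))) = Ident L (Dom L g)"
    using arg_cong[OF sum_right_natural(1)[of "Dom L g" f], of "\<lambda>x. Comp L x (diag (Dom L g))"]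
      arg_cong[OF sum_right_natural(2)[of "Dom L g" f], of "\<lambda>x. Comp L x (diag (Dom L g))"]
    by (simp_all add: diag_def loc_Comp loc_Ident)
  show "Comp L (loc (Pr1 A X Y)) (pair f g) = f" if "X = Cod L f" "Y = Cod L g"
    using arg_cong[OF sum_left_natural(1)[of "Cod L f" g],
        of "\<lambda>x. Comp L x (Comp L (sum_right (Dom L g) f) (diag (Dom L g)))"] that r
    by (simp add: pair_def)
  show "Comp L (loc (Pr2 A X Y)) (pair f g) = g" if "X = Cod L f" "Y = Cod L g"
    using arg_cong[OF sum_left_natural(2)[of "Cod L f" g],
        of "\<lambda>x. Comp L x (Comp L (sum_right (Dom L g) f) (diag (Dom L g)))"] that r
    by (simp add: pair_def)
qed

text \<open>Functoriality of \<open>square\<close> is the interchange law.\<close>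

definition square :: "('o, ('o, 'm) gz_arr, 'o, ('o, 'm) gz_arr) fctr" where
  "square = \<lparr>ObMap = \<lambda>X. DSum A X X, ArrMap = \<lambda>f. Comp L (sum_left (Cod L f) f) (sum_right (Dom L f) f)\<rparr>"

lemma square_functor: "is_functor L L square"
proof (unfold_locales, goal_cases)
  case (1 X)
  then show ?case by (simp add: square_def)
next
  case (2 f X Y)
  then show ?case by (auto simp: square_def Hom_def)
next
  case (3 X)
  then show ?case by (simp add: square_def sum_Ident)
next
  case (4 f X Y g Z)
  then have [simp]: "f \<in> Arr L" "g \<in> Arr L" "Dom L g = Cod L f" and e: "X = Dom L f" "Y = Cod L f" "Z = Cod L g"
    by (auto simp: Hom_def)
  have "Comp L (Comp L (sum_left (Cod L g) g) (sum_left (Cod L g) f)) (Comp L (sum_right (Dom L f) g) (sum_right (Dom L f) f))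
    = Comp L (sum_left (Cod L g) g) (Comp L (Comp L (sum_left (Cod L g) f) (sum_right (Dom L f) g)) (sum_right (Dom L f) f))"
    by simp
  also have "\<dots> = Comp L (Comp L (sum_left (Cod L g) g) (sum_right (Dom L g) g)) (Comp L (sum_left (Cod L f) f) (sum_right (Dom L f) f))"
    using interchange[of g f, symmetric] by simp
  finally show ?case by (simp add: square_def sum_Comp)
qed

lemma diag_natural:
  assumes "f \<in> Arr L"
  shows "Comp L (diag (Cod L f)) f = Comp L (sum_left (Cod L f) f) (Comp L (sum_right (Dom L f) f) (diag (Dom L f)))"
proof -
  have "Comp A (Add A (In1 A (Cod A a) (Cod A a)) (In2 A (Cod A a) (Cod A a))) a =
      Comp A (dsum_arr A (Ident A (Cod A a)) a) (Comp A (dsum_arr A a (Ident A (Dom A a)))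
        (Add A (In1 A (Dom A a) (Dom A a)) (In2 A (Dom A a) (Dom A a))))" if "a \<in> Arr A" for a
    by (rule DSum_eqI[of "Cod A a" "Cod A a"]) (use that in simp_all)
  then show ?thesis
    using natural[OF fid_functor[OF L.category_axioms] square_functor, of diag f] assms
    by (simp add: fid_def square_def diag_def sum_functor loc_Comp loc_Comp')
qed

text \<open>The diagonal is natural, so \<open>h\<close> can be moved past it as
  \<open>h \<oplus> h\<close>; the interchange law then collects \<open>f h\<close> and
  \<open>g h\<close>.\<close>

lemma pair_Comp:
  assumes "f \<in> Arr L" "g \<in> Arr L" "h \<in> Arr L" "Dom L f = Cod L h" "Dom L g = Cod L h"
  shows "Comp L (pair f g) h = pair (Comp L f h) (Comp L g h)"
proof -
  note [simp] = assms
  have "Comp L (pair f g) h = Comp L (sum_left (Cod L f) g) (Comp L (sum_right (Dom L f) f) (Comp L (diag (Dom L f)) h))"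
    by (simp add: pair_def)
  also have "\<dots> = Comp L (sum_left (Cod L f) g) (Comp L (Comp L (sum_right (Cod L h) f) (sum_left (Cod L h) h))
    (Comp L (sum_right (Dom L h) h) (diag (Dom L h))))"
    by (simp add: diag_natural)
  also have "\<dots> = pair (Comp L f h) (Comp L g h)"
    using interchange[of f h] by (simp add: pair_def sum_Comp)
  finally show ?thesis .
qed

text \<open>The pair of the two projections is the identity, as a computation in \<open>A\<close>
  shows. By \<open>pair_Comp\<close> every arrow into the sum is then the pair of its
  components.\<close>

lemma pair_eqI:
  assumes X: "X \<in> Ob A" "Y \<in> Ob A" and h: "h \<in> Arr L" "h' \<in> Arr L" "Cod L h = DSum A X Y" "Cod L h' = DSum A X Y"
    and "Comp L (loc (Pr1 A X Y)) h = Comp L (loc (Pr1 A X Y)) h'" "Comp L (loc (Pr2 A X Y)) h = Comp L (loc (Pr2 A X Y)) h'"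
  shows "h = h'"
proof -
  have "Comp A (dsum_arr A (Ident A X) (Pr2 A X Y)) (Comp A (dsum_arr A (Pr1 A X Y) (Ident A (DSum A X Y)))
      (Add A (In1 A (DSum A X Y) (DSum A X Y)) (In2 A (DSum A X Y) (DSum A X Y)))) = Ident A (DSum A X Y)"
    by (rule DSum_eqI[of X Y]) (use X in simp_all)
  then have "pair (loc (Pr1 A X Y)) (loc (Pr2 A X Y)) = Ident L (DSum A X Y)"
    using X by (simp add: pair_def sum_functor diag_def loc_Comp loc_Ident)
  then have "k = pair (Comp L (loc (Pr1 A X Y)) k) (Comp L (loc (Pr2 A X Y)) k)" if "k \<in> Arr L" "Cod L k = DSum A X Y" for k
    using pair_Comp[of "loc (Pr1 A X Y)" "loc (Pr2 A X Y)" k] X that by simp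
  then show ?thesis using assms by metis
qed

section \<open>The addition of arrows, defined through the codiagonal\<close>

definition gz_add_arr :: "('o, 'm) gz_arr \<Rightarrow> ('o, 'm) gz_arr \<Rightarrow> ('o, 'm) gz_arr" where
  "gz_add_arr f g = Comp L (loc (Add A (Pr1 A (Cod L f) (Cod L f)) (Pr2 A (Cod L f) (Cod L f)))) (pair f g)"

lemma gz_add_arr_simps [simp]:
  assumes "f \<in> Arr L" "g \<in> Arr L" "Dom L f = Dom L g" "Cod L f = Cod L g"
  shows "gz_add_arr f g \<in> Arr L" "Dom L (gz_add_arr f g) = Dom L g" "Cod L (gz_add_arr f g) = Cod L g"
  using assms by (simp_all add: gz_add_arr_def)

text \<open>Comparison of components shows that the pair of \<open>a u\<close> and
  \<open>b u\<close> is the image of the arrow with components \<open>a\<close> and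
  \<open>b\<close>, composed with \<open>u\<close>. Since \<open>f\<close> and \<open>g\<close> are
  projections of \<open>pair f g\<close>, this reduces laws of addition to \<open>A\<close>.\<close>

lemma gz_add_arr_loc:
  assumes u: "u \<in> Arr L" "Cod L u = Dom A a" and ab: "a \<in> Arr A" "b \<in> Arr A" "Dom A a = Dom A b" "Cod A a = Cod A b"
  shows "gz_add_arr (Comp L (loc a) u) (Comp L (loc b) u) = Comp L (loc (Add A a b)) u"
proof -
  note [simp] = assms
  have "pair (Comp L (loc a) u) (Comp L (loc b) u)
    = Comp L (loc (Add A (Comp A (In1 A (Cod A b) (Cod A b)) a) (Comp A (In2 A (Cod A b) (Cod A b)) b))) u"
    by (rule pair_eqI[of "Cod A b" "Cod A b"]) (simp_all add: loc_Comp')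
  then show ?thesis by (simp add: gz_add_arr_def loc_Comp')
qed

lemma gz_add_arr_Comp_right:
  assumes "f \<in> Arr L" "g \<in> Arr L" "h \<in> Arr L" "Dom L f = Dom L g" "Cod L f = Cod L g" "Cod L h = Dom L g"
  shows "Comp L (gz_add_arr f g) h = gz_add_arr (Comp L f h) (Comp L g h)"
  using assms by (simp add: gz_add_arr_def pair_Comp)

text \<open>With \<open>u = pair f g\<close> both sides are images of arrows of \<open>A\<close>
  composed with \<open>u\<close>, and composition in \<open>A\<close> is additive.\<close>

lemma loc_Comp_gz_add_arr:
  assumes "a \<in> Arr A" "f \<in> Arr L" "g \<in> Arr L" "Dom L f = Dom L g" "Cod L f = Dom A a" "Cod L g = Dom A a"
  shows "Comp L (loc a) (gz_add_arr f g) = gz_add_arr (Comp L (loc a) f) (Comp L (loc a) g)"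
proof -
  note [simp] = assms
  have "gz_add_arr (Comp L (loc a) f) (Comp L (loc a) g)
    = gz_add_arr (Comp L (loc (Comp A a (Pr1 A (Dom A a) (Dom A a)))) (pair f g))
        (Comp L (loc (Comp A a (Pr2 A (Dom A a) (Dom A a)))) (pair f g))"
    by (simp add: loc_Comp'[symmetric])
  also have "\<dots> = Comp L (loc a) (gz_add_arr f g)"
    by (subst gz_add_arr_loc) (simp_all add: gz_add_arr_def loc_Comp')
  finally show ?thesis ..
qed

text \<open>For the inverse \<open>t\<close> of \<open>s\<close>, write \<open>f + g\<close> as
  \<open>s (t f) + s (t g) = s (t f + t g)\<close> and compose with \<open>t\<close>.\<close>

lemma gz_add_arr_Comp_left:
  assumes "h \<in> Arr L"
  shows "\<forall>f g. f \<in> Arr L \<longrightarrow> g \<in> Arr L \<longrightarrow> Dom L f = Dom L g \<longrightarrow> Cod L f = Dom L h \<longrightarrow> Cod L g = Dom L h \<longrightarrow>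
    Comp L h (gz_add_arr f g) = gz_add_arr (Comp L h f) (Comp L h g)"
  using assms
proof (induction rule: gz_induct)
  case (Ident X)
  then show ?case by simp
next
  case (loc a)
  then show ?case using loc_Comp_gz_add_arr by simp
next
  case (inverse s t)
  then have s [simp]: "s \<in> Arr A" using S_sub by blast
  note [simp] = inverse(2-4)
  show ?case
  proof (intro allI impI)
    fix f g assume fg [simp]: "f \<in> Arr L" "g \<in> Arr L" "Dom L f = Dom L g" "Cod L f = Dom L t" "Cod L g = Dom L t"
    have st: "Comp L (loc s) (Comp L t k) = k" if "k \<in> Arr L" "Cod L k = Dom L t" for k
      using that inverse(6) L.Comp_assoc_simp[of k t "loc s"] by (simp del: L.Comp_assoc_simp)
    have "Comp L t (gz_add_arr f g) = Comp L t (Comp L (loc s) (gz_add_arr (Comp L t f) (Comp L t g)))"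
      by (simp add: loc_Comp_gz_add_arr st)
    also have "\<dots> = Comp L (Comp L t (loc s)) (gz_add_arr (Comp L t f) (Comp L t g))" by simp
    also have "\<dots> = gz_add_arr (Comp L t f) (Comp L t g)" unfolding inverse(5) by simp
    finally show "Comp L t (gz_add_arr f g) = gz_add_arr (Comp L t f) (Comp L t g)" .
  qed
next
  case (Comp f g)
  then show ?case by (simp del: split_paired_All)
qed

text \<open>For the inverse \<open>t\<close> of \<open>s\<close>, the zero arrow on the source of
  \<open>s\<close> is the zero arrow on its target composed with \<open>s\<close>, and
  \<open>s t\<close> is an identity.\<close>

lemma loc_Zero_Comp:
  assumes "f \<in> Arr L" 
  shows "\<forall>Y \<in> Ob A. Comp L (loc (ZeroArr A (Cod L f) Y)) f = loc (ZeroArr A (Dom L f) Y)"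
  using assms
proof (induction rule: gz_induct)
  case (Ident X)
  then show ?case by simp
next
  case (loc a)
  then show ?case by (simp add: loc_Comp)
next
  case (inverse s t)
  then have s [simp]: "s \<in> Arr A" using S_sub by blast
  note [simp] = inverse(2-4)
  show ?case
  proof
    fix Y assume [simp]: "Y \<in> Ob A"
    have "Comp L (loc (ZeroArr A (Dom A s) Y)) t = Comp L (Comp L (loc (ZeroArr A (Cod A s) Y)) (loc s)) t"
      by (subst loc_Comp) simp_all
    also have "\<dots> = loc (ZeroArr A (Cod A s) Y)"
      using inverse(6) by simp
    finally show "Comp L (loc (ZeroArr A (Cod L t) Y)) t = loc (ZeroArr A (Dom L t) Y)" by simp
  qed
next
  case (Comp f g)
  show ?case
  proof
    fix Y assume [simp]: "Y \<in> Ob A"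
    note [simp] = Comp(1-3)
    have "Comp L (loc (ZeroArr A (Cod L g) Y)) (Comp L g f) = Comp L (Comp L (loc (ZeroArr A (Cod L g) Y)) g) f"
      by simp
    then show "Comp L (loc (ZeroArr A (Cod L (Comp L g f)) Y)) (Comp L g f) = loc (ZeroArr A (Dom L (Comp L g f)) Y)"
      using Comp(4,5) by simp
  qed
qed

lemma loc_Zero_from:
  assumes "f \<in> Arr L" shows "\<forall>X \<in> Ob A. Comp L f (loc (ZeroArr A X (Dom L f))) = loc (ZeroArr A X (Cod L f))"
  using assms
proof (induction rule: gz_induct)
  case (Ident X)
  then show ?case by simp
next
  case (loc a)
  then show ?case by (simp add: loc_Comp)
next
  case (inverse s t)
  then have s [simp]: "s \<in> Arr A" using S_sub by blast
  note [simp] = inverse(2-4)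
  show ?case
  proof
    fix X assume [simp]: "X \<in> Ob A"
    have "Comp L t (loc (ZeroArr A X (Cod A s))) = Comp L t (Comp L (loc s) (loc (ZeroArr A X (Dom A s))))"
      by (subst loc_Comp) simp_all
    also have "\<dots> = Comp L (Comp L t (loc s)) (loc (ZeroArr A X (Dom A s)))" by simp
    also have "\<dots> = loc (ZeroArr A X (Dom A s))"
      unfolding inverse(5) by simp
    finally show "Comp L t (loc (ZeroArr A X (Dom L t))) = loc (ZeroArr A X (Cod L t))" by simp
  qed
next
  case (Comp f g)
  then show ?case by simp
qed

text \<open>The zero object, the sums and their structure arrows are those of \<open>A\<close> or
  their images. With \<open>loc_Add\<close> this makes the localization functor preserve all
  additive data as equalities.\<close>

definition gz_addcat :: "('o, ('o, 'm) gz_arr) addcat" where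
  "gz_addcat = \<lparr>Ob = Ob L, Arr = Arr L, Dom = Dom L, Cod = Cod L, Ident = Ident L, Comp = Comp L,
     Add = gz_add_arr, ZeroArr = \<lambda>X Y. loc (ZeroArr A X Y), ZeroOb = ZeroOb A, DSum = DSum A,
     In1 = \<lambda>X Y. loc (In1 A X Y), In2 = \<lambda>X Y. loc (In2 A X Y),
     Pr1 = \<lambda>X Y. loc (Pr1 A X Y), Pr2 = \<lambda>X Y. loc (Pr2 A X Y)\<rparr>"

lemma gz_addcat_simps [simp]:
  "Ob gz_addcat = Ob A" "Arr gz_addcat = Arr L" "Dom gz_addcat = Dom L" "Cod gz_addcat = Cod L"
  "Ident gz_addcat = Ident L" "Comp gz_addcat = Comp L" "Add gz_addcat = gz_add_arr"
  "ZeroArr gz_addcat = (\<lambda>X Y. loc (ZeroArr A X Y))" "ZeroOb gz_addcat = ZeroOb A" "DSum gz_addcat = DSum A"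
  "In1 gz_addcat = (\<lambda>X Y. loc (In1 A X Y))" "In2 gz_addcat = (\<lambda>X Y. loc (In2 A X Y))"
  "Pr1 gz_addcat = (\<lambda>X Y. loc (Pr1 A X Y))" "Pr2 gz_addcat = (\<lambda>X Y. loc (Pr2 A X Y))"
  by (simp_all add: gz_addcat_def)

lemma gz_addcat_Hom [simp]: "Hom gz_addcat X Y = Hom L X Y"
  by (simp add: Hom_def)

lemma loc_Add:
  assumes "a \<in> Arr A" "b \<in> Arr A" "Dom A a = Dom A b" "Cod A a = Cod A b"
  shows "gz_add_arr (loc a) (loc b) = loc (Add A a b)"
  using gz_add_arr_loc[of "Ident L (Dom A a)" a b] assms by simp

text \<open>All the group axioms are pulled back from \<open>A\<close>: arrows with the same source and target are
  of the form \<open>Comp L (loc a) u\<close> for a common \<open>u\<close>.\<close>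

lemma gz_addcat_hom_group:
  assumes XY: "X \<in> Ob A" "Y \<in> Ob A"
  shows "comm_group (hom_group gz_addcat X Y)"
proof (rule comm_groupI; unfold hom_group_def; simp)
  show "loc (ZeroArr A X Y) \<in> Hom L X Y" using XY by (simp add: Hom_def)
next
  fix f g assume fg: "f \<in> Hom L X Y" "g \<in> Hom L X Y"
  then have [simp]: "f \<in> Arr L" "Dom L f = X" "Cod L f = Y" "g \<in> Arr L" "Dom L g = X" "Cod L g = Y"
    by (auto simp: Hom_def)
  note [simp] = XY
  show "gz_add_arr f g \<in> Hom L X Y" by (simp add: Hom_def)
  show "gz_add_arr f g = gz_add_arr g f"
    using gz_add_arr_loc[of "pair f g" "Pr1 A Y Y" "Pr2 A Y Y"] gz_add_arr_loc[of "pair f g" "Pr2 A Y Y" "Pr1 A Y Y"]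
    by (simp add: Add_comm_Arr)
  fix h assume "h \<in> Hom L X Y"
  then have [simp]: "h \<in> Arr L" "Dom L h = X" "Cod L h = Y" by (auto simp: Hom_def)
  define u where "u = pair f (pair g h)"
  have [simp]: "u \<in> Arr L" "Dom L u = X" "Cod L u = DSum A Y (DSum A Y Y)" by (simp_all add: u_def)
  let ?p1 = "Pr1 A Y (DSum A Y Y)" and ?p2 = "Comp A (Pr1 A Y Y) (Pr2 A Y (DSum A Y Y))"
    and ?p3 = "Comp A (Pr2 A Y Y) (Pr2 A Y (DSum A Y Y))"
  have e: "Comp L (loc ?p1) u = f" "Comp L (loc ?p2) u = g" "Comp L (loc ?p3) u = h"
    by (simp_all add: loc_Comp'[symmetric] u_def)
  have "gz_add_arr (gz_add_arr (Comp L (loc ?p1) u) (Comp L (loc ?p2) u)) (Comp L (loc ?p3) u)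
      = gz_add_arr (Comp L (loc ?p1) u) (gz_add_arr (Comp L (loc ?p2) u) (Comp L (loc ?p3) u))"
    by (simp add: gz_add_arr_loc)
  then show "gz_add_arr (gz_add_arr f g) h = gz_add_arr f (gz_add_arr g h)" unfolding e .
next
  fix f assume "f \<in> Hom L X Y"
  then have [simp]: "f \<in> Arr L" "Dom L f = X" "Cod L f = Y" by (auto simp: Hom_def)
  note [simp] = XY
  have z: "Comp L (loc (ZeroArr A Y Y)) f = loc (ZeroArr A X Y)"
    using loc_Zero_Comp[of f] by simp
  show "gz_add_arr (loc (ZeroArr A X Y)) f = f"
    using gz_add_arr_loc[of f "ZeroArr A Y Y" "Ident A Y"] z by (simp add: loc_Ident)
  show "\<exists>g \<in> Hom L X Y. gz_add_arr g f = loc (ZeroArr A X Y)"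
    using gz_add_arr_loc[of f "neg A (Ident A Y)" "Ident A Y"] z
    by (intro bexI[of _ "Comp L (loc (neg A (Ident A Y))) f"]) (simp_all add: loc_Ident Hom_def)
qed

theorem gz_addcat_additive: "additive_category gz_addcat"
proof (intro additive_category.intro category.intro additive_category_axioms.intro, goal_cases)
  case 1 then show ?case by (simp)
next case 2 then show ?case by simp
next case 3 then show ?case by (simp add: L.Ident_Hom)
next case 4 then show ?case by (auto intro: L.Comp_Hom)
next case 5 then show ?case by (auto intro: L.Comp_Ident)
next case 6 then show ?case by (auto intro: L.Ident_Comp)
next case 7 then show ?case by (auto intro: L.Comp_assoc)
next case 8 then show ?case by (simp add: gz_addcat_hom_group)
next case 9 then show ?case by (simp add: gz_add_arr_Comp_right Hom_def)
next case (10 f X Y f' g Z) then show ?case using gz_add_arr_Comp_left[of g] by (simp add: Hom_def del: split_paired_All)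
next
  case 11
  have "\<exists>!f. f \<in> Hom L X (ZeroOb A)" if X: "X \<in> Ob A" for X
  proof (rule ex1I[of _ "loc (ZeroArr A X (ZeroOb A))"])
    fix f assume "f \<in> Hom L X (ZeroOb A)"
    then have [simp]: "f \<in> Arr L" "Dom L f = X" "Cod L f = ZeroOb A" by (auto simp: Hom_def)
    \<comment> \<open>The identity of the zero object of \<open>A\<close> is a zero arrow, and its
      image is the identity in \<open>L\<close>.\<close>
    have "f = Comp L (loc (Ident A (ZeroOb A))) f" by (simp add: loc_Ident)
    then show "f = loc (ZeroArr A X (ZeroOb A))" using loc_Zero_Comp[of f] by (simp add: ZeroOb_Ident)
  qed (use X in \<open>simp add: Hom_def\<close>)
  moreover have "\<exists>!f. f \<in> Hom L (ZeroOb A) X" if X: "X \<in> Ob A" for X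
  proof (rule ex1I[of _ "loc (ZeroArr A (ZeroOb A) X)"])
    fix f assume "f \<in> Hom L (ZeroOb A) X"
    then have [simp]: "f \<in> Arr L" "Dom L f = ZeroOb A" "Cod L f = X" by (auto simp: Hom_def)
    have "f = Comp L f (loc (Ident A (ZeroOb A)))" by (simp add: loc_Ident)
    then show "f = loc (ZeroArr A (ZeroOb A) X)" using loc_Zero_from[of f] by (simp add: ZeroOb_Ident)
  qed (use X in \<open>simp add: Hom_def\<close>)
  ultimately show ?case by (simp add: zero_object_def)
qed (simp_all add: Hom_def loc_Comp loc_Ident loc_Add In_Pr_sum)

end

section \<open>Strict additive functors\<close>

text \<open>Sums and zero objects are preserved as equalities, so that the induced map on complexes
  commutes with cones and with complexes in degree \<open>0\<close> as an equality of
  complexes.\<close>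

locale strict_additive_functor =
  A: additive_category A + B: additive_category B + is_functor A B F
  for A :: "('o, 'm, 'x) addcat_scheme" and B :: "('p, 'n, 'y) addcat_scheme" and F :: "('o, 'm, 'p, 'n) fctr" +
  assumes F_Add: "f \<in> Hom A X Y \<Longrightarrow> g \<in> Hom A X Y \<Longrightarrow> ArrMap F (Add A f g) = Add B (ArrMap F f) (ArrMap F g)"
    and F_Zero: "X \<in> Ob A \<Longrightarrow> Y \<in> Ob A \<Longrightarrow> ArrMap F (ZeroArr A X Y) = ZeroArr B (ObMap F X) (ObMap F Y)"
    and F_ZeroOb: "ObMap F (ZeroOb A) = ZeroOb B"
    and F_DSum: "X \<in> Ob A \<Longrightarrow> Y \<in> Ob A \<Longrightarrow> ObMap F (DSum A X Y) = DSum B (ObMap F X) (ObMap F Y)"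
    and F_In1: "X \<in> Ob A \<Longrightarrow> Y \<in> Ob A \<Longrightarrow> ArrMap F (In1 A X Y) = In1 B (ObMap F X) (ObMap F Y)"
    and F_In2: "X \<in> Ob A \<Longrightarrow> Y \<in> Ob A \<Longrightarrow> ArrMap F (In2 A X Y) = In2 B (ObMap F X) (ObMap F Y)"
    and F_Pr1: "X \<in> Ob A \<Longrightarrow> Y \<in> Ob A \<Longrightarrow> ArrMap F (Pr1 A X Y) = Pr1 B (ObMap F X) (ObMap F Y)"
    and F_Pr2: "X \<in> Ob A \<Longrightarrow> Y \<in> Ob A \<Longrightarrow> ArrMap F (Pr2 A X Y) = Pr2 B (ObMap F X) (ObMap F Y)"
begin

lemma F_Add_simp:
  assumes "f \<in> Arr A" "g \<in> Arr A" "Dom A f = Dom A g" "Cod A f = Cod A g"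
  shows "ArrMap F (Add A f g) = Add B (ArrMap F f) (ArrMap F g)"
  using F_Add[of f "Dom A f" "Cod A f" g] assms by (simp add: Hom_def)

lemma F_neg: "f \<in> Arr A \<Longrightarrow> ArrMap F (neg A f) = neg B (ArrMap F f)"
  using F_Add_simp[of f "neg A f"] F_Zero[of "Dom A f" "Cod A f"]
  by (intro B.neg_unique[of _ "ObMap F (Dom A f)" "ObMap F (Cod A f)"]) (simp_all add: Hom_def)

lemma F_zero_object:
  assumes "zero_object A X" shows "zero_object B (ObMap F X)"
proof -
  have X: "X \<in> Ob A" using assms by (simp add: zero_object_def)
  then show ?thesis
    using A.zero_object_Ident[OF assms] F_Zero[OF X X] ArrMap_Ident[OF X] ObMap_Ob
    by (intro B.zero_objectI) simp_all
qed

lemmas F_simps = F_Add_simp F_neg F_Zero F_ZeroOb F_DSum F_In1 F_In2 F_Pr1 F_Pr2 ArrMap_Ident ArrMap_Comp_simp ObMap_Ob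

section \<open>The induced functor between homotopy categories\<close>

definition map_cplx :: "('o, 'm) cplx \<Rightarrow> ('p, 'n) cplx" where
  "map_cplx X = \<lparr>COb = \<lambda>i. ObMap F (COb X i), Diff = \<lambda>i. ArrMap F (Diff X i)\<rparr>"

lemma map_cplx_simps [simp]:
  "COb (map_cplx X) i = ObMap F (COb X i)" "Diff (map_cplx X) i = ArrMap F (Diff X i)"
  by (simp_all add: map_cplx_def)

lemma map_cplx_complex: "is_complex A X \<Longrightarrow> is_complex B (map_cplx X)"
  using ArrMap_Comp_simp[of "Diff X _" "Diff X (_ + 1)", symmetric]
  by (intro B.is_complexI) (simp_all add: F_simps(3) ObMap_Ob)

lemma map_cplx_bounded:
  assumes "bounded_complex A X" shows "bounded_complex B (map_cplx X)"
proof -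
  obtain m where "\<And>i. \<bar>i\<bar> > m \<Longrightarrow> zero_object A (COb X i)" using assms unfolding bounded_complex_def by blast
  then have "\<bar>i\<bar> > m \<longrightarrow> zero_object B (COb (map_cplx X) i)" for i using F_zero_object by simp
  then show ?thesis using assms map_cplx_complex[of X] unfolding bounded_complex_def by blast
qed

lemma map_chain_map:
  assumes X: "is_complex A X" and Y: "is_complex A Y" and f: "chain_map A X Y f"
  shows "chain_map B (map_cplx X) (map_cplx Y) (\<lambda>i. ArrMap F (f i))"
proof (rule B.chain_mapI)
  note [simp] = X Y A.chain_mapD[OF f]
  fix i
  show "ArrMap F (f i) \<in> Arr B" "Dom B (ArrMap F (f i)) = COb (map_cplx X) i" "Cod B (ArrMap F (f i)) = COb (map_cplx Y) i"
    by simp_all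
  have "ArrMap F (Comp A (Diff Y i) (f i)) = ArrMap F (Comp A (f (i + 1)) (Diff X i))"
    by simp
  then show "Comp B (Diff (map_cplx Y) i) (ArrMap F (f i)) = Comp B (ArrMap F (f (i + 1))) (Diff (map_cplx X) i)"
    by (simp add: ArrMap_Comp_simp del: A.chain_mapD(4)[OF f])
qed

lemma map_nullhtp:
  assumes X: "is_complex A X" and Y: "is_complex A Y" and h: "A.nullhtp X Y f h"
  shows "B.nullhtp (map_cplx X) (map_cplx Y) (\<lambda>i. ArrMap F (f i)) (\<lambda>i. ArrMap F (h i))"
proof -
  note [simp] = X Y A.nullhtpD(1-3)[OF h]
  show ?thesis by (rule B.nullhtpI) (simp_all add: A.nullhtpD(4)[OF h] F_simps)
qed

lemma map_homotopic:
  assumes X: "is_complex A X" and Y: "is_complex A Y" and f: "chain_map A X Y f" and g: "chain_map A X Y g"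
    and "homotopic A X Y f g"
  shows "homotopic B (map_cplx X) (map_cplx Y) (\<lambda>i. ArrMap F (f i)) (\<lambda>i. ArrMap F (g i))"
proof -
  obtain h where h: "A.nullhtp X Y (\<lambda>i. Add A (f i) (neg A (g i))) h"
    using A.homotopicE_nullhtp[OF assms] .
  note [simp] = A.chain_mapD(1-3)[OF f] A.chain_mapD(1-3)[OF g]
  show ?thesis
    using map_nullhtp[OF X Y h]
    by (intro B.homotopicI_nullhtp[OF map_cplx_complex[OF X] map_cplx_complex[OF Y]
      map_chain_map[OF X Y f] map_chain_map[OF X Y g]]) (simp add: F_simps)
qed

text \<open>An arrow of \<open>Kb A\<close> is a set of homotopic chain maps, and some
  representative is mapped; \<open>Kb_map_ArrMap\<close> shows that the choice does not
  matter.\<close>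

definition Kb_map :: "(('o, 'm) cplx, ('o, 'm) ho_arr, ('p, 'n) cplx, ('p, 'n) ho_arr) fctr" where
  "Kb_map = \<lparr>ObMap = map_cplx,
     ArrMap = \<lambda>(X, Y, c). ho_class B (map_cplx X) (map_cplx Y) (\<lambda>i. ArrMap F ((SOME f. f \<in> c) i))\<rparr>"

lemma Kb_map_ObMap: "ObMap Kb_map X = map_cplx X"
  by (simp add: Kb_map_def)

lemma Kb_map_ArrMap:
  assumes X: "is_complex A X" and Y: "is_complex A Y" and f: "chain_map A X Y f"
  shows "ArrMap Kb_map (ho_class A X Y f) = ho_class B (map_cplx X) (map_cplx Y) (\<lambda>i. ArrMap F (f i))"
proof -
  let ?c = "{g. chain_map A X Y g \<and> homotopic A X Y f g}"
  let ?g = "SOME g. g \<in> ?c"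
  have "f \<in> ?c" using f A.homotopic_refl[OF X Y f] by simp
  then have g: "chain_map A X Y ?g" "homotopic A X Y f ?g" using someI[of "\<lambda>g. g \<in> ?c" f] by simp_all
  have "ho_class B (map_cplx X) (map_cplx Y) (\<lambda>i. ArrMap F (f i)) = ho_class B (map_cplx X) (map_cplx Y) (\<lambda>i. ArrMap F (?g i))"
    using map_homotopic[OF X Y f g]
    by (subst B.ho_class_eq_iff[OF map_cplx_complex[OF X] map_cplx_complex[OF Y] map_chain_map[OF X Y f] map_chain_map[OF X Y g(1)]])
  then show ?thesis by (simp add: Kb_map_def ho_class_def)
qed

theorem Kb_map_functor: "is_functor (Kb A) (Kb B) Kb_map"
proof (intro is_functor.intro is_functor_axioms.intro A.Kb_category B.Kb_category)
  fix X assume "X \<in> Ob (Kb A)"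
  then have X: "bounded_complex A X" by (simp add: A.Kb_Ob_iff)
  then show "ObMap Kb_map X \<in> Ob (Kb B)" by (simp add: B.Kb_Ob_iff Kb_map_def map_cplx_bounded)
  show "ArrMap Kb_map (Ident (Kb A) X) = Ident (Kb B) (ObMap Kb_map X)"
    using X Kb_map_ArrMap[OF _ _ A.chain_map_Ident, of X]
    by (simp add: A.Kb_Ident B.Kb_Ident ArrMap_Ident) (simp add: Kb_map_def)
next
  fix f X Y assume "f \<in> Hom (Kb A) X Y"
  then obtain u where u: "bounded_complex A X" "bounded_complex A Y" "chain_map A X Y u" "f = ho_class A X Y u"
    by (auto simp: A.Kb_Hom_iff)
  then show "ArrMap Kb_map f \<in> Hom (Kb B) (ObMap Kb_map X) (ObMap Kb_map Y)"
    using Kb_map_ArrMap[of X Y u] map_chain_map[of X Y u] map_cplx_bounded[of X] map_cplx_bounded[of Y]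
    by (auto simp: B.Kb_Hom_iff Kb_map_def)
next
  fix f X Y g Z assume "f \<in> Hom (Kb A) X Y" "g \<in> Hom (Kb A) Y Z"
  then obtain u v where C: "bounded_complex A X" "bounded_complex A Y" "bounded_complex A Z"
    and u: "chain_map A X Y u" "f = ho_class A X Y u" and v: "chain_map A Y Z v" "g = ho_class A Y Z v"
    by (auto simp: A.Kb_Hom_iff)
  note [simp] = A.chain_mapD(1-3)[OF u(1)] A.chain_mapD(1-3)[OF v(1)]
  have [simp]: "is_complex A X" "is_complex A Y" "is_complex A Z" using C by simp_all
  show "ArrMap Kb_map (Comp (Kb A) g f) = Comp (Kb B) (ArrMap Kb_map g) (ArrMap Kb_map f)"
    using A.Kb_Comp[OF _ _ _ u(1) v(1)] A.chain_map_Comp[OF _ _ _ u(1) v(1)] Kb_map_ArrMap[OF _ _ u(1)] Kb_map_ArrMap[OF _ _ v(1)]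
      Kb_map_ArrMap[of X Z "\<lambda>i. Comp A (v i) (u i)"]
      B.Kb_Comp[OF _ _ _ map_chain_map[OF _ _ u(1)] map_chain_map[OF _ _ v(1)]]
    by (simp add: u(2) v(2) map_cplx_complex ArrMap_Comp_simp)
qed

lemma map_shift: "is_complex A X \<Longrightarrow> map_cplx (shift A n X) = shift B n (map_cplx X)"
  by (auto simp: map_cplx_def shift_def fun_eq_iff F_simps)

lemma map_cone:
  assumes X: "is_complex A X" and Y: "is_complex A Y" and f: "chain_map A X Y f"
  shows "map_cplx (cone A X Y f) = cone B (map_cplx X) (map_cplx Y) (\<lambda>i. ArrMap F (f i))"
  using assms A.chain_mapD(1-3)[OF f]
  by (auto simp: map_cplx_def cone_def fun_eq_iff F_simps)

lemma map_stalk: "X \<in> Ob A \<Longrightarrow> map_cplx (stalk A X) = stalk B (ObMap F X)"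
  by (auto simp: map_cplx_def stalk_def fun_eq_iff F_simps)

lemma map_stalk_map: "f \<in> Arr A \<Longrightarrow> (\<lambda>i. ArrMap F (stalk_map A f i)) = stalk_map B (ArrMap F f)"
  by (auto simp: stalk_map_def fun_eq_iff F_simps)

text \<open>The preimage of the contractible complexes inherits the closure properties, since
  \<open>map_cplx\<close> commutes with shifts and cones and \<open>Kb_map\<close> preserves
  isomorphisms.\<close>

lemma contractible_map_strict_triangulated:
  "strict_triangulated A {X. bounded_complex A X \<and> B.contractible (map_cplx X)}" (is "strict_triangulated A ?P")
proof (rule strict_triangulatedI)
  note T = strict_triangulatedD[OF B.contractible_strict_triangulated]
  interpret K: is_functor "Kb A" "Kb B" Kb_map by (rule Kb_map_functor)
  show "?P \<subseteq> Ob (Kb A)" by (auto simp: A.Kb_Ob_iff)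
  show "Z \<in> ?P" if z: "zero_object (Kb A) Z" for Z
  proof -
    have Z: "bounded_complex A Z" using z by (simp add: zero_object_def A.Kb_Ob_iff)
    then have Z': "is_complex A Z" by simp
    obtain h where "A.nullhtp Z Z (\<lambda>i. Ident A (COb Z i)) h" using A.Kb_zero_object_nullhtp[OF z] .
    from map_nullhtp[OF Z' Z' this] show ?thesis
      using Z Z' unfolding B.contractible_def by (auto simp: ArrMap_Ident)
  qed
  have m: "map_cplx X \<in> {Z. bounded_complex B Z \<and> B.contractible Z}" if "X \<in> ?P" for X
    using that map_cplx_bounded by simp
  show "Y \<in> ?P" if X: "X \<in> ?P" and Y: "Y \<in> Ob (Kb A)" and XY: "isomorphic (Kb A) X Y" for X Y
  proof -
    obtain f where f: "f \<in> Hom (Kb A) X Y" "is_iso (Kb A) f" using XY unfolding isomorphic_def by blast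
    then have "isomorphic (Kb B) (map_cplx X) (map_cplx Y)"
      using K.ArrMap_Hom[OF f(1)] K.ArrMap_is_iso[OF f(2)] HomD[OF f(1)]
      unfolding isomorphic_def Kb_map_ObMap by blast
    moreover have "map_cplx Y \<in> Ob (Kb B)" using K.ObMap_Ob[OF Y] by (simp add: Kb_map_ObMap)
    ultimately show ?thesis using T(2)[OF m[OF X]] Y by (simp add: A.Kb_Ob_iff)
  qed
  show "shift A n X \<in> ?P" if X: "X \<in> ?P" for X n
    using T(3)[OF m[OF X], of n] X map_shift[of X n] A.shift_bounded[of X n] by simp
  show "cone A X Y f \<in> ?P" if XY: "X \<in> ?P" "Y \<in> ?P" and f: "chain_map A X Y f" for X Y f
    using T(4)[OF m[OF XY(1)] m[OF XY(2)] map_chain_map[OF _ _ f]] XY map_cone[OF _ _ f] A.cone_bounded[OF _ _ f]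
    by simp
qed

text \<open>\<open>F\<close> makes the cones of elements of \<open>S\<close> contractible, hence by
  minimality all of \<open>cone_subcat\<close>; a map with contractible cone is an isomorphism in
  the homotopy category.\<close>

lemma Kb_map_inverts:
  assumes S: "S \<subseteq> Arr A" "\<And>s. s \<in> S \<Longrightarrow> is_iso B (ArrMap F s)" and w: "w \<in> cone_in A (cone_subcat A S)"
  shows "is_iso (Kb B) (ArrMap Kb_map w)"
proof -
  have "cone A (stalk A (Dom A s)) (stalk A (Cod A s)) (stalk_map A s) \<in> {X. bounded_complex A X \<and> B.contractible (map_cplx X)}"
    if s: "s \<in> S" for s
  proof -
    have s': "s \<in> Hom A (Dom A s) (Cod A s)" using s S by (auto simp: Hom_def)
    note O = A.Hom_Ob[OF s']
    have "bounded_complex A (cone A (stalk A (Dom A s)) (stalk A (Cod A s)) (stalk_map A s))"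
      using A.cone_bounded A.stalk_bounded A.stalk_chain_map[OF s'] O by blast
    moreover have "B.contractible (cone B (stalk B (ObMap F (Dom A s))) (stalk B (ObMap F (Cod A s))) (stalk_map B (ArrMap F s)))"
      by (rule B.iso_cone_contractible[OF ArrMap_Hom[OF s'] S(2)[OF s]])
    ultimately show ?thesis
      using O s' map_cone[OF _ _ A.stalk_chain_map[OF s']] by (auto simp: map_stalk map_stalk_map Hom_def)
  qed
  then have "cone_subcat A S \<subseteq> {X. bounded_complex A X \<and> B.contractible (map_cplx X)}"
    unfolding cone_subcat_def using contractible_map_strict_triangulated by blast
  with w obtain X Y f where f: "w = ho_class A X Y f" "bounded_complex A X" "bounded_complex A Y" "chain_map A X Y f"
    "B.contractible (map_cplx (cone A X Y f))"
    unfolding cone_in_def by blast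
  then show ?thesis
    using B.cone_contractible_iso[OF map_cplx_bounded map_cplx_bounded map_chain_map, of X Y f]
    by (simp add: Kb_map_ArrMap map_cone)
qed

end

section \<open>The natural functor is full and faithful\<close>

context additive_localization
begin

text \<open>The matrix with rows \<open>(1, 0)\<close> and \<open>(g, d)\<close> is the product of a transvection and \<open>1 \<oplus> d\<close>.\<close>

lemma loc_triangular_iso:
  assumes g: "g \<in> Hom A U R" and d: "d \<in> Hom A P R" and i: "is_iso L (loc d)"
  shows "is_iso L (loc (Add A (Comp A (In1 A U R) (Pr1 A U P))
    (Comp A (In2 A U R) (Add A (Comp A g (Pr1 A U P)) (Comp A d (Pr2 A U P))))))"
proof -
  have [simp]: "U \<in> Ob A" "R \<in> Ob A" "P \<in> Ob A" "g \<in> Arr A" "Dom A g = U" "Cod A g = R" "d \<in> Arr A" "Dom A d = P" "Cod A d = R"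
    using g d Hom_Ob[OF g] Hom_Ob[OF d] by (auto simp: Hom_def)
  let ?E = "Add A (Ident A (DSum A U R)) (Comp A (In2 A U R) (Comp A g (Pr1 A U R)))"
  have "is_iso L (sum_left U (loc d))"
    unfolding sum_left_def by (rule is_functor.ArrMap_is_iso[OF sum_functor(2) i]) simp_all
  then have "is_iso L (loc (dsum_arr A (Ident A U) d))" by (simp add: sum_functor)
  moreover have "is_iso L (loc ?E)"
    by (rule P.ArrMap_is_iso[OF transvection_iso[OF g]]) simp
  moreover have "Comp A ?E (dsum_arr A (Ident A U) d)
    = Add A (Comp A (In1 A U R) (Pr1 A U P)) (Comp A (In2 A U R) (Add A (Comp A g (Pr1 A U P)) (Comp A d (Pr2 A U P))))"
    by (rule DSum_eqI[of U R]) (simp_all add: Add_ac)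
  moreover have "loc (Comp A ?E (dsum_arr A (Ident A U) d)) = Comp L (loc ?E) (loc (dsum_arr A (Ident A U) d))"
    by (rule loc_Comp[symmetric]) simp_all
  ultimately show ?thesis
    using L.is_iso_Comp[of "loc (dsum_arr A (Ident A U) d)" "loc ?E" "DSum A U P" "DSum A U R" "DSum A U R"]
    by (simp add: Hom_def)
qed

sublocale V: localization "Kb A" "cone_in A (cone_subcat A S)"
  by (intro localization.intro localization_axioms.intro Kb_category cone_in_Arr)

section \<open>Chain maps in the Verdier quotient and the values of the natural functor\<close>

abbreviation "V \<equiv> gz (Kb A) (cone_in A (cone_subcat A S))"

definition kq :: "('o, 'm) cplx \<Rightarrow> ('o, 'm) cplx \<Rightarrow> (int \<Rightarrow> 'm) \<Rightarrow> (('o, 'm) cplx, ('o, 'm) ho_arr) gz_arr" where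
  "kq X Y f = V.loc (ho_class A X Y f)"

lemma kq_Hom:
  assumes "bounded_complex A X" "bounded_complex A Y" "chain_map A X Y f"
  shows "kq X Y f \<in> Hom V X Y"
proof -
  have "ho_class A X Y f \<in> Hom (Kb A) X Y" using assms by (auto simp: Kb_Hom_iff)
  from V.P.ArrMap_Hom[OF this] show ?thesis by (simp add: kq_def)
qed

lemma kq_simps [simp]:
  assumes "bounded_complex A X" "bounded_complex A Y" "chain_map A X Y f"
  shows "kq X Y f \<in> Arr V" "Dom V (kq X Y f) = X" "Cod V (kq X Y f) = Y"
  using kq_Hom[OF assms] by (auto simp: Hom_def)

lemma kq_Comp:
  assumes "bounded_complex A X" "bounded_complex A Y" "bounded_complex A Z" "chain_map A X Y f" "chain_map A Y Z g"
  shows "Comp V (kq Y Z g) (kq X Y f) = kq X Z (\<lambda>i. Comp A (g i) (f i))"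
proof -
  have "ho_class A X Y f \<in> Hom (Kb A) X Y" "ho_class A Y Z g \<in> Hom (Kb A) Y Z" using assms by (auto simp: Kb_Hom_iff)
  from V.P.ArrMap_Comp[OF this] show ?thesis
    unfolding kq_def using Kb_Comp[OF _ _ _ assms(4,5)] assms by simp
qed

lemma kq_eqI:
  assumes "is_complex A X" "is_complex A Y" "chain_map A X Y f" "chain_map A X Y g" "homotopic A X Y f g"
  shows "kq X Y f = kq X Y g"
  unfolding kq_def using assms ho_class_eq_iff[OF assms(1-4)] by simp

lemma kq_Ident: "bounded_complex A X \<Longrightarrow> kq X X (\<lambda>i. Ident A (COb X i)) = Ident V X"
  using V.loc_Ident[of X] by (simp add: kq_def Kb_Ident Kb_Ob_iff)

lemma kq_iso:
  assumes "bounded_complex A X" "bounded_complex A Y" "chain_map A X Y f" "cone A X Y f \<in> cone_subcat A S"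
  shows "is_iso V (kq X Y f)"
proof -
  have "ho_class A X Y f \<in> cone_in A (cone_subcat A S)" unfolding cone_in_def using assms by blast
  from V.gz_loc_inverts[OF V.S_Arr this] show ?thesis by (simp add: kq_def)
qed

abbreviation "Q \<equiv> gz_to_gz_add A S"

lemma Q_functor: "is_functor L (gz_add A S) Q"
  by (rule gz_to_gz_add_functor(1)[OF S_sub])

lemma gz_add_ops:
  "Ident (gz_add A S) = Ident V" "Comp (gz_add A S) = Comp V" "Dom (gz_add A S) = Dom V" "Cod (gz_add A S) = Cod V"
  by (simp_all add: gz_add_def full_subcat_def verdier_quotient_def)

lemma Q_ObMap: "ObMap Q X = stalk A X"
  by (simp add: gz_to_gz_add_def gz_lift_def gz_add_loc_def fcomp_def gz_loc_def Kb_embed_def)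

lemma Q_Hom: "\<theta> \<in> Hom L X Y \<Longrightarrow> ArrMap Q \<theta> \<in> Hom V (stalk A X) (stalk A Y)"
  using is_functor.ArrMap_Hom[OF Q_functor, of \<theta> X Y] by (simp add: Q_ObMap gz_add_Hom_iff verdier_quotient_def)

lemma Q_Comp: "\<theta> \<in> Hom L X Y \<Longrightarrow> \<eta> \<in> Hom L Y Z \<Longrightarrow> ArrMap Q (Comp L \<eta> \<theta>) = Comp V (ArrMap Q \<eta>) (ArrMap Q \<theta>)"
  using is_functor.ArrMap_Comp[OF Q_functor] by (simp add: gz_add_ops)

lemma Q_Ident: "X \<in> Ob A \<Longrightarrow> ArrMap Q (Ident L X) = Ident V (stalk A X)"
  using is_functor.ArrMap_Ident[OF Q_functor, of X] by (simp add: gz_add_ops Q_ObMap)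

lemma Q_loc:
  assumes "f \<in> Hom A X Y" shows "ArrMap Q (loc f) = kq (stalk A X) (stalk A Y) (stalk_map A f)"
  using gz_to_gz_add_functor(2)[OF S_sub] HomD[OF assms]
  by (simp add: feq_def fcomp_def gz_add_loc_ArrMap kq_def Kb_embed_def)

text \<open>A chain map to the stalk complex only if \<open>Z\<close> vanishes in degree \<open>-1\<close>.\<close>

definition deg0 :: "('o, 'm) cplx \<Rightarrow> int \<Rightarrow> 'm" where
  "deg0 Z = (\<lambda>i. if i = 0 then Ident A (COb Z 0) else ZeroArr A (COb Z i) (ZeroOb A))"

definition points :: "'o \<Rightarrow> (('o, 'm) cplx \<times> (('o, 'm) cplx, ('o, 'm) ho_arr) gz_arr) set" where
  "points X = {(Z, \<phi>). bounded_complex A Z \<and> (\<forall>i < 0. zero_object A (COb Z i)) \<and> \<phi> \<in> Hom V (stalk A X) Z \<and>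
     Comp V (kq Z (stalk A (COb Z 0)) (deg0 Z)) \<phi> \<in> ArrMap Q ` Hom L X (COb Z 0)}"

definition refines :: "('o, 'm) cplx \<times> (('o, 'm) cplx, ('o, 'm) ho_arr) gz_arr \<Rightarrow>
    ('o, 'm) cplx \<times> (('o, 'm) cplx, ('o, 'm) ho_arr) gz_arr \<Rightarrow> (int \<Rightarrow> 'm) \<Rightarrow> bool" where
  "refines p' p r \<longleftrightarrow> chain_map A (fst p') (fst p) r \<and> Comp V (kq (fst p') (fst p) r) (snd p') = snd p"

lemma pointsD:
  assumes "(Z, \<phi>) \<in> points X"
  shows "bounded_complex A Z" "is_complex A Z" "i < 0 \<Longrightarrow> zero_object A (COb Z i)" "\<phi> \<in> Hom V (stalk A X) Z"
    "\<phi> \<in> Arr V" "Dom V \<phi> = stalk A X" "Cod V \<phi> = Z"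
    "Comp V (kq Z (stalk A (COb Z 0)) (deg0 Z)) \<phi> \<in> ArrMap Q ` Hom L X (COb Z 0)"
  using assms by (auto simp: points_def Hom_def)

lemma deg0_chain_map:
  assumes "is_complex A Z" "zero_object A (COb Z (-1))"
  shows "chain_map A Z (stalk A (COb Z 0)) (deg0 Z)"
  unfolding deg0_def by (rule to_stalk_chain_map) (use assms in \<open>simp_all add: Hom_def\<close>)

lemma refinement_points: "refinement A (points X) fst refines"
proof
  fix p p' p'' :: "('o, 'm) cplx \<times> (('o, 'm) cplx, ('o, 'm) ho_arr) gz_arr" and r r'
  assume p: "p \<in> points X"
  obtain Z \<phi> where p_def: "p = (Z, \<phi>)" by (cases p)
  note Z = pointsD[OF p[unfolded p_def]]
  show "is_complex A (fst p)" using Z by (simp add: p_def)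
  show "refines p p (\<lambda>i. Ident A (COb (fst p) i))"
    using Z chain_map_Ident by (simp add: p_def refines_def kq_Ident)
  assume p': "p' \<in> points X" and r: "refines p' p r"
  then show "chain_map A (fst p') (fst p) r" by (simp add: refines_def)
  assume p'': "p'' \<in> points X" and r': "refines p'' p' r'"
  obtain Z' \<phi>' where p'_def: "p' = (Z', \<phi>')" by (cases p')
  note Z' = pointsD[OF p'[unfolded p'_def]]
  obtain Z'' \<phi>'' where p''_def: "p'' = (Z'', \<phi>'')" by (cases p'')
  note Z'' = pointsD[OF p''[unfolded p''_def]]
  have c: "chain_map A Z' Z r" "chain_map A Z'' Z' r'" using r r' by (simp_all add: refines_def p_def p'_def p''_def)
  have "Comp V (Comp V (kq Z' Z r) (kq Z'' Z' r')) \<phi>'' = \<phi>"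
    using r r' c Z Z' Z'' by (simp add: refines_def p_def p'_def p''_def)
  then show "refines p'' p (\<lambda>i. Comp A (r i) (r' i))"
    using c Z Z' Z'' chain_map_Comp[OF Z''(2) Z'(2) Z(2) c(2,1)]
    by (simp add: refines_def p_def p'_def p''_def kq_Comp)
qed

lemma cone_subcat_closed:
  "Z \<in> cone_subcat A S \<Longrightarrow> shift A n Z \<in> cone_subcat A S"
  "Z \<in> cone_subcat A S \<Longrightarrow> Z' \<in> Ob (Kb A) \<Longrightarrow> isomorphic (Kb A) Z Z' \<Longrightarrow> Z' \<in> cone_subcat A S"
  "s \<in> S \<Longrightarrow> cone A (stalk A (Dom A s)) (stalk A (Cod A s)) (stalk_map A s) \<in> cone_subcat A S"
  unfolding cone_subcat_def using strict_triangulatedD(2,3)[of A] by blast+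

text \<open>The differential is \<open>s\<close> preceded by the removal and followed by the
  insertion of a zero summand, all of which become isomorphisms.\<close>

lemma loc_stalk_cone_Diff_iso:
  assumes s: "s \<in> S"
  shows "is_iso L (loc (Diff (cone A (stalk A (Dom A s)) (stalk A (Cod A s)) (stalk_map A s)) (-1)))"
proof -
  have [simp]: "s \<in> Arr A" using s S_sub by blast
  then have s': "s \<in> Hom A (Dom A s) (Cod A s)" by (simp add: Hom_def)
  have "is_iso L (loc (Pr1 A (Dom A s) (ZeroOb A)))" "is_iso L (loc (In2 A (ZeroOb A) (Cod A s)))"
    by (rule P.ArrMap_is_iso; simp add: zero_summand_iso[OF zero_object_ZeroOb])+
  then have "is_iso L (Comp L (loc (In2 A (ZeroOb A) (Cod A s))) (Comp L (loc s) (loc (Pr1 A (Dom A s) (ZeroOb A)))))"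
    using gz_loc_inverts[OF S_sub s]
    by (intro L.is_iso_Comp[where X = "DSum A (Dom A s) (ZeroOb A)" and Y = "Cod A s" and Z = "DSum A (ZeroOb A) (Cod A s)"]
      L.is_iso_Comp[where X = "DSum A (Dom A s) (ZeroOb A)" and Y = "Dom A s" and Z = "Cod A s"]) (simp_all add: Hom_def)
  then show ?thesis by (simp add: stalk_cone_Diff[OF s'] loc_Comp)
qed

text \<open>The shifted cone \<open>C\<close> lives in degrees \<open>-n - 1\<close> and
  \<open>-n\<close>. For \<open>n > 0\<close> these are negative and \<open>g\<close> vanishes.
  Otherwise the map \<open>r\<close> from the cocone of \<open>g\<close> to \<open>Z\<close> has a
  cone isomorphic to \<open>C\<close>, so it is invertible in \<open>V\<close> and
  \<open>\<phi>\<close> lifts; what has to be shown is that the degree \<open>0\<close> part of the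
  lift comes from \<open>L\<close>.\<close>

lemma killed_cone_S:
  assumes X: "X \<in> Ob A" and s: "s \<in> S"
  shows "refinement.killed A (points X) fst refines (cone A (stalk A (Dom A s)) (stalk A (Cod A s)) (stalk_map A s))"
proof -
  interpret R: refinement A "points X" fst refines by (rule refinement_points)
  let ?U = "Dom A s" and ?Y = "Cod A s"
  let ?C0 = "cone A (stalk A ?U) (stalk A ?Y) (stalk_map A s)"
  have s': "s \<in> Hom A ?U ?Y" using s S_sub by (auto simp: Hom_def)
  then have [simp]: "s \<in> Arr A" by (simp add: Hom_def)
  have C0: "bounded_complex A ?C0" using cone_bounded[OF _ _ stalk_chain_map[OF s']] stalk_bounded by simp
  have C0_zero: "zero_object A (COb ?C0 i)" if "i \<noteq> 0" "i \<noteq> -1" for i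
    using that zero_object_DSum[OF zero_object_ZeroOb zero_object_ZeroOb] by (simp add: eq_neg_iff_add_eq_0)
  show ?thesis
    unfolding R.killed_def
  proof (intro allI ballI impI)
    fix n p g assume p: "p \<in> points X" and g: "chain_map A (fst p) (shift A n ?C0) g"
    obtain Z \<phi> where p_def: "p = (Z, \<phi>)" by (cases p)
    note Z = pointsD[OF p[unfolded p_def]]
    define C where "C = shift A n ?C0"
    have g: "chain_map A Z C g" using g by (simp add: p_def C_def)
    have Cb: "bounded_complex A C" unfolding C_def using shift_bounded[OF C0] .
    then have C: "is_complex A C" by simp
    have C_zero: "zero_object A (COb C i)" if "i + n \<noteq> 0" "i + n \<noteq> -1" for i
      using C0_zero[OF that] by (simp add: C_def)
    have C_iso: "is_iso L (loc (Diff C (-1)))" if "n = 0"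
      using loc_stalk_cone_Diff_iso[OF s] that by (simp add: C_def)
    have "\<exists>p' \<in> points X. \<exists>r h. refines p' p r \<and> nullhtp (fst p') C (\<lambda>i. Comp A (g i) (r i)) h"
    proof (cases "n > 0")
      case True
      have G: "g i = ZeroArr A (COb Z i) (COb C i)" for i
      proof (cases "i < 0")
        case True
        then show ?thesis using Z(3) chain_mapD(1-3)[OF g, of i] by (intro zero_object_from) (simp_all add: Hom_def)
      next
        case False
        then have "zero_object A (COb C i)" using C_zero[of i] \<open>n > 0\<close> by simp
        then show ?thesis using chain_mapD(1-3)[OF g, of i] by (intro zero_object_to) (simp_all add: Hom_def)
      qed
      have "nullhtp Z C (\<lambda>i. Comp A (g i) (Ident A (COb Z i))) (\<lambda>i. ZeroArr A (COb Z i) (COb C (i - 1)))"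
        using Z(2) C by (intro nullhtpI) (simp_all add: G)
      then show ?thesis using p R.refines_refl[OF p] unfolding p_def fst_conv
        by - (rule bexI[of _ "(Z, \<phi>)"], rule exI[of _ "\<lambda>i. Ident A (COb Z i)"],
          rule exI[of _ "\<lambda>i. ZeroArr A (COb Z i) (COb C (i - 1))"], simp_all)
    next
      case False
      define Z' where "Z' = shift A (-1) (cone A Z C g)"
      define r where "r = (\<lambda>i. Pr1 A (COb Z i) (COb C (i - 1)))"
      note co = cocone_isomorphic[OF Z(1) Cb g, folded Z'_def r_def]
      have Z'b: "bounded_complex A Z'" unfolding Z'_def by (rule shift_bounded[OF cone_bounded[OF Z(1) Cb g]])
      then have Z'c [simp]: "is_complex A Z'" by simp
      have ZO: "COb Z' i = DSum A (COb Z i) (COb C (i - 1))" for i by (simp add: Z'_def)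
      \<comment> \<open>For \<open>n = 0\<close> the lowest nonzero degree of \<open>C\<close> may
        be \<open>-1\<close>, and the cocone moves this term to degree \<open>0\<close>; thus the
        bound just holds.\<close>
      have Z'0: "zero_object A (COb Z' i)" if "i < 0" for i
        unfolding ZO using that False Z(3) C_zero[of "i - 1"] by (intro zero_object_DSum) simp_all
      have "cone A Z' Z r \<in> cone_subcat A S"
        using cone_subcat_closed(2)[OF _ _ co(3)] cone_subcat_closed(1)[OF cone_subcat_closed(3)[OF s], of n]
          cone_bounded[OF Z'b Z(1) co(1)] unfolding Kb_Ob_iff C_def by blast
      from kq_iso[OF Z'b Z(1) co(1) this] obtain t where t: "t \<in> Hom V Z Z'"
        "Comp V t (kq Z' Z r) = Ident V Z'" "Comp V (kq Z' Z r) t = Ident V Z"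
        using V.L.is_isoE[OF _ kq_Hom[OF Z'b Z(1) co(1)]] by blast
      then have [simp]: "t \<in> Arr V" "Dom V t = Z" "Cod V t = Z'" by (auto simp: Hom_def)
      note [simp] = Z(1,2,5,6,7) Z'b co(1)
      define \<phi>' where "\<phi>' = Comp V t \<phi>"
      have \<phi>' [simp]: "\<phi>' \<in> Arr V" "Dom V \<phi>' = stalk A X" "Cod V \<phi>' = Z'" by (simp_all add: \<phi>'_def)
      have r\<phi>': "Comp V (kq Z' Z r) \<phi>' = \<phi>"
        using arg_cong[OF t(3), of "\<lambda>x. Comp V x \<phi>"] by (simp add: \<phi>'_def)
      let ?U = "COb Z 0" and ?P = "COb C (-1)" and ?R = "COb C 0"
      let ?e = "kq Z (stalk A ?U) (deg0 Z)" and ?e' = "kq Z' (stalk A (COb Z' 0)) (deg0 Z')"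
      note [simp] = C chain_mapD(1-3)[OF g]
      have ZO0: "COb Z' 0 = DSum A ?U ?P" using ZO[of 0] by simp
      have e: "chain_map A Z (stalk A ?U) (deg0 Z)" "chain_map A Z' (stalk A (COb Z' 0)) (deg0 Z')"
        using deg0_chain_map Z(3)[of "-1"] Z'0[of "-1"] by simp_all
      have sb [simp]: "bounded_complex A (stalk A Y)" if "Y \<in> Ob A" for Y using that stalk_bounded by blast
      \<comment> \<open>In degree \<open>0\<close> the cocone is \<open>Z\<^sup>0 \<oplus> C\<^sup>-\<^sup>1\<close>.  For \<open>n = 0\<close> the matrix \<open>M\<close> with rows \<open>(1, 0)\<close> and
        \<open>(g, d)\<close> becomes invertible and agrees with the inclusion of \<open>Z\<^sup>0\<close> on the cocone up to homotopy;
        for \<open>n < 0\<close> the term \<open>C\<^sup>-\<^sup>1\<close> is zero.\<close>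
      have "\<exists>M a T. M \<in> Hom A (COb Z' 0) T \<and> a \<in> Hom A ?U T \<and> is_iso L (loc M) \<and>
          Comp V (kq (stalk A (COb Z' 0)) (stalk A T) (stalk_map A M)) ?e'
            = Comp V (kq (stalk A ?U) (stalk A T) (stalk_map A a)) (Comp V ?e (kq Z' Z r))"
      proof (cases "n = 0")
        case True
        let ?M = "Add A (Comp A (In1 A ?U ?R) (Pr1 A ?U ?P)) (Comp A (In2 A ?U ?R) (Add A (Comp A (g 0) (Pr1 A ?U ?P))
          (Comp A (Diff C (-1)) (Pr2 A ?U ?P))))"
        have M: "?M \<in> Hom A (COb Z' 0) (DSum A ?U ?R)" and a: "In1 A ?U ?R \<in> Hom A ?U (DSum A ?U ?R)"
          by (simp_all add: ZO0 Hom_def)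
        have "is_iso L (loc ?M)"
          by (rule loc_triangular_iso) (use C_iso True in \<open>simp_all add: Hom_def\<close>)
        note cM = stalk_chain_map[OF M] and ca = stalk_chain_map[OF a]
        note l = chain_map_Comp[OF _ _ _ e(2) cM] and rr = chain_map_Comp[OF _ _ _ chain_map_Comp[OF _ _ _ co(1) e(1)] ca]
        have "homotopic A Z' (stalk A (DSum A ?U ?R)) (\<lambda>i. Comp A (stalk_map A ?M i) (deg0 Z' i))
          (\<lambda>i. Comp A (stalk_map A (In1 A ?U ?R) i) (Comp A (deg0 Z i) (r i)))"
        proof (rule to_stalk_homotopic[OF _ _ l rr])
          \<comment> \<open>\<open>M\<close> and the inclusion of \<open>Z\<close> in degree
            \<open>0\<close> differ by the row \<open>(g, d)\<close>, which is the
            \<open>C\<close>-component of the differential of the cone; the sign comes from the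
            shift in the cocone.\<close>
          let ?b = "neg A (Comp A (In2 A ?U ?R) (Pr2 A (COb Z 1) ?R))"
          have ZO1: "COb Z' 1 = DSum A (COb Z 1) ?R" using ZO[of 1] by simp
          show "?b \<in> Hom A (COb Z' 1) (DSum A ?U ?R)" by (simp add: ZO1 Hom_def)
          have D: "Diff Z' 0 = neg A (Diff (cone A Z C g) (-1))" by (simp add: Z'_def)
          have "Comp A ?b (Diff Z' 0) = Comp A (In2 A ?U ?R) (Add A (Comp A (g 0) (Pr1 A ?U ?P)) (Comp A (Diff C (-1)) (Pr2 A ?U ?P)))"
            using cone_Diff[OF Z(2) C g, where i = "-1"] cone_Diff(5)[OF Z(2) C g, where i = "-1" and j = 1 and k = 0]
            by (simp add: D)
          then show "Comp A (stalk_map A ?M 0) (deg0 Z' 0) = Add A (Comp A (stalk_map A (In1 A ?U ?R) 0) (Comp A (deg0 Z 0) (r 0)))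
              (Comp A ?b (Diff Z' 0))"
            by (simp add: deg0_def r_def ZO0)
        qed simp_all
        then have "kq Z' (stalk A (DSum A ?U ?R)) (\<lambda>i. Comp A (stalk_map A ?M i) (deg0 Z' i))
          = kq Z' (stalk A (DSum A ?U ?R)) (\<lambda>i. Comp A (stalk_map A (In1 A ?U ?R) i) (Comp A (deg0 Z i) (r i)))"
          by (intro kq_eqI l rr) simp_all
        then have "Comp V (kq (stalk A (COb Z' 0)) (stalk A (DSum A ?U ?R)) (stalk_map A ?M)) ?e'
            = Comp V (kq (stalk A ?U) (stalk A (DSum A ?U ?R)) (stalk_map A (In1 A ?U ?R))) (Comp V ?e (kq Z' Z r))"
          using kq_Comp[OF _ _ _ e(2) cM] kq_Comp[OF _ _ _ co(1) e(1)] kq_Comp[OF _ _ _ chain_map_Comp[OF _ _ _ co(1) e(1)] ca]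
          by simp
        then show ?thesis using M a \<open>is_iso L (loc ?M)\<close> by blast
      next
        case n: False
        let ?M = "Ident A (COb Z' 0)" and ?a = "In1 A ?U ?P"
        have M: "?M \<in> Hom A (COb Z' 0) (COb Z' 0)" and a: "?a \<in> Hom A ?U (COb Z' 0)"
          by (simp_all add: ZO0 Hom_def)
        have "is_iso L (loc ?M)"
          by (rule L.is_isoI[of _ "COb Z' 0" "COb Z' 0" "loc ?M"]) (simp_all add: loc_Ident Hom_def)
        note cM = stalk_chain_map[OF M] and ca = stalk_chain_map[OF a]
        note l = chain_map_Comp[OF _ _ _ e(2) cM] and rr = chain_map_Comp[OF _ _ _ chain_map_Comp[OF _ _ _ co(1) e(1)] ca]
        have "Comp A ?a (Pr1 A ?U ?P) = Ident A (DSum A ?U ?P)"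
        proof (rule DSum_eqI[of ?U ?P])
          show "Comp A (Pr2 A ?U ?P) (Comp A ?a (Pr1 A ?U ?P)) = Comp A (Pr2 A ?U ?P) (Ident A (DSum A ?U ?P))"
            using n False C_zero[of "-1"]
            by (intro zero_object_to_eq[of ?P _ "DSum A ?U ?P"]) (simp_all add: Hom_def)
        qed simp_all
        then have "(\<lambda>i. Comp A (stalk_map A ?M i) (deg0 Z' i)) = (\<lambda>i. Comp A (stalk_map A ?a i) (Comp A (deg0 Z i) (r i)))"
          by (intro to_stalk_eqI[OF l rr]) (simp_all add: deg0_def r_def ZO0)
        then have "Comp V (kq (stalk A (COb Z' 0)) (stalk A (COb Z' 0)) (stalk_map A ?M)) ?e'
            = Comp V (kq (stalk A ?U) (stalk A (COb Z' 0)) (stalk_map A ?a)) (Comp V ?e (kq Z' Z r))"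
          using kq_Comp[OF _ _ _ e(2) cM] kq_Comp[OF _ _ _ co(1) e(1)] kq_Comp[OF _ _ _ chain_map_Comp[OF _ _ _ co(1) e(1)] ca]
          by simp
        then show ?thesis using M a \<open>is_iso L (loc ?M)\<close> by blast
      qed
      then obtain M a T where M: "M \<in> Hom A (COb Z' 0) T" and a: "a \<in> Hom A ?U T" and Mi: "is_iso L (loc M)"
        and Me: "Comp V (kq (stalk A (COb Z' 0)) (stalk A T) (stalk_map A M)) ?e'
            = Comp V (kq (stalk A ?U) (stalk A T) (stalk_map A a)) (Comp V ?e (kq Z' Z r))" by blast
      obtain m where m: "m \<in> Hom L T (COb Z' 0)" "Comp L m (loc M) = Ident L (COb Z' 0)"
        using L.is_isoE[OF Mi P.ArrMap_Hom[OF M]] unfolding loc_ObMap by blast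
      obtain \<theta> where \<theta>: "\<theta> \<in> Hom L X ?U" "Comp V ?e \<phi> = ArrMap Q \<theta>" using Z(8) by blast
      have lM: "loc M \<in> Hom L (COb Z' 0) T" and la: "loc a \<in> Hom L ?U T" using P.ArrMap_Hom M a by fastforce+
      have H: "ArrMap Q m \<in> Hom V (stalk A T) (stalk A (COb Z' 0))" "ArrMap Q (loc M) \<in> Hom V (stalk A (COb Z' 0)) (stalk A T)"
        "ArrMap Q (loc a) \<in> Hom V (stalk A ?U) (stalk A T)" "?e \<in> Hom V Z (stalk A ?U)" "?e' \<in> Hom V Z' (stalk A (COb Z' 0))"
        "kq Z' Z r \<in> Hom V Z' Z" "\<phi>' \<in> Hom V (stalk A X) Z'"
        using Q_Hom m(1) lM la kq_Hom e co(1) by (simp_all add: Hom_def)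
      then have [simp]: "ArrMap Q m \<in> Arr V" "Dom V (ArrMap Q m) = stalk A T" "Cod V (ArrMap Q m) = stalk A (COb Z' 0)"
        "ArrMap Q (loc M) \<in> Arr V" "Dom V (ArrMap Q (loc M)) = stalk A (COb Z' 0)" "Cod V (ArrMap Q (loc M)) = stalk A T"
        "ArrMap Q (loc a) \<in> Arr V" "Dom V (ArrMap Q (loc a)) = stalk A ?U" "Cod V (ArrMap Q (loc a)) = stalk A T"
        "?e \<in> Arr V" "Dom V ?e = Z" "Cod V ?e = stalk A ?U" "?e' \<in> Arr V" "Dom V ?e' = Z'" "Cod V ?e' = stalk A (COb Z' 0)"
        by (simp_all add: Hom_def)
      \<comment> \<open>Insert the inverse \<open>m\<close> of \<open>M\<close> in \<open>L\<close>,
        replace \<open>M\<close> after \<open>?e'\<close> by \<open>a\<close> after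
        \<open>?e\<close> and \<open>r\<close>, and use that \<open>r\<close> carries
        \<open>\<phi>'\<close> to \<open>\<phi>\<close>, whose degree \<open>0\<close> part is the
        image of \<open>\<theta>\<close>.\<close>
      have "Comp V ?e' \<phi>' = Comp V (Comp V (ArrMap Q m) (ArrMap Q (loc M))) (Comp V ?e' \<phi>')"
        unfolding Q_Comp[OF lM m(1), symmetric] m(2) using Q_Ident[of "COb Z' 0"] by simp
      also have "\<dots> = Comp V (ArrMap Q m) (Comp V (Comp V (ArrMap Q (loc M)) ?e') \<phi>')" by simp
      also have "\<dots> = Comp V (ArrMap Q m) (Comp V (ArrMap Q (loc a)) (Comp V ?e (Comp V (kq Z' Z r) \<phi>')))"
        unfolding Q_loc[OF M] Me unfolding Q_loc[OF a, symmetric] by simp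
      also have "\<dots> = ArrMap Q (Comp L m (Comp L (loc a) \<theta>))"
        unfolding r\<phi>' \<theta>(2) using Q_Comp[OF \<theta>(1) la] Q_Comp[OF L.Comp_Hom[OF \<theta>(1) la] m(1)] by simp
      finally have "Comp V ?e' \<phi>' \<in> ArrMap Q ` Hom L X (COb Z' 0)"
        using L.Comp_Hom[OF L.Comp_Hom[OF \<theta>(1) la] m(1)] by blast
      then have "(Z', \<phi>') \<in> points X" unfolding points_def using Z'0 H(7) by simp
      moreover have "refines (Z', \<phi>') p r" using r\<phi>' by (simp add: refines_def p_def)
      moreover obtain h where "nullhtp Z' C (\<lambda>i. Comp A (g i) (r i)) h" using co(2) unfolding r_def by blast
      ultimately show ?thesis
        by - (rule bexI[of _ "(Z', \<phi>')"], rule exI[of _ r], rule exI[of _ h], simp_all)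
    qed
    then show "\<exists>p' \<in> points X. \<exists>r h. refines p' p r \<and> nullhtp (fst p') (shift A n ?C0) (\<lambda>i. Comp A (g i) (r i)) h"
      unfolding C_def .
  qed
qed

text \<open>The bounded killed complexes form a strict triangulated class that contains the
  generators, hence also the smallest such class.\<close>

theorem killed_cone_subcat:
  assumes X: "X \<in> Ob A" and Z: "Z \<in> cone_subcat A S"
  shows "refinement.killed A (points X) fst refines Z" "bounded_complex A Z"
proof -
  interpret R: refinement A "points X" fst refines by (rule refinement_points)
  have "bounded_complex A (cone A (stalk A (Dom A s)) (stalk A (Cod A s)) (stalk_map A s))" if "s \<in> S" for s
    using cone_bounded[OF stalk_bounded stalk_bounded stalk_chain_map, of "Dom A s" "Cod A s" s] that S_sub
    by (auto simp: Hom_def)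
  then have "cone_subcat A S \<subseteq> {Z. bounded_complex A Z \<and> R.killed Z}"
    unfolding cone_subcat_def using R.killed_strict_triangulated killed_cone_S[OF X] by blast
  then show "R.killed Z" "bounded_complex A Z" using Z by blast+
qed

section \<open>Fullness: arrows of the quotient that are chain maps on a point\<close>

definition resolved :: "'o \<Rightarrow> ('o, 'm) cplx \<Rightarrow> (('o, 'm) cplx, ('o, 'm) ho_arr) gz_arr \<Rightarrow> bool" where
  "resolved X M \<psi> \<longleftrightarrow> (\<exists>Z \<phi> f. (Z, \<phi>) \<in> points X \<and> bounded_complex A M \<and> chain_map A Z M f \<and> \<psi> = Comp V (kq Z M f) \<phi>)"

lemma resolvedI:
  "(Z, \<phi>) \<in> points X \<Longrightarrow> bounded_complex A M \<Longrightarrow> chain_map A Z M f \<Longrightarrow> resolved X M (Comp V (kq Z M f) \<phi>)"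
  unfolding resolved_def by blast

lemma resolved_Hom: "resolved X M \<psi> \<Longrightarrow> \<psi> \<in> Hom V (stalk A X) M"
  unfolding resolved_def using kq_Hom pointsD(1,4) V.L.Comp_Hom by metis

text \<open>Plays the part of a calculus of fractions. Only the inverse \<open>t\<close> of a map
  \<open>u\<close> with cone in \<open>cone_subcat\<close> is critical: the composite of
  \<open>f\<close> with the inclusion of \<open>M\<close> in that cone dies on a refinement
  \<open>r\<close>, so \<open>f r\<close> lifts to \<open>f'\<close> along \<open>u\<close> up to
  homotopy, and \<open>t \<psi>\<close> is \<open>f'\<close> after \<open>\<phi>'\<close>.\<close>

lemma resolved_Comp:
  assumes X: "X \<in> Ob A" and \<chi>: "\<chi> \<in> Arr V"
  shows "\<forall>\<psi>. resolved X (Dom V \<chi>) \<psi> \<longrightarrow> resolved X (Cod V \<chi>) (Comp V \<chi> \<psi>)"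
  using \<chi>
proof (induction rule: V.gz_induct)
  case (Ident M)
  then have [simp]: "Dom V (Ident V M) = M" "Cod V (Ident V M) = M" by simp_all
  show ?case using resolved_Hom V.L.Ident_Comp by (metis \<open>Dom V (Ident V M) = M\<close> \<open>Cod V (Ident V M) = M\<close>)
next
  case (loc a)
  then obtain M N u where a: "a = ho_class A M N u" "bounded_complex A M" "bounded_complex A N" "chain_map A M N u"
    by (auto simp: Kb_def)
  note [simp] = a(2-4)
  have l: "V.loc a = kq M N u" by (simp add: a kq_def)
  show ?case
  proof (intro allI impI)
    fix \<psi> assume "resolved X (Dom V (V.loc a)) \<psi>"
    then obtain Z \<phi> f where p: "(Z, \<phi>) \<in> points X" and f: "chain_map A Z M f" and \<psi>: "\<psi> = Comp V (kq Z M f) \<phi>"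
      unfolding l resolved_def by auto
    note [simp] = pointsD(1,2,5-7)[OF p] f
    have "Comp V (kq M N u) \<psi> = Comp V (Comp V (kq M N u) (kq Z M f)) \<phi>" by (simp add: \<psi>)
    also have "Comp V (kq M N u) (kq Z M f) = kq Z N (\<lambda>i. Comp A (u i) (f i))" by (rule kq_Comp) simp_all
    finally show "resolved X (Cod V (V.loc a)) (Comp V (V.loc a) \<psi>)"
      unfolding l using resolvedI[OF p a(3) chain_map_Comp[OF _ _ _ f a(4)]] by simp
  qed
next
  case (inverse w t)
  then obtain M' M u where w: "w = ho_class A M' M u" "bounded_complex A M'" "bounded_complex A M" "chain_map A M' M u"
    "cone A M' M u \<in> cone_subcat A S" unfolding cone_in_def by blast
  have c [simp]: "is_complex A M'" "is_complex A M" using w by simp_all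
  note [simp] = w(2-4) 
  have l: "V.loc w = kq M' M u" by (simp add: w kq_def)
  have wd: "Dom (Kb A) w = M'" "Cod (Kb A) w = M" by (simp_all add: w(1) Kb_def ho_class_def)
  note t = inverse(2-6)[unfolded wd l]
  note [simp] = t(1-3)
  show ?case
  proof (intro allI impI)
    fix \<psi> assume "resolved X (Dom V t) \<psi>"
    then obtain Z \<phi> f where p: "(Z, \<phi>) \<in> points X" and f: "chain_map A Z M f" and \<psi>: "\<psi> = Comp V (kq Z M f) \<phi>"
      unfolding resolved_def by auto
    note Z [simp] = pointsD(1,2,5-7)[OF p] f
    interpret R: refinement A "points X" fst refines by (rule refinement_points)
    let ?g = "\<lambda>i. Comp A (In2 A (COb M' (i + 1)) (COb M i)) (f i)"
    have "chain_map A M (cone A M' M u) (\<lambda>i. In2 A (COb M' (i + 1)) (COb M i))"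
      using cone_Diff[OF c w(4)] cone_Diff_In(2)[OF c w(4)] by (intro chain_mapI) simp_all
    from chain_map_Comp[OF Z(2) c(2) cone_complex[OF c w(4)] f this]
    have "chain_map A (fst (Z, \<phi>)) (shift A 0 (cone A M' M u)) ?g" by (simp add: shift_0)
    from R.killedE[OF killed_cone_subcat(1)[OF X w(5)] p this]
    obtain p' r h where p': "p' \<in> points X" "refines p' (Z, \<phi>) r"
      and "nullhtp (fst p') (shift A 0 (cone A M' M u)) (\<lambda>i. Comp A (?g i) (r i)) h" by blast
    moreover obtain Z' \<phi>' where p'_def: "p' = (Z', \<phi>')" by (cases p')
    ultimately have r: "chain_map A Z' Z r" "Comp V (kq Z' Z r) \<phi>' = \<phi>"
      and h: "nullhtp Z' (cone A M' M u) (\<lambda>i. Comp A (?g i) (r i)) h" and p': "(Z', \<phi>') \<in> points X"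
      by (simp_all add: refines_def shift_0)
    note Z' [simp] = pointsD(1,2,5-7)[OF p'] r(1)
    note fr = chain_map_Comp[OF Z'(2) Z(2) c(2) r(1) f]
    have h': "nullhtp Z' (cone A M' M u) (\<lambda>i. Comp A (In2 A (COb M' (i + 1)) (COb M i)) (Comp A (f i) (r i))) h"
      using h chain_mapD(1-3)[OF f] chain_mapD(1-3)[OF r(1)] by simp
    obtain f' where f': "chain_map A Z' M' f'" "homotopic A Z' M (\<lambda>i. Comp A (f i) (r i)) (\<lambda>i. Comp A (u i) (f' i))"
      using lift_along_null_cone[OF c Z'(2) w(4) fr h'] by blast
    note [simp] = f'(1)
    have "\<psi> = Comp V (Comp V (kq Z M f) (kq Z' Z r)) \<phi>'"
      unfolding \<psi> r(2)[symmetric] by simp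
    also have "Comp V (kq Z M f) (kq Z' Z r) = kq Z' M (\<lambda>i. Comp A (f i) (r i))"
      by (rule kq_Comp) simp_all
    also have "\<dots> = kq Z' M (\<lambda>i. Comp A (u i) (f' i))"
      by (rule kq_eqI[OF Z'(2) c(2) fr chain_map_Comp[OF Z'(2) c f'(1) w(4)] f'(2)])
    also have "\<dots> = Comp V (kq M' M u) (kq Z' M' f')"
      by (rule kq_Comp[symmetric]) simp_all
    finally have "Comp V t \<psi> = Comp V (Comp V t (kq M' M u)) (Comp V (kq Z' M' f') \<phi>')" by simp
    also have "\<dots> = Comp V (kq Z' M' f') \<phi>'" unfolding t(4) by simp
    finally show "resolved X (Cod V t) (Comp V t \<psi>)"
      using resolvedI[OF p' w(2) f'(1)] t(3) by simp
  qed
next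
  case (Comp f g)
  show ?case
  proof (intro allI impI)
    fix \<psi> assume "resolved X (Dom V (Comp V g f)) \<psi>"
    then have \<psi>: "resolved X (Dom V f) \<psi>" using Comp(1-3) by simp
    then have 1: "resolved X (Cod V (Comp V g f)) (Comp V g (Comp V f \<psi>))"
      using Comp by (simp del: split_paired_All)
    have "Comp V g (Comp V f \<psi>) = Comp V (Comp V g f) \<psi>"
      using Comp(1-3) HomD[OF resolved_Hom[OF \<psi>]] by simp
    with 1 show "resolved X (Cod V (Comp V g f)) (Comp V (Comp V g f) \<psi>)" by simp
  qed
qed

text \<open>Start from the point given by \<open>X\<close> and its identity. By
  \<open>resolved_Comp\<close> the arrow \<open>\<psi>\<close> is then \<open>f\<close> after
  \<open>\<phi>\<close>, and \<open>f\<close> factors through degree \<open>0\<close>, where the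
  definition of points provides an arrow of \<open>L\<close>.\<close>

theorem Q_full:
  assumes X: "X \<in> Ob A" and Y: "Y \<in> Ob A"
  shows "Hom V (stalk A X) (stalk A Y) \<subseteq> ArrMap Q ` Hom L X Y"
proof
  fix \<psi> assume \<psi>: "\<psi> \<in> Hom V (stalk A X) (stalk A Y)"
  note XY [simp] = X Y stalk_bounded[OF X] stalk_bounded[OF Y]
  have I: "chain_map A (stalk A X) (stalk A X) (\<lambda>i. Ident A (COb (stalk A X) i))"
    by (rule chain_map_Ident) simp
  have "deg0 (stalk A X) = (\<lambda>i. Ident A (COb (stalk A X) i))"
    using ZeroOb_Ident by (auto simp: deg0_def fun_eq_iff)
  then have "Comp V (kq (stalk A X) (stalk A X) (deg0 (stalk A X))) (Ident V (stalk A X)) = ArrMap Q (Ident L X)"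
    using V.L.Comp_Ident[OF kq_Hom[OF XY(3,3) I]] kq_Ident[OF XY(3)] Q_Ident[OF X] by simp
  then have p: "(stalk A X, Ident V (stalk A X)) \<in> points X"
    using V.L.Ident_Hom[of "stalk A X"] L.Ident_Hom[of X] zero_object_ZeroOb by (simp add: points_def Kb_Ob_iff)
  have "resolved X (stalk A X) (Ident V (stalk A X))"
    unfolding resolved_def using p I V.L.Comp_Ident[OF kq_Hom[OF XY(3,3) I]] kq_Ident[OF XY(3)] XY(3) by metis
  then have "resolved X (stalk A Y) \<psi>"
    using resolved_Comp[OF X, of \<psi>] HomD[OF \<psi>] V.L.Comp_Ident[OF \<psi>] by metis
  then obtain Z \<phi> f where p: "(Z, \<phi>) \<in> points X" and f: "chain_map A Z (stalk A Y) f" and e: "\<psi> = Comp V (kq Z (stalk A Y) f) \<phi>"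
    unfolding resolved_def by blast
  note Z [simp] = pointsD(1,2,5-7)[OF p] f
  have f0: "f 0 \<in> Hom A (COb Z 0) Y" using chain_mapD(1-3)[OF f, of 0] by (simp add: Hom_def)
  have Z0: "COb Z 0 \<in> Ob A" by simp
  note d = deg0_chain_map[OF Z(2) pointsD(3)[OF p, of "-1"]]
  have d: "chain_map A Z (stalk A (COb Z 0)) (deg0 Z)" using d by simp
  note sf = stalk_chain_map[OF f0]
  \<comment> \<open>Both sides are chain maps into a complex concentrated in degree
    \<open>0\<close>, so agreement in degree \<open>0\<close> suffices.\<close>
  have "f = (\<lambda>i. Comp A (stalk_map A (f 0) i) (deg0 Z i))"
    using chain_mapD(1-3)[OF f, of 0] Y
    by (intro to_stalk_eqI[OF f chain_map_Comp[OF _ _ _ d sf]]) (simp_all add: deg0_def)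
  then have "kq Z (stalk A Y) f = kq Z (stalk A Y) (\<lambda>i. Comp A (stalk_map A (f 0) i) (deg0 Z i))" by simp
  also have "\<dots> = Comp V (ArrMap Q (loc (f 0))) (kq Z (stalk A (COb Z 0)) (deg0 Z))"
    unfolding Q_loc[OF f0] by (rule kq_Comp[symmetric]) (use d sf stalk_bounded[OF Z0] in simp_all)
  finally have "\<psi> = Comp V (ArrMap Q (loc (f 0))) (Comp V (kq Z (stalk A (COb Z 0)) (deg0 Z)) \<phi>)"
    using V.L.Comp_assoc[OF pointsD(4)[OF p] kq_Hom[OF Z(1) stalk_bounded[OF Z0] d] Q_Hom[OF P.ArrMap_Hom[OF f0, simplified]]]
    by (simp add: e)
  moreover obtain \<theta> where \<theta>: "\<theta> \<in> Hom L X (COb Z 0)" "Comp V (kq Z (stalk A (COb Z 0)) (deg0 Z)) \<phi> = ArrMap Q \<theta>"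
    using pointsD(8)[OF p] by blast
  moreover have "loc (f 0) \<in> Hom L (COb Z 0) Y" using P.ArrMap_Hom[OF f0] by simp
  ultimately show "\<psi> \<in> ArrMap Q ` Hom L X Y"
    using Q_Comp[OF \<theta>(1), of "loc (f 0)" Y] L.Comp_Hom[OF \<theta>(1), of "loc (f 0)" Y] by (metis image_eqI)
qed

text \<open>The functor from \<open>V\<close> to the homotopy category of \<open>L\<close>, composed
  with \<open>Q\<close>, is the embedding of \<open>L\<close>, and this embedding is
  faithful.\<close>

theorem Q_faithful: "inj_on (ArrMap Q) (Hom L X Y)"
proof (rule inj_onI)
  fix \<theta> \<eta> assume \<theta>: "\<theta> \<in> Hom L X Y" and \<eta>: "\<eta> \<in> Hom L X Y" and e: "ArrMap Q \<theta> = ArrMap Q \<eta>"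
  interpret B: additive_category gz_addcat by (rule gz_addcat_additive)
  \<comment> \<open>\<open>gz_addcat\<close> and \<open>L\<close> have the same objects, arrows and
    composition but are different records; functors are carried from one to the other.\<close>
  have LB: "is_functor L D F" if "is_functor gz_addcat D F" for D and F :: "('o, ('o, 'm) gz_arr, 'p, 'n) fctr"
    using that L.category_axioms unfolding is_functor_def is_functor_axioms_def by simp
  interpret F: strict_additive_functor A gz_addcat "gz_loc A S"
  proof
    show "\<And>X. X \<in> Ob A \<Longrightarrow> ObMap (gz_loc A S) X \<in> Ob gz_addcat" by simp
  qed (simp_all add: Hom_def loc_Ident loc_Add loc_Comp)
  let ?W = "cone_in A (cone_subcat A S)"
  have inv: "is_iso (Kb gz_addcat) (ArrMap F.Kb_map w)" if "w \<in> ?W" for w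
  proof (rule F.Kb_map_inverts[OF S_sub _ that])
    fix s assume s: "s \<in> S"
    show "is_iso gz_addcat (loc s)"
      using gz_loc_inverts[OF S_sub s] unfolding is_iso_def inverse_arrows_def by simp
  qed
  let ?G = "gz_lift (Kb A) (Kb gz_addcat) F.Kb_map"
  note G = V.gz_universal(1,2)[OF V.S_Arr F.Kb_map_functor inv]
  have "is_functor (gz_add A S) V fid"
    unfolding gz_add_def verdier_quotient_def by (rule full_subcat_inclusion[OF V.L.category_axioms])
  from fcomp_functor[OF fcomp_functor[OF Q_functor this] G(1)]
  have GQ: "is_functor L (Kb gz_addcat) (fcomp ?G (fcomp fid Q))" .
  have EB: "is_functor L (Kb gz_addcat) (Kb_embed gz_addcat)" by (rule LB[OF B.Kb_embed_functor])
  have "ArrMap (fcomp ?G (fcomp fid Q)) \<phi> = ArrMap (Kb_embed gz_addcat) \<phi>" if "\<phi> \<in> Arr L" for \<phi>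
  \<comment> \<open>Functors on \<open>L\<close> need only be compared on objects and on images of
    arrows of \<open>A\<close>, where every functor involved is explicit.\<close>
  proof (rule functor_eqI[OF GQ EB _ _ that])
    fix X assume X: "X \<in> Ob A"
    show "ObMap (fcomp ?G (fcomp fid Q)) X = ObMap (Kb_embed gz_addcat) X"
      using F.map_stalk[OF X] by (simp add: fcomp_def fid_def Q_ObMap gz_lift_def F.Kb_map_ObMap Kb_embed_def)
  next
    fix f assume f: "f \<in> Arr A"
    then have f': "f \<in> Hom A (Dom A f) (Cod A f)" by (simp add: Hom_def)
    have "ArrMap (Kb_embed A) f \<in> Arr (Kb A)"
      using is_functor.ArrMap_simps(1)[OF Kb_embed_functor f] .
    then have "ArrMap ?G (V.loc (ArrMap (Kb_embed A) f)) = ArrMap F.Kb_map (ArrMap (Kb_embed A) f)"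
      using G(2) by (simp add: feq_def fcomp_def)
    also have "\<dots> = ArrMap (Kb_embed gz_addcat) (loc f)"
      using f F.Kb_map_ArrMap[OF _ _ stalk_chain_map[OF f']] F.map_stalk F.map_stalk_map[OF f]
      by (simp add: Kb_embed_def)
    finally show "ArrMap (fcomp ?G (fcomp fid Q)) (loc f) = ArrMap (Kb_embed gz_addcat) (loc f)"
      using Q_loc[OF f'] f by (simp add: fcomp_def fid_def kq_def Kb_embed_def)
  qed
  then have "ArrMap (Kb_embed gz_addcat) \<phi> = ArrMap ?G (ArrMap Q \<phi>)" if "\<phi> \<in> Arr L" for \<phi>
    using that by (simp add: fcomp_def fid_def)
  from this[of \<theta>] this[of \<eta>] have "ArrMap (Kb_embed gz_addcat) \<theta> = ArrMap (Kb_embed gz_addcat) \<eta>"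
    using \<theta> \<eta> e by (simp add: Hom_def)
  then show "\<theta> = \<eta>" using B.Kb_embed_faithful[of \<theta> X Y \<eta>] \<theta> \<eta> by simp
qed

text \<open>On objects \<open>Q\<close> is injective because \<open>X\<close> is recovered as the
  term of its complex in degree \<open>0\<close>; fullness and faithfulness give the bijections on
  hom sets.\<close>

theorem Q_isomorphism: "cat_isomorphism L (gz_add A S) Q"
proof (rule cat_isomorphismI[OF Q_functor])
  have "X = COb (stalk A X) 0" for X by simp
  then show "inj_on (ObMap Q) (Ob L)" unfolding Q_ObMap by (metis inj_onI)
  show "Ob (gz_add A S) \<subseteq> ObMap Q ` Ob L"
    by (auto simp: gz_add_def full_subcat_def Q_ObMap)
  fix X Y assume XY: "X \<in> Ob L" "Y \<in> Ob L"
  show "inj_on (ArrMap Q) (Hom L X Y)" by (rule Q_faithful)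
  show "Hom (gz_add A S) (ObMap Q X) (ObMap Q Y) \<subseteq> ArrMap Q ` Hom L X Y"
    using Q_full[of X Y] XY by (auto simp: gz_add_Hom_iff verdier_quotient_def Q_ObMap)
qed

end

theorem corollary2p2p3:
  fixes A :: "('o, 'm) addcat" and S :: "'m set"
  assumes "additive_category A"
    and "S \<subseteq> Arr A"
    and "\<And>X. X \<in> Ob A \<Longrightarrow> Ident A X \<in> S"
    and "\<And>s t. s \<in> S \<Longrightarrow> t \<in> S \<Longrightarrow> dsum_arr A s t \<in> S"
  shows "cat_isomorphism (gz A S) (gz_add A S) (gz_to_gz_add A S)"
proof -
  interpret additive_localization A S
    using assms by (intro additive_localization.intro additive_localization_axioms.intro)
  show ?thesis by (rule Q_isomorphism)
qed

end
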